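(* Consider a network contribution game (with arbitrary budgets) with reward functions $f_e(x,y)=h_e(\min(x,y))$ for all $e\in E$, where all $h_e$ are continuous, piecewise differentiable, and concave. Then a pairwise equilibrium always exists. It is possible to compute pairwise equilibria efficiently within any desired precision. Moreover, if all $h_e$ are strictly concave, then the pairwise equilibrium is unique (where, by convention, in an equilibrium both endpoints of each edge contribute the same amount to that edge).
   Context: Network contribution game: a finite simple undirected graph $G=(V,E)$; every node $v\in V$ is a player with budget $B_v\ge 0$. Let $E_v$ be the set of edges incident to $v$. A strategy of $v$ is a function $s_v:E_v\to\mathbb{R}_{\ge 0}$ with $\sum_{e\in E_v}s_v(e)\le B_v$; a state $s=(s_v)_{v\in V}$ consists of one strategy per player. Each edge $e=(u,v)$ has a reward function $f_e:\mathbb{R}_{\ge 0}^2\to\mathbb{R}_{\ge 0}$; here $f_e(x,y)=h_e(\min(x,y))$ with $h_e:\mathbb{R}_{\ge0}\to\mathbb{R}_{\ge0}$ nondecreasing. The utility of $v$ is $w_v(s)=\sum_{e=(v,u)\in E_v}f_e(s_v(e),s_u(e))$. A state $s$ is a (pure) Nash equilibrium if $w_v(s)\ge w_v(s_v',s_{-v})$ for every player $v$ and every strategy $s_v'$. An improving bilateral deviation in $s$ is a pair of strategies $(s_u',s_v')$ of two players $u\neq v$ with $w_u(s_u',s_v',s_{-u,v})>w_u(s)$ and $w_v(s_u',s_v',s_{-u,v})>w_v(s)$. A pairwise equilibrium is a Nash equilibrium that admits no improving bilateral deviation. Convention for minimum effort games: since only the minimum contribution to an edge matters, it is assumed without loss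 of generality that in every pairwise equilibrium $s$ there is for each edge $e=(u,v)$ a single value $s_e$ with $s_u(e)=s_v(e)=s_e$. "Efficiently within any desired precision" means in time polynomial in the size of $G$, the encoding of the budgets $B_v$, and the number of bits of precision desired for representing the solution. *)

theory Defs
  imports
    "HOL-Analysis.Analysis"
    "HOL-Computational_Algebra.Polynomial"
    "HOL-Library.FuncSet"
    "HOL-Library.Log_Nat"
    "HOL-Library.More_List"
begin

section \<open>Network contribution games\<close>

definition simple_graph :: "'a set \<Rightarrow> 'a set set \<Rightarrow> bool" where
  "simple_graph V E \<longleftrightarrow> finite V \<and> (\<forall>e\<in>E. e \<subseteq> V \<and> card e = 2)"

definition incident :: "'a set set \<Rightarrow> 'a \<Rightarrow> 'a set set" where
  "incident E v = {e \<in> E. v \<in> e}"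

text \<open>
  A strategy of a player is a function on the incident edges only, so strategies and states are
  extensional functions; equality of two states is then equality of all contributions.
\<close>

definition strategies :: "'a set set \<Rightarrow> ('a \<Rightarrow> real) \<Rightarrow> 'a \<Rightarrow> ('a set \<Rightarrow> real) set" where
  "strategies E B v = {x \<in> incident E v \<rightarrow>\<^sub>E {0..}. (\<Sum>e\<in>incident E v. x e) \<le> B v}"

definition states :: "'a set \<Rightarrow> 'a set set \<Rightarrow> ('a \<Rightarrow> real) \<Rightarrow> ('a \<Rightarrow> 'a set \<Rightarrow> real) set" where
  "states V E B = (\<Pi>\<^sub>E v\<in>V. strategies E B v)"

text \<open>
  In a simple graph the edges at \<open>v\<close> correspond to the neighbours \<open>u\<close> of \<open>v\<close>. The first argument of
  a reward function is the contribution of the player whose utility is evaluated.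
\<close>

definition utility ::
    "'a set set \<Rightarrow> ('a set \<Rightarrow> real \<Rightarrow> real \<Rightarrow> real) \<Rightarrow> ('a \<Rightarrow> 'a set \<Rightarrow> real) \<Rightarrow> 'a \<Rightarrow> real" where
  "utility E f s v = (\<Sum>u | {v, u} \<in> E. f {v, u} (s v {v, u}) (s u {v, u}))"

definition nash_equilibrium ::
    "'a set \<Rightarrow> 'a set set \<Rightarrow> ('a \<Rightarrow> real) \<Rightarrow> ('a set \<Rightarrow> real \<Rightarrow> real \<Rightarrow> real) \<Rightarrow>
     ('a \<Rightarrow> 'a set \<Rightarrow> real) \<Rightarrow> bool" where
  "nash_equilibrium V E B f s \<longleftrightarrow> s \<in> states V E B \<and>
     (\<forall>v\<in>V. \<forall>x\<in>strategies E B v. utility E f s v \<ge> utility E f (s(v := x)) v)"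

definition improving_bilateral_deviation ::
    "'a set \<Rightarrow> 'a set set \<Rightarrow> ('a \<Rightarrow> real) \<Rightarrow> ('a set \<Rightarrow> real \<Rightarrow> real \<Rightarrow> real) \<Rightarrow>
     ('a \<Rightarrow> 'a set \<Rightarrow> real) \<Rightarrow> 'a \<Rightarrow> 'a \<Rightarrow> ('a set \<Rightarrow> real) \<Rightarrow> ('a set \<Rightarrow> real) \<Rightarrow> bool" where
  "improving_bilateral_deviation V E B f s u v x y \<longleftrightarrow>
     u \<in> V \<and> v \<in> V \<and> u \<noteq> v \<and> x \<in> strategies E B u \<and> y \<in> strategies E B v \<and>
     utility E f (s(u := x, v := y)) u > utility E f s u \<and>
     utility E f (s(u := x, v := y)) v > utility E f s v"

definition pairwise_equilibrium ::
    "'a set \<Rightarrow> 'a set set \<Rightarrow> ('a \<Rightarrow> real) \<Rightarrow> ('a set \<Rightarrow> real \<Rightarrow> real \<Rightarrow> real) \<Rightarrow>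
     ('a \<Rightarrow> 'a set \<Rightarrow> real) \<Rightarrow> bool" where
  "pairwise_equilibrium V E B f s \<longleftrightarrow> nash_equilibrium V E B f s \<and>
     \<not> (\<exists>u v x y. improving_bilateral_deviation V E B f s u v x y)"


section \<open>Minimum effort games with concave rewards\<close>

definition min_effort :: "('a set \<Rightarrow> real \<Rightarrow> real) \<Rightarrow> 'a set \<Rightarrow> real \<Rightarrow> real \<Rightarrow> real" where
  "min_effort h e x y = h e (min x y)"

text \<open>The convention for minimum effort games: both endpoints of an edge contribute equally.\<close>

definition matched :: "'a set set \<Rightarrow> ('a \<Rightarrow> 'a set \<Rightarrow> real) \<Rightarrow> bool" where
  "matched E s \<longleftrightarrow> (\<forall>u v. {u, v} \<in> E \<longrightarrow> s u {u, v} = s v {u, v})"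

definition min_effort_equilibrium ::
    "'a set \<Rightarrow> 'a set set \<Rightarrow> ('a \<Rightarrow> real) \<Rightarrow> ('a set \<Rightarrow> real \<Rightarrow> real) \<Rightarrow>
     ('a \<Rightarrow> 'a set \<Rightarrow> real) \<Rightarrow> bool" where
  "min_effort_equilibrium V E B h s \<longleftrightarrow>
     pairwise_equilibrium V E B (min_effort h) s \<and> matched E s"

text \<open>
  Functions on the nonnegative reals are represented by total functions of which only the values
  on \<open>{0..}\<close> matter. Piecewise differentiability is required on bounded intervals, which allows
  infinitely many pieces as long as they do not accumulate.
\<close>

definition concave_reward :: "(real \<Rightarrow> real) \<Rightarrow> bool" where
  "concave_reward g \<longleftrightarrow>
     (\<forall>x\<ge>0. g x \<ge> 0) \<and> mono_on {0..} g \<and>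
     continuous_on {0..} g \<and> (\<forall>b. g piecewise_differentiable_on {0..b}) \<and> concave_on {0..} g"

definition strictly_concave_on :: "real set \<Rightarrow> (real \<Rightarrow> real) \<Rightarrow> bool" where
  "strictly_concave_on S g \<longleftrightarrow> convex S \<and>
     (\<forall>x\<in>S. \<forall>y\<in>S. \<forall>t. x \<noteq> y \<and> 0 < t \<and> t < 1 \<longrightarrow>
        g ((1 - t) * x + t * y) > (1 - t) * g x + t * g y)"


section \<open>Model of computation\<close>

text \<open>
  Programs run on a random access machine at logarithmic cost. The memory consists of arrays of
  natural numbers (addressed by a constant array name and a computed index) and of arrays of real
  numbers. Evaluating a node of a natural number expression costs one plus the binary length of
  the result.

  The reward functions are arbitrary real functions and not part of the encoded input; they are
  given by an evaluation oracle. \<open>RQuery i a b\<close> is the exact value of the \<open>i\<close>-th function at the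
  rational point \<open>a / b\<close>, where \<open>a\<close> and \<open>b\<close> are numbers that the program has computed and paid for.
  Reals arise only as oracle answers; they can be stored, added, subtracted and compared at unit
  cost. Multiplication of reals and rounding to natural numbers are not available, since at unit
  cost they would give the machine more than polynomial time.
\<close>

datatype nexp =
    NConst nat
  | NRead nat nexp
  | NAdd nexp nexp
  | NSub nexp nexp
  | NMul nexp nexp
  | NDiv nexp nexp

datatype rexp =
    RRead nat nexp
  | RAdd rexp rexp
  | RSub rexp rexp
  | RQuery nexp nexp nexp

datatype bexp =
    NLess nexp nexp
  | RLess rexp rexp
  | BNot bexp
  | BAnd bexp bexp

datatype com =
    Skip
  | NWrite nat nexp nexp
  | RWrite nat nexp rexp
  | Seq com com
  | Cond bexp com com
  | Loop bexp com

type_synonym nmem = "nat \<Rightarrow> nat \<Rightarrow> nat"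
type_synonym rmem = "nat \<Rightarrow> nat \<Rightarrow> real"
type_synonym oracle_fun = "nat \<Rightarrow> real \<Rightarrow> real"

abbreviation binlen :: "nat \<Rightarrow> nat" where
  "binlen \<equiv> floorlog 2"

primrec nval :: "nmem \<Rightarrow> nexp \<Rightarrow> nat" where
  "nval N (NConst c) = c"
| "nval N (NRead x i) = N x (nval N i)"
| "nval N (NAdd a b) = nval N a + nval N b"
| "nval N (NSub a b) = nval N a - nval N b"
| "nval N (NMul a b) = nval N a * nval N b"
| "nval N (NDiv a b) = nval N a div nval N b"

primrec ncost :: "nmem \<Rightarrow> nexp \<Rightarrow> nat" where
  "ncost N (NConst c) = 1 + binlen c"
| "ncost N (NRead x i) = 1 + binlen (nval N (NRead x i)) + ncost N i"
| "ncost N (NAdd a b) = 1 + binlen (nval N (NAdd a b)) + ncost N a + ncost N b"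
| "ncost N (NSub a b) = 1 + binlen (nval N (NSub a b)) + ncost N a + ncost N b"
| "ncost N (NMul a b) = 1 + binlen (nval N (NMul a b)) + ncost N a + ncost N b"
| "ncost N (NDiv a b) = 1 + binlen (nval N (NDiv a b)) + ncost N a + ncost N b"

primrec rval :: "oracle_fun \<Rightarrow> nmem \<Rightarrow> rmem \<Rightarrow> rexp \<Rightarrow> real" where
  "rval f N R (RRead x i) = R x (nval N i)"
| "rval f N R (RAdd a b) = rval f N R a + rval f N R b"
| "rval f N R (RSub a b) = rval f N R a - rval f N R b"
| "rval f N R (RQuery i a b) = f (nval N i) (real (nval N a) / real (nval N b))"

primrec rcost :: "nmem \<Rightarrow> rexp \<Rightarrow> nat" where
  "rcost N (RRead x i) = 1 + ncost N i"
| "rcost N (RAdd a b) = 1 + rcost N a + rcost N b"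
| "rcost N (RSub a b) = 1 + rcost N a + rcost N b"
| "rcost N (RQuery i a b) = 1 + ncost N i + ncost N a + ncost N b"

primrec bval :: "oracle_fun \<Rightarrow> nmem \<Rightarrow> rmem \<Rightarrow> bexp \<Rightarrow> bool" where
  "bval f N R (NLess a b) \<longleftrightarrow> nval N a < nval N b"
| "bval f N R (RLess a b) \<longleftrightarrow> rval f N R a < rval f N R b"
| "bval f N R (BNot c) \<longleftrightarrow> \<not> bval f N R c"
| "bval f N R (BAnd c d) \<longleftrightarrow> bval f N R c \<and> bval f N R d"

primrec bcost :: "nmem \<Rightarrow> bexp \<Rightarrow> nat" where
  "bcost N (NLess a b) = 1 + ncost N a + ncost N b"
| "bcost N (RLess a b) = 1 + rcost N a + rcost N b"
| "bcost N (BNot c) = 1 + bcost N c"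
| "bcost N (BAnd c d) = 1 + bcost N c + bcost N d"

text \<open>\<open>exec f c N R t N' R'\<close>: from memory \<open>(N, R)\<close> the program terminates in \<open>(N', R')\<close> at cost \<open>t\<close>.\<close>

inductive exec ::
    "oracle_fun \<Rightarrow> com \<Rightarrow> nmem \<Rightarrow> rmem \<Rightarrow> nat \<Rightarrow> nmem \<Rightarrow> rmem \<Rightarrow> bool"
  for f :: oracle_fun where
  Skip: "exec f Skip N R 1 N R"
| NWrite: "exec f (NWrite x i a) N R (1 + ncost N i + ncost N a)
             (N(x := (N x)(nval N i := nval N a))) R"
| RWrite: "exec f (RWrite x i a) N R (1 + ncost N i + rcost N a)
             N (R(x := (R x)(nval N i := rval f N R a)))"
| Seq: "exec f c N R t N' R' \<Longrightarrow> exec f d N' R' t' N'' R'' \<Longrightarrow>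
          exec f (Seq c d) N R (t + t') N'' R''"
| CondTrue: "bval f N R b \<Longrightarrow> exec f c N R t N' R' \<Longrightarrow>
          exec f (Cond b c d) N R (1 + bcost N b + t) N' R'"
| CondFalse: "\<not> bval f N R b \<Longrightarrow> exec f d N R t N' R' \<Longrightarrow>
          exec f (Cond b c d) N R (1 + bcost N b + t) N' R'"
| LoopFalse: "\<not> bval f N R b \<Longrightarrow> exec f (Loop b c) N R (1 + bcost N b) N R"
| LoopTrue: "bval f N R b \<Longrightarrow> exec f c N R t N' R' \<Longrightarrow> exec f (Loop b c) N' R' t' N'' R'' \<Longrightarrow>
          exec f (Loop b c) N R (1 + bcost N b + t + t') N'' R''"

lemma exec_deterministic:
  assumes "exec f c N R t N' R'" and "exec f c N R u M S"
  shows "u = t \<and> M = N' \<and> S = R'"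
  using assms
proof (induction arbitrary: u M S rule: exec.induct)
  case Skip
  from Skip.prems show ?case by cases simp
next
  case NWrite
  from NWrite.prems show ?case by cases simp
next
  case RWrite
  from RWrite.prems show ?case by cases simp
next
  case (Seq c N R t N' R' d t' N'' R'')
  from Seq.prems show ?case by cases (metis Seq.IH)
next
  case (CondTrue N R b)
  from CondTrue.prems show ?case by cases (metis CondTrue.IH, use CondTrue.hyps in simp)
next
  case (CondFalse N R b)
  from CondFalse.prems show ?case by cases (use CondFalse.hyps in simp, metis CondFalse.IH)
next
  case (LoopFalse N R b)
  from LoopFalse.prems show ?case by cases (use LoopFalse.hyps in simp_all)
next
  case (LoopTrue N R b c t N' R' t' N'' R'')
  from LoopTrue.prems show ?case
    by cases (use LoopTrue.hyps in simp, metis LoopTrue.IH)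
qed


section \<open>Encoding of games\<close>

text \<open>
  The graph has vertices \<open>{..<n}\<close> and is given by the list \<open>es\<close> of its edges. The list \<open>bs\<close> contains
  numerator and denominator of the (rational) budget of each vertex.
\<close>

definition endpoints :: "nat \<times> nat \<Rightarrow> nat set" where
  "endpoints p = {fst p, snd p}"

definition edges_of :: "(nat \<times> nat) list \<Rightarrow> nat set set" where
  "edges_of es = endpoints ` set es"

definition budget_of :: "(nat \<times> nat) list \<Rightarrow> nat \<Rightarrow> real" where
  "budget_of bs v = real (fst (bs ! v)) / real (snd (bs ! v))"

definition valid_input :: "nat \<Rightarrow> (nat \<times> nat) list \<Rightarrow> (nat \<times> nat) list \<Rightarrow> bool" where
  "valid_input n es bs \<longleftrightarrow>
     simple_graph {..<n} (edges_of es) \<and> distinct (map endpoints es) \<and>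
     length bs = n \<and> (\<forall>(a, b)\<in>set bs. b > 0)"

text \<open>The precision is \<open>k\<close> bits and contributes \<open>k\<close>, not the length of \<open>k\<close>, to the input size.\<close>

definition input_size :: "nat \<Rightarrow> (nat \<times> nat) list \<Rightarrow> (nat \<times> nat) list \<Rightarrow> nat \<Rightarrow> nat" where
  "input_size n es bs k =
     n + length es + (\<Sum>(a, b)\<leftarrow>bs. binlen a + binlen b) + k"

definition input_mem :: "nat \<Rightarrow> (nat \<times> nat) list \<Rightarrow> (nat \<times> nat) list \<Rightarrow> nat \<Rightarrow> nmem" where
  "input_mem n es bs k =
     (\<lambda>_ _. 0)
       (0 := nth_default 0 [n, length es, k],
        1 := nth_default 0 (map fst es),
        2 := nth_default 0 (map snd es),
        3 := nth_default 0 (map fst bs),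
        4 := nth_default 0 (map snd bs))"

definition reward_oracle ::
    "(nat \<times> nat) list \<Rightarrow> (nat set \<Rightarrow> real \<Rightarrow> real) \<Rightarrow> oracle_fun" where
  "reward_oracle es h i x = (if i < length es then h (endpoints (es ! i)) x else 0)"

text \<open>
  The program leaves in array 5 natural numbers which, divided by \<open>2 ^ k\<close>, approximate the
  contributions \<open>s\<^sub>e\<close> of a pairwise equilibrium up to an error of at most \<open>1 / 2 ^ k\<close>.
\<close>

definition approximates ::
    "(nat \<times> nat) list \<Rightarrow> nat \<Rightarrow> nmem \<Rightarrow> (nat \<Rightarrow> nat set \<Rightarrow> real) \<Rightarrow> bool" where
  "approximates es k N s \<longleftrightarrow>
     (\<forall>i<length es. \<forall>v\<in>endpoints (es ! i).
        \<bar>real (N 5 i) / 2 ^ k - s v (endpoints (es ! i))\<bar> \<le> 1 / 2 ^ k)"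

definition computes_equilibria_in_time :: "com \<Rightarrow> (nat \<Rightarrow> nat) \<Rightarrow> bool" where
  "computes_equilibria_in_time c T \<longleftrightarrow>
     (\<forall>n es bs h k.
        valid_input n es bs \<and> (\<forall>e\<in>edges_of es. concave_reward (h e)) \<longrightarrow>
        (\<exists>t N R s.
           exec (reward_oracle es h) c (input_mem n es bs k) (\<lambda>_ _. 0) t N R \<and>
           t \<le> T (input_size n es bs k) \<and>
           min_effort_equilibrium {..<n} (edges_of es) (budget_of bs) h s \<and>
           approximates es k N s))"

end

theory Submission
  imports Defs
begin

text \<open>
  In a matched state an edge admits no bilateral deviation iff one of its endpoints is saturated and
  cannot profitably shift effort to it. Such blocked contributions are stable: along a chain of
  edges on which two approximate solutions alternately differ in opposite directions the marginal
  reward strictly increases, so chains have length at most the number \<open>m\<close> of edges and the two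
  solutions differ by at most \<open>(m + 1)\<^sup>m\<close> times the tolerance. This yields uniqueness for strictly
  concave rewards. For merely concave rewards, adding small strictly concave terms that keep a given
  approximate solution \<open>c\<close> valid and passing to the limit gives an exact solution close to \<open>c\<close>.
  Approximate solutions exist because the greedy algorithm on the grid of multiples of \<open>1 / D\<close>
  produces them; with \<open>D\<close> having polynomially many bits, this algorithm is accelerated to
  polynomial time by bisecting, for every edge, for the last unit that can still be reached, until
  an edge becomes saturated.
\<close>

text \<open>The obstacle is that passing a test of approximate optimality says little about the
  distance to an equilibrium: where rewards have linear pieces, equilibria form a continuum and
  near-ties may be resolved far away. The way out is that the stability bound depends only on the
  graph and the tolerance, not on how strictly concave the rewards are. Hence the perturbation may
  be arbitrarily small and may be built around the very solution whose accuracy is to be shown. The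
  factor also dictates the grid: with \<open>D = 2 ^ (k + (m * m + 3))\<close> an exact solution
  lies within half the requested precision, and the other half pays for rounding the output to
  multiples of \<open>1 / 2 ^ k\<close>. All conditions compare increments over a finite step
  instead of derivatives, because the oracle delivers only values; on the grid they become
  comparisons of unit increments. The acceleration rests on the fact that the greedy order
  restricted to active edges changes only when an edge drops out. Uniqueness also needs the converse
  that every equilibrium is blocked; strict concavity enters there a second time, since it makes
  unspent budget worth spending.\<close>

section \<open>Increments of concave functions\<close>

lemma concave_increment_antimono:
  fixes g :: "real \<Rightarrow> real"
  assumes g: "concave_on {0..} g" and x: "0 \<le> x" "x \<le> y" and d: "0 \<le> d"
  shows "g (y + d) - g y \<le> g (x + d) - g x"
proof (cases "y + d = x")
  case True
  then show ?thesis using assms by auto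
next
  case False
  \<comment> \<open>\<open>y\<close> and \<open>x + d\<close> are convex combinations of
    \<open>x\<close> and \<open>y + d\<close> with the two weights exchanged, so adding both
    concavity inequalities gives the claim.\<close>
  define t where "t = (y - x) / (y + d - x)"
  have pos: "y + d - x > 0" using False x d by linarith
  have t: "0 \<le> t" "t \<le> 1" using x d pos by (auto simp: t_def field_simps)
  have eq: "t * (y + d - x) = y - x" using pos by (simp add: t_def)
  have y: "(1 - t) * x + t * (y + d) = y" using eq by (simp add: algebra_simps)
  have xd: "(1 - (1 - t)) * x + (1 - t) * (y + d) = x + d" using eq by (simp add: algebra_simps)
  have "(1 - t) * g x + t * g (y + d) \<le> g y"
    using concave_onD[OF g t, of x "y + d"] x d y by simp
  moreover have "(1 - (1 - t)) * g x + (1 - t) * g (y + d) \<le> g (x + d)"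
    using concave_onD[OF g, of "1 - t" x "y + d"] x d xd t by simp
  ultimately show ?thesis by (simp add: algebra_simps)
qed

lemma strictly_concave_increment_less:
  assumes g: "strictly_concave_on {0..} g" and x: "0 \<le> x" "x < y" and d: "0 < d"
  shows "g (y + d) - g y < g (x + d) - g x"
proof -
  define t where "t = (y - x) / (y + d - x)"
  have pos: "y + d - x > 0" using x d by linarith
  have t: "0 < t" "t < 1" using x d pos by (auto simp: t_def field_simps)
  have eq: "t * (y + d - x) = y - x" using pos by (simp add: t_def)
  have y: "(1 - t) * x + t * (y + d) = y" using eq by (simp add: algebra_simps)
  have xd: "(1 - (1 - t)) * x + (1 - t) * (y + d) = x + d" using eq by (simp add: algebra_simps)
  have mid: "(1 - r) * g x + r * g (y + d) < g ((1 - r) * x + r * (y + d))" if "0 < r" "r < 1" for r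
    using g x d that unfolding strictly_concave_on_def by auto
  have "(1 - t) * g x + t * g (y + d) < g y" using mid[of t] t y by simp
  moreover have "(1 - (1 - t)) * g x + (1 - t) * g (y + d) < g (x + d)"
    using mid[of "1 - t"] t xd by simp
  ultimately show ?thesis by (simp add: algebra_simps)
qed

text \<open>Chords from a fixed left end get flatter as they grow longer; the slopes are
  cross-multiplied so that lengths may be zero.\<close>

lemma concave_increment_slope:
  fixes g :: "real \<Rightarrow> real"
  assumes g: "concave_on {0..} g" and x: "0 \<le> x" and d: "0 \<le> d" "d \<le> r"
  shows "d * (g (x + r) - g x) \<le> r * (g (x + d) - g x)"
proof (cases "r = 0")
  case False
  then have r: "r > 0" using d by linarith
  define t where "t = d / r"
  have t: "0 \<le> t" "t \<le> 1" "t * r = d" using r d by (auto simp: t_def)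
  have "(1 - t) * x + t * (x + r) = x + d" using t(3) by (simp add: algebra_simps)
  then have "(1 - t) * g x + t * g (x + r) \<le> g (x + d)"
    using concave_onD[OF g t(1,2), of x "x + r"] x r by simp
  then have "r * ((1 - t) * g x + t * g (x + r)) \<le> r * g (x + d)" using r by simp
  moreover have "r * ((1 - t) * g x + t * g (x + r)) = r * g x + t * r * (g (x + r) - g x)"
    by (simp add: algebra_simps)
  ultimately have "r * g x + d * (g (x + r) - g x) \<le> r * g (x + d)" using t(3) by simp
  then show ?thesis by (simp add: right_diff_distrib)
qed (use d in auto)

text \<open>The mirror image for chords with a fixed right end \<open>x\<close>, which get steeper
  as they grow to the left: it is the previous inequality based at \<open>x - r\<close>.\<close>

lemma concave_decrement_slope:
  fixes g :: "real \<Rightarrow> real"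
  assumes g: "concave_on {0..} g" and x: "r \<le> x" and d: "0 \<le> d" "d \<le> r"
  shows "r * (g x - g (x - d)) \<le> d * (g x - g (x - r))"
proof -
  have "(r - d) * (g (x - r + r) - g (x - r)) \<le> r * (g (x - r + (r - d)) - g (x - r))"
    by (rule concave_increment_slope[OF g]) (use x d in auto)
  then show ?thesis by (simp add: algebra_simps)
qed

text \<open>The increment following \<open>y\<close> is nonnegative by monotonicity and strictly
  below the one from \<open>x\<close> to \<open>y\<close>.\<close>

lemma strictly_concave_mono_imp_strict:
  assumes g: "strictly_concave_on {0..} g" and m: "mono_on {0..} g" and x: "0 \<le> x" "x < y"
  shows "g x < g y"
proof -
  have "g (y + (y - x)) - g y < g (x + (y - x)) - g x"
    by (rule strictly_concave_increment_less[OF g]) (use x in auto)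
  moreover have "g y \<le> g (y + (y - x))" using x by (intro mono_onD[OF m]) auto
  ultimately show ?thesis by simp
qed


section \<open>Approximate equilibria\<close>

text \<open>
  In a matched state a player can only gain on an edge that its partner raises as well, so the
  edge \<open>e\<close> prevents a bilateral deviation iff one of its endpoints \<open>w\<close> cannot profitably move any
  amount \<open>d\<close> to \<open>e\<close> from its other edges. The tolerance \<open>t\<close> is the unspent budget allowed at \<open>w\<close>.
\<close>

definition blocks ::
    "'a set set \<Rightarrow> ('a \<Rightarrow> real) \<Rightarrow> ('a set \<Rightarrow> real \<Rightarrow> real) \<Rightarrow> ('a set \<Rightarrow> real) \<Rightarrow>
     real \<Rightarrow> real \<Rightarrow> 'a \<Rightarrow> 'a set \<Rightarrow> bool" where
  "blocks E B h s d t w e \<longleftrightarrow> B w - t \<le> (\<Sum>f\<in>incident E w. s f) \<and>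
     (\<forall>f\<in>incident E w. f \<noteq> e \<and> d \<le> s f \<longrightarrow>
        h e (s e + d) - h e (s e) \<le> h f (s f) - h f (s f - d))"

definition feasible :: "'a set \<Rightarrow> 'a set set \<Rightarrow> ('a \<Rightarrow> real) \<Rightarrow> ('a set \<Rightarrow> real) \<Rightarrow> bool" where
  "feasible V E B s \<longleftrightarrow> (\<forall>e\<in>E. 0 \<le> s e) \<and> (\<forall>v\<in>V. (\<Sum>f\<in>incident E v. s f) \<le> B v)"

definition approx_blocked ::
    "'a set \<Rightarrow> 'a set set \<Rightarrow> ('a \<Rightarrow> real) \<Rightarrow> ('a set \<Rightarrow> real \<Rightarrow> real) \<Rightarrow> real \<Rightarrow> real \<Rightarrow>
     ('a set \<Rightarrow> real) \<Rightarrow> bool" where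
  "approx_blocked V E B h d t s \<longleftrightarrow>
     feasible V E B s \<and> (\<forall>e\<in>E. \<exists>w\<in>e. blocks E B h s d t w e)"

text \<open>Asking for all \<open>d > 0\<close> replaces the comparison of the right derivative on
  \<open>e\<close> with the left derivatives on the other edges at \<open>w\<close>. The endpoint is
  chosen before \<open>d\<close>: a single player refuses every shift.\<close>

definition blocked ::
    "'a set \<Rightarrow> 'a set set \<Rightarrow> ('a \<Rightarrow> real) \<Rightarrow> ('a set \<Rightarrow> real \<Rightarrow> real) \<Rightarrow> ('a set \<Rightarrow> real) \<Rightarrow> bool" where
  "blocked V E B h s \<longleftrightarrow>
     feasible V E B s \<and> (\<forall>e\<in>E. \<exists>w\<in>e. \<forall>d>0. blocks E B h s d 0 w e)"

lemma finite_edges: "simple_graph V E \<Longrightarrow> finite E"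
  unfolding simple_graph_def by (rule finite_subset[of _ "Pow V"]) auto

lemma finite_incident: "simple_graph V E \<Longrightarrow> finite (incident E v)"
  using finite_edges[of V E] by (simp add: incident_def)

lemma incident_subset: "incident E v \<subseteq> E"
  by (auto simp: incident_def)

text \<open>Per unit moved, the gain shrinks and the loss grows with the amount. So a shift that
  does not pay at \<open>d\<close> does not pay at any larger amount; read backwards, a profitable
  shift stays profitable when scaled down.\<close>

lemma increment_le_decrement_mono:
  fixes g k :: "real \<Rightarrow> real"
  assumes g: "concave_on {0..} g" and k: "concave_on {0..} k"
    and x: "0 \<le> x" and d: "0 < d" "d \<le> r" "r \<le> y"
    and le: "g (x + d) - g x \<le> k y - k (y - d)"
  shows "g (x + r) - g x \<le> k y - k (y - r)"
proof -
  have "d * (g (x + r) - g x) \<le> r * (g (x + d) - g x)"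
    using concave_increment_slope[OF g x] d by simp
  also have "\<dots> \<le> r * (k y - k (y - d))" using le d by (intro mult_left_mono) auto
  also have "\<dots> \<le> d * (k y - k (y - r))" using concave_decrement_slope[OF k] d by simp
  finally show ?thesis using d by simp
qed

lemma blocks_mono:
  assumes G: "simple_graph V E" and h: "\<forall>e\<in>E. concave_on {0..} (h e)"
    and s: "\<forall>e\<in>E. 0 \<le> s e" and e: "e \<in> E"
    and b: "blocks E B h s d t w e" and d: "0 < d" "d \<le> d'" and t: "t \<le> t'"
  shows "blocks E B h s d' t' w e"
  unfolding blocks_def
proof (intro conjI ballI impI)
  show "B w - t' \<le> sum s (incident E w)" using b t by (simp add: blocks_def)
  fix f assume f: "f \<in> incident E w" "f \<noteq> e \<and> d' \<le> s f"
  then have "f \<in> E" by (simp add: incident_def)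
  show "h e (s e + d') - h e (s e) \<le> h f (s f) - h f (s f - d')"
    by (rule increment_le_decrement_mono[of _ _ _ d])
      (use h s e b d f \<open>f \<in> E\<close> in \<open>auto simp: blocks_def\<close>)
qed

text \<open>Solutions on fine grids count as solutions at a coarser resolution, which is what makes
  solutions of different precision comparable.\<close>

lemma approx_blocked_mono:
  assumes "simple_graph V E" "\<forall>e\<in>E. concave_on {0..} (h e)"
    and "approx_blocked V E B h d t s" "0 < d" "d \<le> d'" "t \<le> t'"
  shows "approx_blocked V E B h d' t' s"
  using assms unfolding approx_blocked_def by (metis blocks_mono feasible_def)

text \<open>
  An edge on which two approximate solutions differ by \<open>g\<close> shares an endpoint with an edge on
  which they differ by about \<open>g / m\<close> in the opposite direction and where the increment at the
  smaller of the two contributions is strictly larger. Such chains have length at most \<open>m\<close>.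
\<close>

lemma approx_blocked_next:
  assumes G: "simple_graph V E"
    and dec: "\<And>e x y. e \<in> E \<Longrightarrow> 0 \<le> x \<Longrightarrow> x < y \<Longrightarrow>
      h e (y + d) - h e y < h e (x + d) - h e x"
    and h: "\<forall>e\<in>E. concave_on {0..} (h e)"
    and d: "0 < d" and t: "0 \<le> t"
    and s: "approx_blocked V E B h d t s" and s': "approx_blocked V E B h d t s'"
    and e: "e \<in> E" and g: "2 * d + t \<le> g" and gap: "s e + real (card E + 1) * g \<le> s' e"
  obtains f where "f \<in> E" "s' f + g \<le> s f" "h e (s e + d) - h e (s e) < h f (s' f + d) - h f (s' f)"
proof -
  obtain w where w: "w \<in> e" "blocks E B h s d t w e" using s e by (auto simp: approx_blocked_def)
  have wV: "w \<in> V" using G e w by (auto simp: simple_graph_def)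
  let ?I = "incident E w"
  have fin: "finite ?I" and fE: "finite E" using finite_incident[OF G] finite_edges[OF G] by auto
  have eI: "e \<in> ?I" using e w by (simp add: incident_def)
  have "sum s' ?I \<le> B w" using s' wV by (simp add: approx_blocked_def feasible_def)
  also have "\<dots> \<le> sum s ?I + t" using w by (simp add: blocks_def)
  finally have "(\<Sum>f\<in>?I. s' f - s f) \<le> t" by (simp add: sum_subtractf)
  then have sm: "(\<Sum>f\<in>?I - {e}. s' f - s f) + (s' e - s e) \<le> t"
    using sum.remove[OF fin eI, of "\<lambda>f. s' f - s f"] by simp
  \<comment> \<open>Pigeonhole: \<open>s'\<close> exceeds \<open>s\<close> on \<open>e\<close> by
    \<open>card E + 1\<close> times \<open>g\<close>, while the loads at \<open>w\<close> allow a
    surplus of only \<open>t < g\<close>. Fewer than \<open>card E\<close> other edges must absorb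
    the rest, so one of them gives up at least \<open>g\<close>.\<close>
  have "\<exists>f\<in>?I - {e}. s' f + g \<le> s f"
  proof (rule ccontr)
    assume "\<not> ?thesis"
    then have "(\<Sum>f\<in>?I - {e}. - g) \<le> (\<Sum>f\<in>?I - {e}. s' f - s f)"
      by (intro sum_mono) force
    moreover have "card (?I - {e}) \<le> card E"
      using fE incident_subset[of E w] by (intro card_mono) auto
    then have "real (card (?I - {e})) * g \<le> real (card E) * g"
      using g d t by (intro mult_right_mono) auto
    ultimately have "s' e - s e \<le> t + real (card E) * g" using sm by simp
    then show False using gap g d by (simp add: algebra_simps)
  qed
  then obtain f where f: "f \<in> ?I" "f \<noteq> e" "s' f + g \<le> s f" by auto
  have fE: "f \<in> E" using f by (simp add: incident_def)
  have pos: "0 \<le> s' f" using s' fE by (simp add: approx_blocked_def feasible_def)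
  \<comment> \<open>The decrement on \<open>f\<close> is the increment based at
    \<open>s f - d\<close>, and \<open>g > d\<close> keeps this base strictly above
    \<open>s' f\<close>, so \<open>dec\<close> applies.\<close>
  have "h e (s e + d) - h e (s e) \<le> h f (s f) - h f (s f - d)"
    using w(2) f g d t pos by (auto simp: blocks_def)
  also have "\<dots> < h f (s' f + d) - h f (s' f)"
    using dec[OF fE pos, of "s f - d"] f g d t by simp
  finally show ?thesis using that fE f by blast
qed

lemma approx_blocked_close:
  assumes G: "simple_graph V E"
    and dec: "\<And>e x y. e \<in> E \<Longrightarrow> 0 \<le> x \<Longrightarrow> x < y \<Longrightarrow>
      h e (y + d) - h e y < h e (x + d) - h e x"
    and h: "\<forall>e\<in>E. concave_on {0..} (h e)"
    and d: "0 < d" and t: "0 \<le> t"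
    and s: "approx_blocked V E B h d t s" and s': "approx_blocked V E B h d t s'"
    and e: "e \<in> E"
  shows "\<bar>s e - s' e\<bar> \<le> real (card E + 1) ^ card E * (2 * d + t)"
proof (rule ccontr)
  assume "\<not> ?thesis"
  then have far: "real (card E + 1) ^ card E * (2 * d + t) \<le> \<bar>s e - s' e\<bar>" by simp
  \<comment> \<open>Consecutive edges of a chain differ in opposite directions; the minimum lets one
    potential serve both, since it is \<open>s\<close> on one edge and \<open>s'\<close> on the
    next.\<close>
  define P where "P f = h f (min (s f) (s' f) + d) - h f (min (s f) (s' f))" for f
  have fE: "finite E" using finite_edges[OF G] .
  have G_ge: "2 * d + t \<le> real (card E + 1) ^ j * (2 * d + t)" for j
    using mult_right_mono[of 1 "real (card E + 1) ^ j" "2 * d + t"] d t by simp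
  have step: "\<exists>f\<in>E. g \<le> \<bar>s f - s' f\<bar> \<and> P e < P f"
    if e: "e \<in> E" and g: "2 * d + t \<le> g" and gap: "real (card E + 1) * g \<le> \<bar>s e - s' e\<bar>" for e g
  proof -
    have gp: "0 < g" using g d t by linarith
    have "0 < real (card E + 1) * g" using gp by simp
    then consider "s e + real (card E + 1) * g \<le> s' e" "s e < s' e"
      | "s' e + real (card E + 1) * g \<le> s e" "s' e < s e"
      using gap by (cases "s e \<le> s' e") auto
    then show ?thesis
    proof cases
      case 1
      from approx_blocked_next[OF G dec h d t s s' e g 1(1)] obtain f where
        f: "f \<in> E" "s' f + g \<le> s f" "h e (s e + d) - h e (s e) < h f (s' f + d) - h f (s' f)" .
      then show ?thesis using 1 gp by (intro bexI[of _ f]) (auto simp: P_def min_def)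
    next
      case 2
      from approx_blocked_next[OF G dec h d t s' s e g 2(1)] obtain f where
        f: "f \<in> E" "s f + g \<le> s' f" "h e (s' e + d) - h e (s' e) < h f (s f + d) - h f (s f)" .
      then show ?thesis using 2 gp by (intro bexI[of _ f]) (auto simp: P_def min_def)
    qed
  qed
  \<comment> \<open>A gap with exponent \<open>j\<close> starts a chain of \<open>j\<close> strict
    increases of \<open>P\<close>. For \<open>j = card E\<close> all edges would lie above
    \<open>e\<close> in \<open>P\<close>, including \<open>e\<close> itself.\<close>
  have "j \<le> card {f\<in>E. P e < P f}"
    if "e \<in> E" "real (card E + 1) ^ j * (2 * d + t) \<le> \<bar>s e - s' e\<bar>" for j e
    using that
  proof (induction j arbitrary: e)
    case (Suc j)
    obtain f where f: "f \<in> E" "real (card E + 1) ^ j * (2 * d + t) \<le> \<bar>s f - s' f\<bar>" "P e < P f"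
      using step[OF Suc.prems(1) G_ge[of j]] Suc.prems(2) by (auto simp: algebra_simps)
    have "card {k\<in>E. P f < P k} < card {k\<in>E. P e < P k}"
      by (rule psubset_card_mono) (use f fE in auto)
    then show ?case using Suc.IH[OF f(1,2)] by linarith
  qed simp
  from this[OF e far] have "card E \<le> card {f\<in>E. P e < P f}" .
  moreover have "card {f\<in>E. P e < P f} < card E"
    by (rule psubset_card_mono) (use e fE in auto)
  ultimately show False by simp
qed

section \<open>Greedy integer allocations\<close>

text \<open>
  \<open>M e l\<close> is the reward increment of the \<open>l\<close>-th unit on edge \<open>e\<close>. The greedy algorithm gives units
  to edges in the order of decreasing \<open>M\<close> (ties: smaller edge, then smaller unit) and drops an edge
  when one of its endpoints has no unit left. \<open>closing x e j\<close> describes the allocation reached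
  from \<open>x\<close> after all units up to unit \<open>j - 1\<close> of \<open>e\<close>,
    where amounts beyond a capacity may be cut
  off arbitrarily.
\<close>

locale unit_greedy =
  fixes V :: "'v set" and m :: nat and ed :: "nat \<Rightarrow> 'v set"
    and U :: "'v \<Rightarrow> nat" and M :: "nat \<Rightarrow> nat \<Rightarrow> real"
  assumes ed_V: "e < m \<Longrightarrow> ed e \<subseteq> V"
    and ed_ne: "e < m \<Longrightarrow> ed e \<noteq> {}"
    and M_antimono: "e < m \<Longrightarrow> l \<le> l' \<Longrightarrow> M e l' \<le> M e l"
begin

definition load :: "(nat \<Rightarrow> nat) \<Rightarrow> 'v \<Rightarrow> nat" where
  "load x v = (\<Sum>f | f < m \<and> v \<in> ed f. x f)"

definition feas :: "(nat \<Rightarrow> nat) \<Rightarrow> bool" where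
  "feas x \<longleftrightarrow> (\<forall>v\<in>V. load x v \<le> U v)"

definition act :: "(nat \<Rightarrow> nat) \<Rightarrow> nat set" where
  "act x = {f. f < m \<and> (\<forall>v\<in>ed f. load x v < U v)}"

text \<open>The greedy order relative to the target unit \<open>j - 1\<close> of \<open>e\<close>.
  The condition \<open>l < j\<close> rather than \<open>l < j - 1\<close> includes the target
  itself. The allocation \<open>x\<close> enters only through its active set.\<close>

definition pr :: "(nat \<Rightarrow> nat) \<Rightarrow> nat \<Rightarrow> nat \<Rightarrow> nat \<Rightarrow> nat \<Rightarrow> bool" where
  "pr x e j f l \<longleftrightarrow> f \<in> act x \<and>
     (M e (j - 1) < M f l \<or> M e (j - 1) = M f l \<and> (f < e \<or> f = e \<and> l < j))"

text \<open>The escape \<open>U v < q\<close> spares a search beyond the capacity: such a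
  \<open>q\<close> is infeasible already and serves only to reject the target.\<close>

definition closing_at :: "(nat \<Rightarrow> nat) \<Rightarrow> nat \<Rightarrow> nat \<Rightarrow> nat \<Rightarrow> nat \<Rightarrow> bool" where
  "closing_at x e j f q \<longleftrightarrow> x f \<le> q \<and> (\<forall>l. x f \<le> l \<and> l < q \<longrightarrow> pr x e j f l) \<and>
     (\<not> pr x e j f q \<or> (\<exists>v\<in>ed f. U v < q))"

definition closing :: "(nat \<Rightarrow> nat) \<Rightarrow> nat \<Rightarrow> nat \<Rightarrow> (nat \<Rightarrow> nat) \<Rightarrow> bool" where
  "closing x e j y \<longleftrightarrow> (\<forall>f<m. closing_at x e j f (y f))"

definition cover :: "(nat \<Rightarrow> nat) \<Rightarrow> nat \<Rightarrow> nat \<Rightarrow> (nat \<Rightarrow> nat) \<Rightarrow> bool" where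
  "cover x e j y \<longleftrightarrow> (\<forall>f<m. x f \<le> y f \<and> \<not> pr x e j f (y f))"

text \<open>Phrased by all covers instead of one closing, so that the property visibly persists for
  later targets and for larger allocations with the same active set.\<close>

definition stuck :: "(nat \<Rightarrow> nat) \<Rightarrow> nat \<Rightarrow> nat \<Rightarrow> bool" where
  "stuck x e j \<longleftrightarrow> (\<forall>y. cover x e j y \<longrightarrow> \<not> feas y)"

definition unit_blocked :: "(nat \<Rightarrow> nat) \<Rightarrow> nat \<Rightarrow> 'v \<Rightarrow> bool" where
  "unit_blocked x e w \<longleftrightarrow> load x w = U w \<and>
     (\<forall>f<m. w \<in> ed f \<and> 1 \<le> x f \<longrightarrow> M e (x e) \<le> M f (x f - 1))"

text \<open>The clause for active edges compares with all placed units, not only those at a common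
  vertex. It is the certificate in reserve: as soon as an endpoint of such an edge is saturated,
  that endpoint blocks the edge.\<close>

definition greedy_inv :: "(nat \<Rightarrow> nat) \<Rightarrow> bool" where
  "greedy_inv x \<longleftrightarrow> feas x \<and>
     (\<forall>e\<in>act x. \<forall>f<m. 1 \<le> x f \<longrightarrow> M e (x e) \<le> M f (x f - 1)) \<and>
     (\<forall>e<m. e \<notin> act x \<longrightarrow> (\<exists>w\<in>ed e. unit_blocked x e w))"

lemma act_lt: "e \<in> act x \<Longrightarrow> e < m"
  by (simp add: act_def)

lemma finite_act: "finite (act x)"
  by (rule finite_subset[of _ "{..<m}"]) (auto simp: act_def)

lemma load_mono: "(\<And>f. f < m \<Longrightarrow> x f \<le> y f) \<Longrightarrow> load x v \<le> load y v"
  unfolding load_def by (intro sum_mono) auto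

lemma load_cong: "(\<And>f. f < m \<Longrightarrow> v \<in> ed f \<Longrightarrow> x f = y f) \<Longrightarrow>
  load x v = load y v"
  unfolding load_def by (intro sum.cong) auto

lemma le_load: "f < m \<Longrightarrow> v \<in> ed f \<Longrightarrow> x f \<le> load x v"
  unfolding load_def by (rule member_le_sum) auto

lemma feas_le: "feas x \<Longrightarrow> f < m \<Longrightarrow> v \<in> ed f \<Longrightarrow> x f \<le> U v"
  using le_load[of f v x] ed_V[of f] unfolding feas_def by fastforce

lemma feas_mono: "feas y \<Longrightarrow> (\<And>f. f < m \<Longrightarrow> x f \<le> y f) \<Longrightarrow> feas x"
  unfolding feas_def using load_mono[of x y] order_trans by blast

lemma act_antimono: "(\<And>f. f < m \<Longrightarrow> x f \<le> y f) \<Longrightarrow> act y \<subseteq> act x"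
  unfolding act_def using load_mono[of x y] le_less_trans by blast

lemma pr_antimono: "pr x e j f l' \<Longrightarrow> l \<le> l' \<Longrightarrow> pr x e j f l"
  using M_antimono[of f l l'] act_lt[of f x] unfolding pr_def by force

lemma pr_self: "e \<in> act x \<Longrightarrow> 0 < j \<Longrightarrow> pr x e j e l \<longleftrightarrow> l < j"
  using M_antimono[of e l "j - 1"] M_antimono[of e "j - 1" l] act_lt[of e x]
  unfolding pr_def by force

lemma pr_mono: "pr x e j f l \<Longrightarrow> e < m \<Longrightarrow> j \<le> j' \<Longrightarrow> pr x e j' f l"
  using M_antimono[of e "j - 1" "j' - 1"] unfolding pr_def by force

lemma pr_act: "act x = act y \<Longrightarrow> pr x = pr y"
  by (simp add: pr_def fun_eq_iff)

lemma closing_le_cover: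
  assumes "closing x e j y" "cover x e j z" "f < m"
  shows "y f \<le> z f"
proof (rule ccontr)
  assume "\<not> y f \<le> z f"
  then have "pr x e j f (z f)"
    using assms by (auto simp: closing_def closing_at_def cover_def)
  then show False using assms by (auto simp: cover_def)
qed

text \<open>A closing lies pointwise below every cover and feasibility is inherited downwards, so
  one infeasible candidate refutes all covers.\<close>

lemma infeasible_closing_stuck: "closing x e j y \<Longrightarrow> \<not> feas y \<Longrightarrow> stuck x e j"
  unfolding stuck_def using closing_le_cover feas_mono by blast

lemma stuck_mono: "stuck x e j \<Longrightarrow> e < m \<Longrightarrow> j \<le> j' \<Longrightarrow> stuck x e j'"
  unfolding stuck_def cover_def using pr_mono by blast

text \<open>With equal active sets the orders \<open>pr\<close> coincide, so every cover above the
  larger allocation is also one above the smaller.\<close>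

lemma stuck_step:
  assumes "stuck x e j" "act x = act y" "\<And>f. f < m \<Longrightarrow> x f \<le> y f"
  shows "stuck y e j"
  unfolding stuck_def
proof (intro allI impI)
  fix z assume "cover y e j z"
  then have "cover x e j z" using assms(3) pr_act[OF assms(2)] order_trans
    unfolding cover_def by fastforce
  then show "\<not> feas z" using assms(1) by (simp add: stuck_def)
qed

lemma stuck_capacity: "e \<in> act x \<Longrightarrow> v \<in> ed e \<Longrightarrow> U v < j \<Longrightarrow>
  stuck x e j"
  unfolding stuck_def cover_def
  using pr_self[of e x j] feas_le[of _ e v] act_lt[of e x] by fastforce

text \<open>Feasibility rules out the capacity escape of \<open>closing_at\<close>, so that
  \<open>y\<close> is exactly what the greedy algorithm reaches.\<close>

lemma feas_closing:
  assumes "closing x e j y" "feas y" "f < m"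
  shows "x f \<le> y f" "x f < y f \<Longrightarrow> pr x e j f (y f - 1)" "\<not> pr x e j f (y f)"
    "f \<notin> act x \<Longrightarrow> y f = x f"
proof -
  have c: "closing_at x e j f (y f)" using assms by (simp add: closing_def)
  show 1: "x f \<le> y f" using c by (simp add: closing_at_def)
  show 2: "pr x e j f (y f - 1)" if "x f < y f" using that c by (simp add: closing_at_def)
  have "\<not> (\<exists>v\<in>ed f. U v < y f)" using feas_le[OF assms(2,3)] by (auto simp: not_less)
  then show 3: "\<not> pr x e j f (y f)" using c by (auto simp: closing_at_def)
  show "f \<notin> act x \<Longrightarrow> y f = x f" using 1 2 by (auto simp: pr_def le_less)
qed

lemma closing_self:
  assumes "closing x e j y" "feas y" "e \<in> act x" "x e < j"
  shows "y e = j"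
proof -
  note c = feas_closing[OF assms(1,2) act_lt[OF assms(3)]]
  have "j \<le> y e" using c(3) pr_self[OF assms(3), of j] assms(4) by force
  moreover have "y e \<le> j" using c(1,2) pr_self[OF assms(3), of j] assms(4) by force
  ultimately show ?thesis by simp
qed

text \<open>The increment of the target unit separates: units just placed are worth at least as
  much, and the next unit of any edge active in \<open>x\<close> is worth at most as much.\<close>

lemma greedy_inv_closing:
  assumes x: "greedy_inv x" and c: "closing x e j y" and y: "feas y"
  shows "greedy_inv y"
proof -
  note fc = feas_closing[OF c y]
  have sub: "act y \<subseteq> act x" using act_antimono fc(1) by blast
  have key: "M g (y g) \<le> M f (y f - 1)" if g: "g \<in> act x" and f: "f < m" "1 \<le> y f" for g f
  proof (cases "x f < y f")
    case True
    have "M e (j - 1) \<le> M f (y f - 1)" using fc(2)[OF f(1) True] by (auto simp: pr_def)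
    moreover have "M g (y g) \<le> M e (j - 1)"
      using fc(3)[OF act_lt[OF g]] g by (auto simp: pr_def)
    ultimately show ?thesis by simp
  next
    case False
    then have eq: "y f = x f" using fc(1)[OF f(1)] by simp
    have "M g (y g) \<le> M g (x g)" using M_antimono act_lt[OF g] fc(1) by blast
    also have "\<dots> \<le> M f (x f - 1)" using x g f eq by (auto simp: greedy_inv_def)
    finally show ?thesis using eq by simp
  qed
  have "\<exists>w\<in>ed g. unit_blocked y g w" if g: "g < m" "g \<notin> act y" for g
  proof (cases "g \<in> act x")
    case True
    then obtain w where w: "w \<in> ed g" "U w \<le> load y w"
      using g by (auto simp: act_def not_less)
    then have "load y w = U w" using y ed_V[OF g(1)] by (auto simp: feas_def intro: antisym)
    then show ?thesis using w key[OF True] by (auto simp: unit_blocked_def)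
  next
    case False
    then obtain w where w: "w \<in> ed g" "unit_blocked x g w" using x g by (auto simp: greedy_inv_def)
    \<comment> \<open>\<open>w\<close> is already saturated in \<open>x\<close>, so all its edges
      are inactive and a closing leaves them alone; the old blocking certificate survives.\<close>
    have same: "y f = x f" if f: "f < m" "w \<in> ed f" for f
    proof -
      have "f \<notin> act x" using f w by (fastforce simp: act_def unit_blocked_def)
      then show ?thesis using fc(4)[OF f(1)] by simp
    qed
    then have "load y w = load x w" by (intro load_cong) auto
    then have "unit_blocked y g w" using w same g by (auto simp: unit_blocked_def)
    then show ?thesis using w by blast
  qed
  then show ?thesis using y key sub by (auto simp: greedy_inv_def)
qed

text \<open>Take the first unit in the greedy order among the next units of active edges. No other
  unplaced unit precedes it, so the closing adds this unit alone, and both the order and the spare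
  capacity make it feasible.\<close>

lemma next_unit:
  assumes x: "feas x" and a: "act x \<noteq> {}"
  obtains e y where "e \<in> act x" "feas y" "cover x e (x e + 1) y" "closing x e (x e + 1) y"
    "y = x(e := x e + 1)"
proof -
  define mx where "mx = Max ((\<lambda>e. M e (x e)) ` act x)"
  have fin: "finite ((\<lambda>e. M e (x e)) ` act x)" using finite_act by simp
  have "mx \<in> (\<lambda>e. M e (x e)) ` act x" unfolding mx_def using fin a by (intro Max_in) auto
  then have ex: "\<exists>e. e \<in> act x \<and> M e (x e) = mx" by auto
  define e where "e = (LEAST e. e \<in> act x \<and> M e (x e) = mx)"
  have e: "e \<in> act x" "M e (x e) = mx" using LeastI_ex[OF ex] by (auto simp: e_def)
  have le: "M f (x f) \<le> mx" if "f \<in> act x" for f using that fin by (auto simp: mx_def)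
  have lst: "e \<le> f" if "f \<in> act x" "M f (x f) = mx" for f
    unfolding e_def using that by (intro Least_le) auto
  define y where "y = x(e := x e + 1)"
  have em: "e < m" using e act_lt by blast
  have load_y: "load y v = (if v \<in> ed e then load x v + 1 else load x v)" for v
  proof (cases "v \<in> ed e")
    case True
    then have "load z v = z e + (\<Sum>f\<in>{f. f < m \<and> v \<in> ed f} - {e}. z f)" for z
      unfolding load_def using em by (intro sum.remove) auto
    moreover have "(\<Sum>f\<in>{f. f < m \<and> v \<in> ed f} - {e}. y f) = (\<Sum>f\<in>{f. f < m \<and> v \<in> ed f} - {e}. x f)"
      by (intro sum.cong) (auto simp: y_def)
    ultimately show ?thesis using True by (simp add: y_def)
  next
    case False
    then show ?thesis by (auto simp: y_def intro: load_cong)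
  qed
  have fy: "feas y" using x e(1) by (auto simp: feas_def load_y act_def Suc_le_eq)
  have npr: "\<not> pr x e (x e + 1) f (y f)" if "f < m" for f
  proof (cases "f = e")
    case True
    then show ?thesis using pr_self[OF e(1), of "x e + 1"] by (simp add: y_def)
  next
    case False
    then have "y f = x f" by (simp add: y_def)
    then show ?thesis using le[of f] lst[of f] e(2) False by (force simp: pr_def)
  qed
  have le_y: "x f \<le> y f" for f by (simp add: y_def)
  have "cover x e (x e + 1) y" using npr le_y by (simp add: cover_def)
  moreover have "pr x e (x e + 1) f l" if "x f \<le> l" "l < y f" for f l
  proof -
    have "f = e" "l = x e" using that by (auto simp: y_def split: if_splits)
    then show ?thesis using pr_self[OF e(1), of "x e + 1"] by simp
  qed
  ultimately have "closing x e (x e + 1) y" using npr le_y by (auto simp: closing_def closing_at_def)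
  then show ?thesis using that[OF e(1) fy] \<open>cover x e (x e + 1) y\<close> y_def by blast
qed

lemma all_stuck_done:
  assumes "feas x" "\<forall>e\<in>act x. stuck x e (x e + 1)"
  shows "act x = {}"
  using next_unit[OF assms(1)] assms(2) unfolding stuck_def by metis

lemma greedy_inv_init: "greedy_inv (\<lambda>_. 0)"
proof -
  have "\<exists>w\<in>ed e. unit_blocked (\<lambda>_. 0) e w" if e: "e < m" "e \<notin> act (\<lambda>_. 0)" for e
    using e by (auto simp: act_def unit_blocked_def load_def)
  then show ?thesis by (simp add: greedy_inv_def feas_def load_def)
qed

text \<open>Otherwise single greedy steps would raise the total without end, although each edge is
  bounded by the capacity of any one of its endpoints.\<close>

lemma greedy_exists: "\<exists>x. greedy_inv x \<and> act x = {}"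
proof (rule ccontr)
  assume no: "\<not> ?thesis"
  have "\<exists>x. greedy_inv x \<and> i \<le> (\<Sum>f<m. x f)" for i
  proof (induction i)
    case 0
    then show ?case using greedy_inv_init by auto
  next
    case (Suc i)
    then obtain x where x: "greedy_inv x" "i \<le> (\<Sum>f<m. x f)" by auto
    then have "feas x" "act x \<noteq> {}" using no by (simp add: greedy_inv_def, blast)
    then obtain e y where y: "e \<in> act x" "feas y" "closing x e (x e + 1) y" "y = x(e := x e + 1)"
      by (rule next_unit)
    have "(\<Sum>f<m. x f) < (\<Sum>f<m. y f)"
      using act_lt[OF y(1)] y(4) by (intro sum_strict_mono_ex1) auto
    then show ?case using greedy_inv_closing[OF x(1) y(3,2)] x(2) by (intro exI[of _ y]) auto
  qed
  then obtain x where x: "greedy_inv x" "1 + (\<Sum>f<m. U (SOME v. v \<in> ed f)) \<le> (\<Sum>f<m. x f)" by blast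
  have "x f \<le> U (SOME v. v \<in> ed f)" if "f < m" for f
    using x(1) feas_le[OF _ that] ed_ne[OF that] by (auto simp: greedy_inv_def some_in_eq)
  then have "(\<Sum>f<m. x f) \<le> (\<Sum>f<m. U (SOME v. v \<in> ed f))" by (intro sum_mono) auto
  then show False using x(2) by simp
qed

text \<open>
  A round of the algorithm searches, for every edge \<open>e\<close> in turn, the last unit of \<open>e\<close> whose closing
  is feasible. If the set of active edges is the same after the round, then every active edge is
  stuck, which contradicts \<open>all_stuck_done\<close> unless no edge is active.
\<close>

definition round_inv :: "nat set \<Rightarrow> nat \<Rightarrow> (nat \<Rightarrow> nat) \<Rightarrow> bool" where
  "round_inv A e x \<longleftrightarrow> greedy_inv x \<and> act x \<subseteq> A \<and>
     (act x = A \<longrightarrow> (\<forall>f\<in>A. f < e \<longrightarrow> stuck x f (x f + 1)))"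

text \<open>\<open>w\<close> is the bisection width: \<open>x e\<close> units are reached and
  \<open>x e + w\<close> are known to be out of reach. This is claimed only while the active set is
  still \<open>A\<close>; a smaller set is already the progress that the round has to make.\<close>

definition search_inv :: "nat set \<Rightarrow> nat \<Rightarrow> nat \<Rightarrow> (nat \<Rightarrow> nat) \<Rightarrow> bool" where
  "search_inv A e w x \<longleftrightarrow> round_inv A e x \<and> (act x = A \<longrightarrow> e \<in> A \<longrightarrow> stuck x e (x e + w))"

lemma round_inv_init: "greedy_inv x \<Longrightarrow> round_inv (act x) 0 x"
  by (simp add: round_inv_def)

lemma search_inv_init: "round_inv A e x \<Longrightarrow> v \<in> ed e \<Longrightarrow>
  U v < w \<Longrightarrow> search_inv A e w x"
  unfolding search_inv_def using stuck_capacity[of e x v] by auto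

text \<open>A feasible closing gives \<open>e\<close> exactly \<open>x e + d\<close> units, so the
  unreachable bound stays where it was. Facts about earlier edges carry over because both larger
  allocations and later targets preserve \<open>stuck\<close>.\<close>

lemma search_inv_accept:
  assumes s: "search_inv A e w x" and c: "closing x e (x e + d) y" and y: "feas y"
    and d: "0 < d" "d \<le> w"
  shows "search_inv A e (w - d) y"
proof -
  note fc = feas_closing[OF c y]
  have x: "greedy_inv x" "act x \<subseteq> A" using s by (auto simp: search_inv_def round_inv_def)
  have sub: "act y \<subseteq> act x" using act_antimono fc(1) by blast
  have "stuck y f (y f + 1)" if "act y = A" "f \<in> A" "f < e" for f
  proof -
    have act: "act x = act y" using that x sub by auto
    have "stuck x f (x f + 1)" using s that act by (auto simp: search_inv_def round_inv_def)
    then have "stuck y f (x f + 1)" using stuck_step[OF _ act] fc(1) by blast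
    then show ?thesis using stuck_mono[of y f "x f + 1" "y f + 1"] fc(1)[of f] act_lt[of f x] that act by auto
  qed
  moreover have "stuck y e (y e + (w - d))" if "act y = A" "e \<in> A"
  proof -
    have act: "act x = act y" using that x sub by auto
    have "stuck x e (x e + w)" using s that act by (auto simp: search_inv_def)
    then have "stuck y e (x e + w)" using stuck_step[OF _ act] fc(1) by blast
    moreover have "y e = x e + d" using closing_self[OF c y] that act d by simp
    ultimately show ?thesis using d by simp
  qed
  ultimately show ?thesis
    using greedy_inv_closing[OF x(1) c y] x sub by (auto simp: search_inv_def round_inv_def)
qed

text \<open>The new width may be any \<open>w' \<ge> d\<close>: after a probe at
  \<open>d = w div 2\<close> the program sets the width to \<open>w - d\<close> in both outcomes,
  which may be \<open>d + 1\<close>.\<close>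

lemma search_inv_reject:
  assumes s: "search_inv A e w x" and c: "closing x e (x e + d) y" and y: "\<not> feas y"
    and e: "e < m" and d: "d \<le> w'"
  shows "search_inv A e w' x"
  using s stuck_mono[OF infeasible_closing_stuck[OF c y] e, of "x e + w'"] d
  by (simp add: search_inv_def)

lemma search_inv_done: "search_inv A e 1 x \<Longrightarrow> round_inv A (Suc e) x"
  by (auto simp: search_inv_def round_inv_def less_Suc_eq)

lemma round_inv_done:
  assumes "round_inv A m x" and A: "finite A"
  shows "greedy_inv x" "card (act x) < card A \<or> act x = {}"
proof -
  show x: "greedy_inv x" using assms by (simp add: round_inv_def)
  have sub: "act x \<subseteq> A" using assms by (simp add: round_inv_def)
  show "card (act x) < card A \<or> act x = {}"
  proof (cases "act x = A")
    case True
    then have "\<forall>f\<in>act x. stuck x f (x f + 1)" using assms act_lt by (auto simp: round_inv_def)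
    then show ?thesis using all_stuck_done x by (auto simp: greedy_inv_def)
  next
    case False
    then show ?thesis using sub A by (intro disjI1 psubset_card_mono) auto
  qed
qed

end

section \<open>From unit allocations to approximate solutions\<close>

text \<open>Both tolerances are one unit of effort: shifts are compared in steps of a unit, and
  rounding a budget down to whole units leaves less than one unit unspent at a saturated
  vertex.\<close>

lemma greedy_approx_blocked:
  fixes D :: nat and B :: "'a \<Rightarrow> real"
  assumes G: "simple_graph V E" and bij: "bij_betw ed {..<m} E"
    and h: "\<forall>e\<in>E. concave_on {0..} (h e)" and B: "\<forall>v\<in>V. 0 \<le> B v" and D: "0 < D"
    and U: "\<And>v. v \<in> V \<Longrightarrow> U v = nat \<lfloor>B v * D\<rfloor>"
    and M: "\<And>e l. e < m \<Longrightarrow> M e l = h (ed e) (real (l + 1) / D) - h (ed e) (real l / D)"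
  shows "unit_greedy V m ed M"
    and "\<lbrakk>unit_greedy.greedy_inv V m ed U M x; unit_greedy.act m ed U x = {};
          \<And>i. i < m \<Longrightarrow> s (ed i) = real (x i) / D\<rbrakk>
       \<Longrightarrow> approx_blocked V E B h (1 / D) (1 / D) s"
proof -
  have edE: "ed e \<in> E" if "e < m" for e using bij that by (auto simp: bij_betw_def)
  show *: "unit_greedy V m ed M"
  proof
    fix e assume e: "e < m"
    show "ed e \<subseteq> V" using G edE[OF e] by (auto simp: simple_graph_def)
    show "ed e \<noteq> {}" using G edE[OF e] by (auto simp: simple_graph_def)
    fix l l' :: nat assume l: "l \<le> l'"
    have "h (ed e) (real l' / D + 1 / D) - h (ed e) (real l' / D)
        \<le> h (ed e) (real l / D + 1 / D) - h (ed e) (real l / D)"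
      by (rule concave_increment_antimono) (use h edE[OF e] l in \<open>auto simp: divide_right_mono\<close>)
    then show "M e l' \<le> M e l" by (simp add: M[OF e] add_divide_distrib add.commute)
  qed
  interpret unit_greedy V m ed U M by (rule *)
  assume x: "greedy_inv x" "act x = {}" and s: "\<And>i. i < m \<Longrightarrow> s (ed i) = real (x i) / D"
  have Eim: "E = ed ` {..<m}" using bij by (simp add: bij_betw_def)
  have inj: "inj_on ed {..<m}" using bij by (simp add: bij_betw_def)
  have sum: "sum s (incident E w) = real (load x w) / D" for w
  proof -
    have "incident E w = ed ` {f. f < m \<and> w \<in> ed f}" by (auto simp: incident_def Eim)
    moreover have "inj_on ed {f. f < m \<and> w \<in> ed f}" by (rule inj_on_subset[OF inj]) auto
    ultimately have "sum s (incident E w) = (\<Sum>f | f < m \<and> w \<in> ed f. s (ed f))"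
      by (simp add: sum.reindex)
    also have "\<dots> = (\<Sum>f | f < m \<and> w \<in> ed f. real (x f) / D)" by (intro sum.cong) (auto simp: s)
    finally show ?thesis by (simp add: load_def sum_divide_distrib)
  qed
  have "feasible V E B s"
    unfolding feasible_def
  proof (intro conjI ballI)
    show "0 \<le> s e" if "e \<in> E" for e using that by (auto simp: Eim s)
    fix v assume v: "v \<in> V"
    have "real (load x v) \<le> real (nat \<lfloor>B v * D\<rfloor>)"
      using x v by (simp add: greedy_inv_def feas_def U)
    also have "\<dots> \<le> B v * D" using B v by (simp add: of_nat_nat)
    finally show "sum s (incident E v) \<le> B v" using D by (simp add: sum field_simps)
  qed
  moreover have "\<exists>w\<in>ed i. blocks E B h s (1 / D) (1 / D) w (ed i)" if i: "i < m" for i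
  proof -
    obtain w where w: "w \<in> ed i" "unit_blocked x i w"
      using x i by (auto simp: greedy_inv_def)
    then have wV: "w \<in> V" using ed_V[OF i] by auto
    have "B w * D - 1 \<le> real (load x w)"
      using w(2) B wV by (simp add: unit_blocked_def U)
    then have "(B w * D - 1) / D \<le> sum s (incident E w)" using D by (simp add: sum divide_right_mono)
    then have "B w - 1 / D \<le> sum s (incident E w)" using D by (simp add: diff_divide_distrib)
    moreover have "h (ed i) (s (ed i) + 1 / D) - h (ed i) (s (ed i)) \<le> h f (s f) - h f (s f - 1 / D)"
      if f: "f \<in> incident E w" "1 / D \<le> s f" for f
    proof -
      obtain k where k: "k < m" "f = ed k" using f by (auto simp: incident_def Eim)
      have "1 \<le> x k" using f D k by (simp add: s field_simps)
      then obtain q where q: "x k = Suc q" by (cases "x k") auto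
      have "M i (x i) \<le> M k (x k - 1)"
        using w(2) f k q by (auto simp: unit_blocked_def incident_def)
      then show ?thesis using k i q by (simp add: M s add_divide_distrib add.commute)
    qed
    ultimately show ?thesis using w(1) by (auto simp: blocks_def)
  qed
  ultimately show "approx_blocked V E B h (1 / D) (1 / D) s" by (auto simp: approx_blocked_def Eim)
qed

lemma approx_blocked_exists:
  fixes D :: nat
  assumes G: "simple_graph V E" and h: "\<forall>e\<in>E. concave_on {0..} (h e)"
    and B: "\<forall>v\<in>V. 0 \<le> B v" and D: "0 < D"
  shows "\<exists>s. approx_blocked V E B h (1 / D) (1 / D) s"
proof -
  obtain ed where bij: "bij_betw ed {..<card E} E"
    using ex_bij_betw_nat_finite[OF finite_edges[OF G]] by (auto simp: atLeast0LessThan)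
  define U where "U v = nat \<lfloor>B v * D\<rfloor>" for v
  define M where "M e l = h (ed e) (real (l + 1) / D) - h (ed e) (real l / D)" for e l
  note greedy = greedy_approx_blocked[OF G bij h B D, of U M, OF U_def M_def]
  interpret unit_greedy V "card E" ed U M by (rule greedy(1))
  obtain x where x: "greedy_inv x" "act x = {}" using greedy_exists by auto
  have "approx_blocked V E B h (1 / D) (1 / D) (\<lambda>e. real (x (inv_into {..<card E} ed e)) / D)"
    using bij by (intro greedy(2)[OF x]) (auto simp: bij_betw_def)
  then show ?thesis by blast
qed

section \<open>Exact solutions as limits of solutions of perturbed games\<close>

lemma finite_bounded_subseq:
  fixes s :: "nat \<Rightarrow> 'b \<Rightarrow> real"
  assumes "finite E" "\<And>e j. e \<in> E \<Longrightarrow> \<bar>s j e\<bar> \<le> b e"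
  shows "\<exists>r l. strict_mono (r :: nat \<Rightarrow> nat) \<and> (\<forall>e\<in>E. (\<lambda>j. s (r j) e) \<longlonglongrightarrow> l e)"
  using assms
proof (induction E)
  case empty
  then show ?case by (intro exI[of _ id]) (auto simp: strict_mono_def)
next
  case (insert e E)
  then obtain r l where r: "strict_mono (r :: nat \<Rightarrow> nat)" "\<forall>e\<in>E. (\<lambda>j. s (r j) e) \<longlonglongrightarrow> l e" by auto
  have "bounded (range (\<lambda>j. s (r j) e))"
    using insert.prems by (intro boundedI[of _ "b e"]) auto
  then obtain y q where q: "strict_mono q" "((\<lambda>j. s (r j) e) \<circ> q) \<longlonglongrightarrow> y"
    using bounded_imp_convergent_subsequence by blast
  have "(\<lambda>j. s (r (q j)) f) \<longlonglongrightarrow> (l(e := y)) f" if f: "f \<in> insert e E" for f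
  proof (cases "f = e")
    case True
    then show ?thesis using q(2) by (simp add: o_def)
  next
    case False
    then have "((\<lambda>j. s (r j) f) \<circ> q) \<longlonglongrightarrow> l f"
      using r(2) f by (intro LIMSEQ_subseq_LIMSEQ[OF _ q(1)]) auto
    then show ?thesis using False by (simp add: o_def)
  qed
  moreover have "strict_mono (r \<circ> q)" using r(1) q(1) by (rule strict_mono_o)
  ultimately show ?case by (intro exI[of _ "r \<circ> q"] exI[of _ "l(e := y)"]) 
    (auto simp: o_def simp del: fun_upd_apply)
qed

text \<open>Thanks to the shift by \<open>c e\<close>, the added term is the same function of
  \<open>x - c e\<close> on every edge, so around \<open>c\<close> it favours no edge over
  another.\<close>

definition perturb ::
    "('a set \<Rightarrow> real) \<Rightarrow> ('a set \<Rightarrow> real \<Rightarrow> real) \<Rightarrow> real \<Rightarrow> 'a set \<Rightarrow> real \<Rightarrow> real" where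
  "perturb c h \<eta> e x = h e x - \<eta> * exp (c e - x)"

lemma concave_perturb:
  assumes "concave_on {0..} (h e)" "0 \<le> \<eta>"
  shows "concave_on {0..} (perturb c h \<eta> e)"
proof -
  have "convex_on UNIV (\<lambda>x. exp (c e - x))"
    by (rule f''_ge0_imp_convex[where f' = "\<lambda>x. - exp (c e - x)" and f'' = "\<lambda>x. exp (c e - x)"])
      (auto intro!: derivative_eq_intros)
  then have "convex_on {0..} (\<lambda>x. exp (c e - x))" by (rule convex_on_subset) auto
  then have "convex_on {0..} (\<lambda>x. - h e x + \<eta> * exp (c e - x))"
    using assms by (intro convex_on_add convex_on_cmul) (auto simp: concave_on_def)
  then show ?thesis by (simp add: concave_on_def perturb_def)
qed

lemma perturb_increment_less:
  assumes h: "concave_on {0..} (h e)" and "0 < \<eta>" "0 < d" "0 \<le> x" "x < y"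
  shows "perturb c h \<eta> e (y + d) - perturb c h \<eta> e y < perturb c h \<eta> e (x + d) - perturb c h \<eta> e x"
proof -
  have eq: "exp (c e - z) - exp (c e - (z + d)) = exp (c e - z) * (1 - exp (- d))" for z
    by (simp add: algebra_simps exp_add[symmetric])
  have "exp (c e - y) * (1 - exp (- d)) < exp (c e - x) * (1 - exp (- d))"
    using assms by (intro mult_strict_right_mono) auto
  then have "\<eta> * (exp (c e - y) - exp (c e - (y + d))) < \<eta> * (exp (c e - x) - exp (c e - (x + d)))"
    using assms by (simp add: eq)
  moreover have "h e (y + d) - h e y \<le> h e (x + d) - h e x"
    using assms by (intro concave_increment_antimono) auto
  ultimately show ?thesis by (simp add: perturb_def algebra_simps)
qed

text \<open>
  All perturbation terms have the same slope at the contributions \<open>s\<close>, which therefore remain an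
  approximate solution.
\<close>

lemma approx_blocked_perturb:
  assumes s: "approx_blocked V E B h d t s" and d: "0 < d" "0 \<le> \<eta>"
  shows "approx_blocked V E B (perturb s h \<eta>) d t s"
proof -
  \<comment> \<open>At \<open>s\<close> the perturbation adds
    \<open>\<eta> * (1 - exp (- d))\<close> to the gain of a step up and the larger
    \<open>\<eta> * (exp d - 1)\<close> to the loss of a step down, so a shift that did not pay
    still does not.\<close>
  have "1 - exp (- d) \<le> d" using exp_ge_add_one_self[of "- d"] by simp
  also have "d \<le> exp d - 1" using exp_ge_add_one_self[of d] by linarith
  finally have "\<eta> * (1 - exp (- d)) \<le> \<eta> * (exp d - 1)" using d by (intro mult_left_mono)
  then have key: "perturb s h \<eta> e (s e + d) - perturb s h \<eta> e (s e)
      \<le> perturb s h \<eta> f (s f) - perturb s h \<eta> f (s f - d)"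
    if "h e (s e + d) - h e (s e) \<le> h f (s f) - h f (s f - d)" for e f
    using that by (simp add: perturb_def algebra_simps)
  have "blocks E B (perturb s h \<eta>) s d t w e" if "blocks E B h s d t w e" for w e
    using that key[of e] by (auto simp: blocks_def)
  then show ?thesis using s unfolding approx_blocked_def by metis
qed

text \<open>Failure to block is a strict inequality, hence persists for almost all members of the
  sequence. If every endpoint of an edge failed in the limit, all of them, being finitely many,
  would fail together at some index.\<close>

lemma blocked_limit:
  assumes G: "simple_graph V E"
    and h: "\<forall>e\<in>E. concave_on {0..} (h e)" "\<forall>e\<in>E. continuous_on {0..} (h e)"
    and s: "\<And>j. approx_blocked V E B (perturb c h (\<eta> j)) (d j) (d j) (s j)"
    and pos: "\<And>j. 0 < d j" "\<And>j. 0 \<le> \<eta> j"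
    and lim: "d \<longlonglongrightarrow> 0" "\<eta> \<longlonglongrightarrow> 0" "\<And>e. e \<in> E \<Longrightarrow> (\<lambda>j. s j e) \<longlonglongrightarrow> l e"
  shows "blocked V E B h l"
proof -
  have s0: "0 \<le> s j e" if "e \<in> E" for j e
    using s[of j] that by (auto simp: approx_blocked_def feasible_def)
  have l0: "0 \<le> l e" if "e \<in> E" for e
    using LIMSEQ_le_const[OF lim(3)[OF that]] s0 that by blast
  have limsum: "(\<lambda>j. sum (s j) (incident E v)) \<longlonglongrightarrow> sum l (incident E v)" for v
    using lim(3) incident_subset[of E v] by (intro tendsto_sum) auto
  have "sum l (incident E v) \<le> B v" if "v \<in> V" for v
    using LIMSEQ_le_const2[OF limsum, of v "B v"] s that
    by (auto simp: approx_blocked_def feasible_def)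
  then have feas: "feasible V E B l" using l0 by (simp add: feasible_def)
  have limP: "(\<lambda>j. perturb c h (\<eta> j) e (s j e + a)) \<longlonglongrightarrow> h e (l e + a)"
    if e: "e \<in> E" and a: "0 < l e + a \<or> 0 \<le> a" for e a
  proof -
    have lima: "(\<lambda>j. s j e + a) \<longlonglongrightarrow> l e + a" by (intro tendsto_intros lim e)
    have ev: "\<forall>\<^sub>F j in sequentially. s j e + a \<in> {0..}"
    proof (cases "0 \<le> a")
      case True
      then show ?thesis using s0[OF e] by (auto intro!: always_eventually)
    next
      case False
      then have "\<forall>\<^sub>F j in sequentially. 0 < s j e + a" using a order_tendstoD(1)[OF lima] by auto
      then show ?thesis by eventually_elim auto
    qed
    have "(\<lambda>j. h e (s j e + a)) \<longlonglongrightarrow> h e (l e + a)"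
      using h(2) e a l0[OF e] ev by (intro continuous_on_tendsto_compose[OF _ lima]) auto
    moreover have "(\<lambda>j. \<eta> j * exp (c e - (s j e + a))) \<longlonglongrightarrow> 0 * exp (c e - (l e + a))"
      by (intro tendsto_intros lim e)
    ultimately have "(\<lambda>j. h e (s j e + a) - \<eta> j * exp (c e - (s j e + a)))
        \<longlonglongrightarrow> h e (l e + a) - 0 * exp (c e - (l e + a))" by (rule tendsto_diff)
    then show ?thesis by (simp add: perturb_def)
  qed
  have ev_not: "\<forall>\<^sub>F j in sequentially. \<not> blocks E B (perturb c h (\<eta> j)) (s j) (d j) (d j) w e"
    if e: "e \<in> E" and nb: "0 < r" "\<not> blocks E B h l r 0 w e" for w e r
  proof (cases "sum l (incident E w) < B w")
    case True
    have "(\<lambda>j. sum (s j) (incident E w) + d j) \<longlonglongrightarrow> sum l (incident E w) + 0"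
      by (intro tendsto_add limsum lim)
    then have "\<forall>\<^sub>F j in sequentially. sum (s j) (incident E w) + d j < B w"
      using True by (intro order_tendstoD) auto
    then show ?thesis by eventually_elim (auto simp: blocks_def)
  next
    case False
    then obtain f where f: "f \<in> incident E w" "f \<noteq> e" "r \<le> l f"
      "h f (l f) - h f (l f - r) < h e (l e + r) - h e (l e)"
      using nb by (auto simp: blocks_def not_le)
    have fE: "f \<in> E" using f by (simp add: incident_def)
    \<comment> \<open>With \<open>l f = r\<close> the point \<open>s j f - r\<close> may be
      negative, where nothing is known of \<open>h f\<close>. Halving the shift keeps it profitable
      and moves its end into the interior of the domain.\<close>
    define q where "q = r / 2"
    have q: "0 < q" "q < l f" "q \<le> r" using nb f by (auto simp: q_def)
    have viol: "h f (l f) - h f (l f - q) < h e (l e + q) - h e (l e)"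
      using increment_le_decrement_mono[of "h e" "h f" "l e" q r "l f"] h(1) e fE l0[OF e] q f(3,4)
      by force
    have "(\<lambda>j. perturb c h (\<eta> j) f (s j f) - perturb c h (\<eta> j) f (s j f - q))
        \<longlonglongrightarrow> h f (l f) - h f (l f - q)"
      using tendsto_diff[OF limP[OF fE, of 0] limP[OF fE, of "- q"]] q by simp
    moreover have "(\<lambda>j. perturb c h (\<eta> j) e (s j e + q) - perturb c h (\<eta> j) e (s j e))
        \<longlonglongrightarrow> h e (l e + q) - h e (l e)"
      using tendsto_diff[OF limP[OF e, of q] limP[OF e, of 0]] q by simp
    ultimately have "(\<lambda>j. (perturb c h (\<eta> j) e (s j e + q) - perturb c h (\<eta> j) e (s j e)) -
        (perturb c h (\<eta> j) f (s j f) - perturb c h (\<eta> j) f (s j f - q)))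
        \<longlonglongrightarrow> (h e (l e + q) - h e (l e)) - (h f (l f) - h f (l f - q))"
      by (rule tendsto_diff[rotated])
    then have ev1: "\<forall>\<^sub>F j in sequentially. 0 <
        (perturb c h (\<eta> j) e (s j e + q) - perturb c h (\<eta> j) e (s j e)) -
        (perturb c h (\<eta> j) f (s j f) - perturb c h (\<eta> j) f (s j f - q))"
      by (rule order_tendstoD) (use viol in simp)
    have ev2: "\<forall>\<^sub>F j in sequentially. q < s j f" using order_tendstoD(1)[OF lim(3)[OF fE] q(2)] .
    have ev3: "\<forall>\<^sub>F j in sequentially. d j < q" using order_tendstoD(2)[OF lim(1) q(1)] .
    show ?thesis
      using ev1 ev2 ev3
    proof eventually_elim
      case (elim j)
      have "\<forall>e\<in>E. concave_on {0..} (perturb c h (\<eta> j) e)"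
        using h(1) pos(2) by (intro ballI concave_perturb) auto
      then have "\<not> blocks E B (perturb c h (\<eta> j)) (s j) (d j) (d j) w e"
        if "\<not> blocks E B (perturb c h (\<eta> j)) (s j) q (d j) w e"
        using that blocks_mono[OF G _ _ e _ pos(1)[of j], where s = "s j"] s0 elim by fastforce
      moreover have "\<not> blocks E B (perturb c h (\<eta> j)) (s j) q (d j) w e"
        unfolding blocks_def using f(1,2) elim by (auto intro!: bexI[of _ f] simp: not_le)
      ultimately show ?case by blast
    qed
  qed
  have "\<exists>w\<in>e. \<forall>d>0. blocks E B h l d 0 w e" if e: "e \<in> E" for e
  proof (rule ccontr)
    assume "\<not> ?thesis"
    then have "\<forall>\<^sub>F j in sequentially. \<not> blocks E B (perturb c h (\<eta> j)) (s j) (d j) (d j) w e"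
      if "w \<in> e" for w using ev_not[OF e] that by blast
    moreover have "finite e" using G e by (auto simp: simple_graph_def intro: card_ge_0_finite)
    ultimately have "\<forall>\<^sub>F j in sequentially.
        \<forall>w\<in>e. \<not> blocks E B (perturb c h (\<eta> j)) (s j) (d j) (d j) w e"
      by (simp add: eventually_ball_finite_distrib)
    then have "\<exists>j. \<forall>w\<in>e. \<not> blocks E B (perturb c h (\<eta> j)) (s j) (d j) (d j) w e"
      by (auto simp: eventually_sequentially)
    then show False using s e by (auto simp: approx_blocked_def)
  qed
  then show ?thesis using feas by (simp add: blocked_def)
qed

lemma blocked_near_approx:
  assumes G: "simple_graph V E" and B: "\<forall>v\<in>V. 0 \<le> B v"
    and h: "\<forall>e\<in>E. concave_on {0..} (h e)" "\<forall>e\<in>E. continuous_on {0..} (h e)"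
    and d: "0 < d" and c: "approx_blocked V E B h d d c"
  obtains s where "blocked V E B h s"
    "\<And>e. e \<in> E \<Longrightarrow> \<bar>s e - c e\<bar> \<le> real (card E + 1) ^ card E * (3 * d)"
proof -
  \<comment> \<open>All grids start finer than \<open>1 / d\<close>, so each \<open>s j\<close> is
    also a solution at the resolution \<open>d\<close> of \<open>c\<close>.\<close>
  obtain n0 where n0: "inverse (real (Suc n0)) < d" using reals_Archimedean d by blast
  define D where "D j = Suc (n0 + j)" for j
  define \<eta> where "\<eta> j = 1 / real (Suc j)" for j
  have conc: "\<forall>e\<in>E. concave_on {0..} (perturb c h (\<eta> j) e)" for j
    using h(1) by (intro ballI concave_perturb) (auto simp: \<eta>_def)
  have "\<exists>s. approx_blocked V E B (perturb c h (\<eta> j)) (1 / D j) (1 / D j) s" for j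
    by (rule approx_blocked_exists[OF G conc B]) (simp add: D_def)
  then obtain s where s: "\<And>j. approx_blocked V E B (perturb c h (\<eta> j)) (1 / D j) (1 / D j) (s j)"
    by metis
  have Dd: "1 / real (D j) \<le> d" for j
    using n0 by (intro order_trans[OF _ less_imp_le[OF n0]]) (simp add: D_def field_simps)
  let ?C = "real (card E + 1) ^ card E * (3 * d)"
  have close: "\<bar>s j e - c e\<bar> \<le> ?C" if e: "e \<in> E" for j e
  proof -
    have "approx_blocked V E B (perturb c h (\<eta> j)) d d (s j)"
      by (rule approx_blocked_mono[OF G conc s]) (use Dd in \<open>auto simp: D_def\<close>)
    moreover have "approx_blocked V E B (perturb c h (\<eta> j)) d d c"
      using approx_blocked_perturb[OF c d] by (simp add: \<eta>_def)
    moreover have "perturb c h (\<eta> j) f (y + d) - perturb c h (\<eta> j) f y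
        < perturb c h (\<eta> j) f (x + d) - perturb c h (\<eta> j) f x"
      if "f \<in> E" "0 \<le> x" "x < y" for f x y
      by (rule perturb_increment_less) (use that h(1) d in \<open>auto simp: \<eta>_def\<close>)
    \<comment> \<open>Stability with \<open>t = d\<close>, the source of the factor 3;
      \<open>\<eta> j\<close> does not occur, so the bound survives the limit.\<close>
    ultimately have "\<bar>s j e - c e\<bar> \<le> real (card E + 1) ^ card E * (2 * d + d)"
      using d e by (intro approx_blocked_close[OF G _ conc]) auto
    then show ?thesis by simp
  qed
  have "\<bar>s j e\<bar> \<le> \<bar>c e\<bar> + ?C" if "e \<in> E" for j e using close[OF that, of j] by linarith
  from finite_bounded_subseq[of E s "\<lambda>e. \<bar>c e\<bar> + ?C", OF finite_edges[OF G] this]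
  obtain r l where r: "strict_mono (r :: nat \<Rightarrow> nat)" "\<forall>e\<in>E. (\<lambda>j. s (r j) e) \<longlonglongrightarrow> l e"
    by blast
  have "(\<lambda>j. 1 / real (D j)) \<longlonglongrightarrow> 0"
    using LIMSEQ_ignore_initial_segment[OF lim_inverse_n', of "Suc n0"]
    by (simp add: D_def add.commute)
  then have D0: "(\<lambda>j. 1 / real (D (r j))) \<longlonglongrightarrow> 0"
    using LIMSEQ_subseq_LIMSEQ[OF _ r(1)] by (fastforce simp: o_def)
  have "\<eta> \<longlonglongrightarrow> 0"
    using LIMSEQ_ignore_initial_segment[OF lim_inverse_n', of 1] by (simp add: \<eta>_def[abs_def])
  then have eta0: "(\<lambda>j. \<eta> (r j)) \<longlonglongrightarrow> 0"
    using LIMSEQ_subseq_LIMSEQ[OF _ r(1)] by (fastforce simp: o_def)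
  have "blocked V E B h l"
    by (rule blocked_limit[OF G h, of B c "\<lambda>j. \<eta> (r j)" "\<lambda>j. 1 / real (D (r j))" "\<lambda>j. s (r j)"])
      (use s r(2) D0 eta0 in \<open>auto simp: D_def \<eta>_def\<close>)
  moreover have "\<bar>l e - c e\<bar> \<le> ?C" if e: "e \<in> E" for e
  proof (rule LIMSEQ_le_const2)
    show "(\<lambda>j. \<bar>s (r j) e - c e\<bar>) \<longlonglongrightarrow> \<bar>l e - c e\<bar>"
      using r(2) e by (intro tendsto_intros) auto
    show "\<exists>N. \<forall>j\<ge>N. \<bar>s (r j) e - c e\<bar> \<le> ?C" using close[OF e] by blast
  qed
  ultimately show ?thesis using that by blast
qed

lemma blocked_exists:
  assumes G: "simple_graph V E" and B: "\<forall>v\<in>V. 0 \<le> B v"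
    and h: "\<forall>e\<in>E. concave_on {0..} (h e)" "\<forall>e\<in>E. continuous_on {0..} (h e)"
  shows "\<exists>s. blocked V E B h s"
proof -
  obtain c where "approx_blocked V E B h 1 1 c" using approx_blocked_exists[OF G h(1) B, of 1] by auto
  from blocked_near_approx[OF G B h zero_less_one this] show ?thesis by blast
qed

lemma blocked_unique:
  assumes G: "simple_graph V E" and h: "\<forall>e\<in>E. concave_on {0..} (h e)"
    and sc: "\<forall>e\<in>E. strictly_concave_on {0..} (h e)"
    and s: "blocked V E B h s" "blocked V E B h s'" and e: "e \<in> E"
  shows "s e = s' e"
proof -
  let ?C = "real (card E + 1) ^ card E * 2"
  have "\<bar>s e - s' e\<bar> \<le> ?C * d" if d: "0 < d" for d
  proof -
    have "approx_blocked V E B h d 0 s" "approx_blocked V E B h d 0 s'"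
      using s d unfolding blocked_def approx_blocked_def by blast+
    then show ?thesis
      using approx_blocked_close[OF G _ h d order.refl _ _ e] strictly_concave_increment_less sc d
      by fastforce
  qed
  \<comment> \<open>For this \<open>d\<close> the bound says that the distance is at most half of
    itself.\<close>
  from this[of "\<bar>s e - s' e\<bar> / (2 * ?C)"] show ?thesis by (cases "s e = s' e") (auto simp: field_simps)
qed

section \<open>Blocked contributions and pairwise equilibria\<close>

definition state_of :: "'a set \<Rightarrow> 'a set set \<Rightarrow> ('a set \<Rightarrow> real) \<Rightarrow> 'a \<Rightarrow> 'a set \<Rightarrow> real" where
  "state_of V E s = (\<lambda>v\<in>V. \<lambda>e\<in>incident E v. s e)"

lemma utility_eq_sum:
  assumes G: "simple_graph V E"
    and g: "\<And>u. {v, u} \<in> E \<Longrightarrow> u \<noteq> v \<Longrightarrow>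
      u \<in> V \<Longrightarrow> f {v, u} (s v {v, u}) (s u {v, u}) = g {v, u}"
  shows "utility E f s v = sum g (incident E v)"
proof -
  have "bij_betw (\<lambda>u. {v, u}) {u. {v, u} \<in> E} (incident E v)"
    unfolding bij_betw_def
  proof
    show "inj_on (\<lambda>u. {v, u}) {u. {v, u} \<in> E}" by (auto simp: inj_on_def doubleton_eq_iff)
    have "\<exists>u. e = {v, u}" if ev: "e \<in> E" "v \<in> e" for e
    proof -
      obtain a b where "e = {a, b}" using G ev(1) by (auto simp: simple_graph_def card_2_iff)
      then show ?thesis using ev(2) by (cases "v = a") (auto simp: insert_commute)
    qed
    then show "(\<lambda>u. {v, u}) ` {u. {v, u} \<in> E} = incident E v"
      by (fastforce simp: incident_def image_iff)
  qed
  then have "sum g (incident E v) = (\<Sum>u | {v, u} \<in> E. g {v, u})"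
    by (rule sum.reindex_bij_betw[symmetric])
  also have "\<dots> = utility E f s v"
    unfolding utility_def
  proof (intro sum.cong refl)
    fix u assume "u \<in> {u. {v, u} \<in> E}"
    then have "{v, u} \<in> E" "card {v, u} = 2" "u \<in> V" using G by (auto simp: simple_graph_def)
    moreover from this have "u \<noteq> v" by auto
    ultimately show "g {v, u} = f {v, u} (s v {v, u}) (s u {v, u})" using g by simp
  qed
  finally show ?thesis ..
qed

text \<open>Only \<open>e\<close> may be raised. Either some other edge is lowered by more than the
  amount \<open>d\<close> added to \<open>e\<close>, and its loss alone outweighs the gain; or all
  are lowered by at most \<open>d\<close>, and then each loses at least \<open>gain / d\<close> per
  unit withdrawn, for at least \<open>d\<close> units in total.\<close>

lemma blocks_no_gain:
  assumes G: "simple_graph V E"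
    and h: "\<forall>e\<in>E. concave_on {0..} (h e)" "\<forall>e\<in>E. mono_on {0..} (h e)"
    and s: "\<forall>e\<in>E. 0 \<le> s e" and e: "e \<in> incident E w"
    and b: "\<forall>d>0. blocks E B h s d 0 w e"
    and t: "\<And>f. f \<in> incident E w \<Longrightarrow> 0 \<le> t f"
      "\<And>f. f \<in> incident E w \<Longrightarrow> f \<noteq> e \<Longrightarrow>
        t f \<le> s f" "sum t (incident E w) \<le> B w"
  shows "(\<Sum>f\<in>incident E w. h f (t f)) \<le> (\<Sum>f\<in>incident E w. h f (s f))"
proof -
  let ?I = "incident E w"
  have fin: "finite ?I" using finite_incident[OF G] .
  have IE: "f \<in> E" if "f \<in> ?I" for f using that by (simp add: incident_def)
  have mono: "h f a \<le> h f b" if "f \<in> ?I" "0 \<le> a" "a \<le> b" for f a b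
    using h(2) IE that mono_onD[of "{0..}" "h f" a b] by auto
  show ?thesis
  proof (cases "t e \<le> s e")
    case True
    then show ?thesis using t mono by (intro sum_mono) metis
  next
    case False
    define d where "d = t e - s e"
    define loss where "loss f = h f (s f) - h f (t f)" for f
    define gain where "gain = h e (s e + d) - h e (s e)"
    have d: "0 < d" using False by (simp add: d_def)
    have se: "0 \<le> s e" using s IE e by auto
    have "0 \<le> gain" using mono[OF e se, of "s e + d"] d by (simp add: gain_def)
    have le: "h e (s e + r) - h e (s e) \<le> h f (s f) - h f (s f - r)"
      if "f \<in> ?I" "f \<noteq> e" "r \<le> s f" "0 < r" for f r
      using b that by (auto simp: blocks_def)
    have loss0: "0 \<le> loss f" if "f \<in> ?I" "f \<noteq> e" for f
      using mono[of f "t f" "s f"] t that by (simp add: loss_def)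
    have lossd: "d * loss f \<ge> (s f - t f) * gain" if f: "f \<in> ?I" "f \<noteq> e" "s f - t f \<le> d" for f
    proof (cases "s f = t f")
      case False
      then have r: "0 < s f - t f" using t(2) f by force
      have "(s f - t f) * gain \<le> d * (h e (s e + (s f - t f)) - h e (s e))"
        unfolding gain_def using h(1) IE e se r f(3) by (intro concave_increment_slope) auto
      also have "\<dots> \<le> d * loss f"
        using le[OF f(1,2), of "s f - t f"] r t(1)[OF f(1)] d unfolding loss_def
        by (intro mult_left_mono) auto
      finally show ?thesis .
    qed (simp add: loss_def)
    have "gain \<le> (\<Sum>f\<in>?I - {e}. loss f)"
    proof (cases "\<exists>f\<in>?I - {e}. d < s f - t f")
      case True
      then obtain f where f: "f \<in> ?I" "f \<noteq> e" "d < s f - t f" by auto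
      have "gain \<le> h f (s f) - h f (s f - d)"
        unfolding gain_def using f d t(1)[OF f(1)] by (intro le) auto
      also have "\<dots> \<le> loss f"
        using mono[OF f(1) t(1)[OF f(1)], of "s f - d"] f(3) by (simp add: loss_def)
      also have "\<dots> \<le> (\<Sum>f\<in>?I - {e}. loss f)"
        using f fin loss0 by (intro member_le_sum) auto
      finally show ?thesis .
    next
      case False
      \<comment> \<open>Only the saturation of \<open>w\<close> is extracted; the step size 1 is
        arbitrary.\<close>
      have "blocks E B h s 1 0 w e" using b by simp
      then have "sum t ?I \<le> sum s ?I" using t(3) by (simp add: blocks_def)
      then have "d \<le> (\<Sum>f\<in>?I - {e}. s f - t f)"
        using sum.remove[OF fin e, of t] sum.remove[OF fin e, of s]
        by (simp add: d_def sum_subtractf)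
      then have "d * gain \<le> (\<Sum>f\<in>?I - {e}. s f - t f) * gain"
        using \<open>0 \<le> gain\<close> by (intro mult_right_mono)
      also have "\<dots> \<le> (\<Sum>f\<in>?I - {e}. d * loss f)"
        unfolding sum_distrib_right using lossd False by (intro sum_mono) (auto simp: not_less)
      finally show ?thesis using d by (simp add: sum_distrib_left[symmetric])
    qed
    then show ?thesis
      using sum.remove[OF fin e, of "\<lambda>f. h f (t f)"] sum.remove[OF fin e, of "\<lambda>f. h f (s f)"]
      by (simp add: gain_def d_def loss_def sum_subtractf)
  qed
qed

lemma strategiesD:
  assumes "x \<in> strategies E B v"
  shows "\<And>e. e \<in> incident E v \<Longrightarrow> 0 \<le> x e" "sum x (incident E v) \<le> B v" "x \<in> extensional (incident E v)"
  using assms by (auto simp: strategies_def PiE_def Pi_def)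

text \<open>A lone deviator meets partners that still give \<open>s\<close>, so no minimum can rise.
  In a joint deviation only the common edge can rise, and its blocking endpoint does not
  gain.\<close>

lemma blocked_imp_equilibrium:
  assumes G: "simple_graph V E"
    and h: "\<forall>e\<in>E. concave_on {0..} (h e)" "\<forall>e\<in>E. mono_on {0..} (h e)"
    and s: "blocked V E B h s"
  shows "min_effort_equilibrium V E B h (state_of V E s)"
proof -
  let ?S = "state_of V E s" and ?f = "min_effort h"
  have s0: "0 \<le> s e" if "e \<in> E" for e using s that by (simp add: blocked_def feasible_def)
  have EV: "{a, b} \<in> E \<Longrightarrow> a \<in> V \<and> b \<in> V" for a b using G
    by (auto simp: simple_graph_def)
  have Sv: "?S v e = s e" if "v \<in> V" "e \<in> E" "v \<in> e" for v e
    using that by (simp add: state_of_def incident_def)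
  have states: "?S \<in> states V E B"
    using s s0 by (auto simp: states_def strategies_def state_of_def blocked_def feasible_def incident_def)
  have util: "utility E ?f ?S v = (\<Sum>e\<in>incident E v. h e (s e))" if "v \<in> V" for v
    using that by (intro utility_eq_sum[OF G]) (simp add: min_effort_def Sv)
  have no_loss: "(\<Sum>e\<in>incident E v. h e (min (x e) (s e))) \<le> (\<Sum>e\<in>incident E v. h e (s e))"
    if "x \<in> strategies E B v" for x v
  proof (intro sum_mono)
    fix e assume e: "e \<in> incident E v"
    then have "e \<in> E" by (simp add: incident_def)
    then show "h e (min (x e) (s e)) \<le> h e (s e)"
      using h(2) s0[of e] strategiesD(1)[OF that e] mono_onD[of "{0..}" "h e" "min (x e) (s e)" "s e"]
      by simp
  qed
  have nash: "nash_equilibrium V E B ?f ?S"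
    unfolding nash_equilibrium_def
  proof (intro conjI states ballI)
    fix v x assume v: "v \<in> V" and x: "x \<in> strategies E B v"
    have "utility E ?f (?S(v := x)) v = (\<Sum>e\<in>incident E v. h e (min (x e) (s e)))"
      using v by (intro utility_eq_sum[OF G]) (simp add: min_effort_def Sv)
    then show "utility E ?f (?S(v := x)) v \<le> utility E ?f ?S v" using no_loss[OF x] v by (simp add: util)
  qed
  have dev: "\<not> utility E ?f ?S w < utility E ?f (?S(w := x, z := y)) w"
    if w: "w \<in> V" "z \<in> V" "w \<noteq> z" and x: "x \<in> strategies E B w" and y: "y \<in> strategies E B z"
      and b: "{w, z} \<in> E \<Longrightarrow> \<forall>d>0. blocks E B h s d 0 w {w, z}" for w z x y
  proof -
    define t where "t e = (if e = {w, z} then min (x e) (y e) else min (x e) (s e))" for e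
    have "utility E ?f (?S(w := x, z := y)) w = (\<Sum>e\<in>incident E w. h e (t e))"
      using w by (intro utility_eq_sum[OF G]) (auto simp: min_effort_def Sv t_def doubleton_eq_iff)
    also have "\<dots> \<le> (\<Sum>e\<in>incident E w. h e (s e))"
    proof (cases "{w, z} \<in> E")
      case True
      show ?thesis
      proof (rule blocks_no_gain[OF G h _ _ b[OF True]])
        show "\<forall>e\<in>E. 0 \<le> s e" using s0 by blast
        show "{w, z} \<in> incident E w" using True by (simp add: incident_def)
        show "0 \<le> t f" if "f \<in> incident E w" for f
        proof -
          have "f = {w, z} \<Longrightarrow> f \<in> incident E z" using True by (simp add: incident_def)
          then show ?thesis using strategiesD(1)[OF x that] strategiesD(1)[OF y, of f] s0 that
            by (auto simp: t_def incident_def)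
        qed
        show "t f \<le> s f" if "f \<noteq> {w, z}" for f using that by (simp add: t_def)
        have "sum t (incident E w) \<le> sum x (incident E w)" by (intro sum_mono) (simp add: t_def)
        then show "sum t (incident E w) \<le> B w" using strategiesD(2)[OF x] by simp
      qed
    next
      case False
      then have "(\<Sum>e\<in>incident E w. h e (t e)) = (\<Sum>e\<in>incident E w. h e (min (x e) (s e)))"
        by (intro sum.cong) (auto simp: t_def incident_def)
      then show ?thesis using no_loss[OF x] by simp
    qed
    finally show ?thesis using w by (simp add: util)
  qed
  have "\<not> improving_bilateral_deviation V E B ?f ?S u v x y" for u v x y
  proof
    assume "improving_bilateral_deviation V E B ?f ?S u v x y"
    then have d: "u \<in> V" "v \<in> V" "u \<noteq> v" "x \<in> strategies E B u" "y \<in> strategies E B v"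
      "utility E ?f ?S u < utility E ?f (?S(u := x, v := y)) u"
      "utility E ?f ?S v < utility E ?f (?S(v := y, u := x)) v"
      by (auto simp: improving_bilateral_deviation_def fun_upd_twist)
    have "{u, v} \<in> E" "\<not> (\<forall>d>0. blocks E B h s d 0 u {u, v})"
      using dev[of u v x y] d by blast+
    moreover have "\<not> (\<forall>d>0. blocks E B h s d 0 v {u, v})"
      using dev[of v u y x] d by (auto simp: insert_commute)
    ultimately show False using s by (auto simp: blocked_def)
  qed
  moreover have "matched E ?S" using EV by (auto simp: matched_def Sv)
  ultimately show ?thesis
    using nash by (auto simp: min_effort_equilibrium_def pairwise_equilibrium_def)
qed

text \<open>All amounts up to some \<open>r\<close> are provided, not just one, because both
  endpoints of \<open>e\<close> must be able to raise it by the same amount. Spare budget pays since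
  \<open>h e\<close> is strictly increasing; otherwise the profitable shift from \<open>f\<close> is
  scaled down.\<close>

lemma not_blocks_improving:
  assumes G: "simple_graph V E"
    and h: "\<forall>e\<in>E. strictly_concave_on {0..} (h e)" "\<forall>e\<in>E. mono_on {0..} (h e)"
      "\<forall>e\<in>E. concave_on {0..} (h e)"
    and s: "feasible V E B s" and e: "e \<in> incident E w" and w: "w \<in> V"
    and b: "0 < d" "\<not> blocks E B h s d 0 w e"
  obtains r where "0 < r" "\<And>q. 0 < q \<Longrightarrow> q \<le> r \<Longrightarrow>
    \<exists>x\<in>strategies E B w.
      x e = s e + q \<and> (\<forall>f\<in>incident E w. f \<noteq> e \<longrightarrow> x f \<le> s f) \<and>
      (\<Sum>f\<in>incident E w. h f (s f)) < (\<Sum>f\<in>incident E w. h f (x f))"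
proof -
  let ?I = "incident E w"
  have fin: "finite ?I" using finite_incident[OF G] .
  have IE: "f \<in> E" if "f \<in> ?I" for f using that by (simp add: incident_def)
  have s0: "0 \<le> s f" if "f \<in> ?I" for f using s that IE by (simp add: feasible_def)
  have le: "sum s ?I \<le> B w" using s w by (simp add: feasible_def)
  show ?thesis
  proof (cases "sum s ?I < B w")
    case True
    show ?thesis
    proof (rule that[of "B w - sum s ?I"])
      fix q assume q: "0 < q" "q \<le> B w - sum s ?I"
      let ?x = "restrict (s(e := s e + q)) ?I"
      have rest: "(\<Sum>f\<in>?I - {e}. ?x f) = (\<Sum>f\<in>?I - {e}. s f)"
        "(\<Sum>f\<in>?I - {e}. h f (?x f)) = (\<Sum>f\<in>?I - {e}. h f (s f))"
        by (auto intro: sum.cong)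
      have "h e (s e) < h e (s e + q)"
        using strictly_concave_mono_imp_strict h IE[OF e] s0[OF e] q by simp
      then have "(\<Sum>f\<in>?I. h f (s f)) < (\<Sum>f\<in>?I. h f (?x f))"
        using sum.remove[OF fin e, of "\<lambda>f. h f (s f)"] sum.remove[OF fin e, of "\<lambda>f. h f (?x f)"] rest e
        by simp
      moreover have "sum ?x ?I = sum s ?I + q"
        using sum.remove[OF fin e, of s] sum.remove[OF fin e, of ?x] rest e by simp
      then have "?x \<in> strategies E B w" using q s0 by (auto simp: strategies_def)
      ultimately show "\<exists>x\<in>strategies E B w. x e = s e + q \<and> (\<forall>f\<in>?I. f \<noteq> e \<longrightarrow> x f \<le> s f) \<and>
          (\<Sum>f\<in>?I. h f (s f)) < (\<Sum>f\<in>?I. h f (x f))"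
        using e by (intro bexI[of _ ?x]) auto
    qed (use True in simp)
  next
    case False
    then obtain f where f: "f \<in> ?I" "f \<noteq> e" "d \<le> s f"
      "h f (s f) - h f (s f - d) < h e (s e + d) - h e (s e)"
      using b by (auto simp: blocks_def not_le)
    show ?thesis
    proof (rule that[of d])
      fix q assume q: "0 < q" "q \<le> d"
      have gain: "h f (s f) - h f (s f - q) < h e (s e + q) - h e (s e)"
        using increment_le_decrement_mono[of "h e" "h f" "s e" q d "s f"] h(3) IE[OF e] IE[OF f(1)]
          s0[OF e] q f(3,4) by force
      let ?x = "restrict (s(e := s e + q, f := s f - q)) ?I"
      have fin': "finite (?I - {e})" and f': "f \<in> ?I - {e}" using fin f by auto
      have rest: "(\<Sum>k\<in>?I - {e} - {f}. ?x k) = (\<Sum>k\<in>?I - {e} - {f}. s k)"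
        "(\<Sum>k\<in>?I - {e} - {f}. h k (?x k)) = (\<Sum>k\<in>?I - {e} - {f}. h k (s k))"
        by (auto intro: sum.cong)
      have split: "sum g ?I = g e + (g f + sum g (?I - {e} - {f}))" for g :: "'a set \<Rightarrow> real"
        using sum.remove[OF fin e, of g] sum.remove[OF fin' f', of g] by simp
      have "(\<Sum>f\<in>?I. h f (s f)) < (\<Sum>f\<in>?I. h f (?x f))"
        using gain f e rest(2) unfolding split[of "\<lambda>f. h f (s f)"] split[of "\<lambda>f. h f (?x f)"] by simp
      moreover have "sum ?x ?I = sum s ?I"
        using f e rest(1) unfolding split[of ?x] split[of s] by simp
      then have "?x \<in> strategies E B w" using q s0 f le by (auto simp: strategies_def)
      ultimately show "\<exists>x\<in>strategies E B w. x e = s e + q \<and> (\<forall>f\<in>?I. f \<noteq> e \<longrightarrow> x f \<le> s f) \<and>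
          (\<Sum>f\<in>?I. h f (s f)) < (\<Sum>f\<in>?I. h f (x f))"
        using e f q by (intro bexI[of _ ?x]) auto
    qed (rule b)
  qed
qed

text \<open>Needed for uniqueness: it excludes equilibria outside the blocked solutions. Such ones
  can exist for rewards that become constant, where unspent budget gives no incentive.\<close>

lemma equilibrium_imp_blocked:
  assumes G: "simple_graph V E"
    and h: "\<forall>e\<in>E. strictly_concave_on {0..} (h e)" "\<forall>e\<in>E. mono_on {0..} (h e)"
      "\<forall>e\<in>E. concave_on {0..} (h e)"
    and S: "min_effort_equilibrium V E B h S"
  obtains s where "blocked V E B h s" "S = state_of V E s"
proof -
  let ?f = "min_effort h"
  \<comment> \<open>Any endpoint would do, since \<open>S\<close> is matched.\<close>
  define s where "s e = S (SOME v. v \<in> e) e" for e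
  have states: "S \<in> states V E B"
    using S by (simp add: min_effort_equilibrium_def pairwise_equilibrium_def nash_equilibrium_def)
  have m: "matched E S" using S by (simp add: min_effort_equilibrium_def)
  have EV: "e \<subseteq> V" if "e \<in> E" for e using G that by (auto simp: simple_graph_def)
  have Ss: "S v e = s e" if e: "e \<in> E" "v \<in> e" for v e
  proof -
    have z: "(SOME v. v \<in> e) \<in> e" using e by (intro someI)
    obtain a b where "e = {a, b}" using G e by (auto simp: simple_graph_def card_2_iff)
    then show ?thesis using m e z unfolding matched_def s_def by (metis insert_commute insertE singletonD)
  qed
  have strat: "S v \<in> strategies E B v" if "v \<in> V" for v using states that by (auto simp: states_def)
  have "S = state_of V E s"
  proof
    fix v
    show "S v = state_of V E s v"
    proof (cases "v \<in> V")
      case True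
      then show ?thesis using strategiesD(3)[OF strat, of v]
        by (auto simp: state_of_def fun_eq_iff restrict_def extensional_def Ss incident_def)
    next
      case False
      then show ?thesis using states by (simp add: states_def state_of_def PiE_arb[of S V])
    qed
  qed
  have feas: "feasible V E B s"
    unfolding feasible_def
  proof (intro conjI ballI)
    fix e assume e: "e \<in> E"
    then obtain v where v: "v \<in> e" using G by (fastforce simp: simple_graph_def)
    then show "0 \<le> s e" using strategiesD(1)[OF strat, of v e] EV[OF e] e Ss[OF e v] by (auto simp: incident_def)
  next
    fix v assume v: "v \<in> V"
    have "sum s (incident E v) = sum (S v) (incident E v)" by (intro sum.cong) (auto simp: Ss incident_def)
    then show "sum s (incident E v) \<le> B v" using strategiesD(2)[OF strat[OF v]] by simp
  qed
  have "\<exists>w\<in>e. \<forall>d>0. blocks E B h s d 0 w e" if e: "e \<in> E" for e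
  proof (rule ccontr)
    assume nb: "\<not> ?thesis"
    obtain u v where uv: "e = {u, v}" "u \<noteq> v" using G e by (auto simp: simple_graph_def card_2_iff)
    have V: "u \<in> V" "v \<in> V" using EV[OF e] uv by auto
    have I: "e \<in> incident E u" "e \<in> incident E v" using e uv by (auto simp: incident_def)
    obtain du dv where d: "0 < du" "\<not> blocks E B h s du 0 u e" "0 < dv" "\<not> blocks E B h s dv 0 v e"
      using nb uv by blast
    obtain ru where ru: "0 < ru" "\<And>q. 0 < q \<Longrightarrow> q \<le> ru \<Longrightarrow>
      \<exists>x\<in>strategies E B u.
      x e = s e + q \<and> (\<forall>f\<in>incident E u. f \<noteq> e \<longrightarrow> x f \<le> s f) \<and>
      (\<Sum>f\<in>incident E u. h f (s f)) < (\<Sum>f\<in>incident E u. h f (x f))"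
      by (rule not_blocks_improving[OF G h feas I(1) V(1) d(1,2)]) (rule that)
    obtain rv where rv: "0 < rv" "\<And>q. 0 < q \<Longrightarrow> q \<le> rv \<Longrightarrow>
      \<exists>x\<in>strategies E B v.
      x e = s e + q \<and> (\<forall>f\<in>incident E v. f \<noteq> e \<longrightarrow> x f \<le> s f) \<and>
      (\<Sum>f\<in>incident E v. h f (s f)) < (\<Sum>f\<in>incident E v. h f (x f))"
      by (rule not_blocks_improving[OF G h feas I(2) V(2) d(3,4)]) (rule that)
    \<comment> \<open>A raise that both endpoints can afford profitably; the equal amounts make the
      minimum on \<open>e\<close> follow.\<close>
    define q where "q = min ru rv"
    have q: "0 < q" "q \<le> ru" "q \<le> rv" using ru(1) rv(1) by (auto simp: q_def)
    from ru(2)[OF q(1,2)] obtain x where x: "x \<in> strategies E B u" "x e = s e + q"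
      "\<forall>f\<in>incident E u. f \<noteq> e \<longrightarrow> x f \<le> s f"
      "(\<Sum>f\<in>incident E u. h f (s f)) < (\<Sum>f\<in>incident E u. h f (x f))" by blast
    from rv(2)[OF q(1,3)] obtain y where y: "y \<in> strategies E B v" "y e = s e + q"
      "\<forall>f\<in>incident E v. f \<noteq> e \<longrightarrow> y f \<le> s f"
      "(\<Sum>f\<in>incident E v. h f (s f)) < (\<Sum>f\<in>incident E v. h f (y f))" by blast
    have util: "utility E ?f S w = (\<Sum>e\<in>incident E w. h e (s e))" if "w \<in> V" for w
      using that by (intro utility_eq_sum[OF G]) (simp add: min_effort_def Ss)
    have dev: "utility E ?f (S(w := x, z := y)) w = (\<Sum>f\<in>incident E w. h f (x f))"
      if "w \<noteq> z" "e = {w, z}" "x e = y e" "\<forall>f\<in>incident E w. f \<noteq> e \<longrightarrow> x f \<le> s f" for w z x y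
      using that by (intro utility_eq_sum[OF G])
        (auto simp: min_effort_def Ss incident_def doubleton_eq_iff min_def)
    have "utility E ?f (S(u := x, v := y)) u = (\<Sum>f\<in>incident E u. h f (x f))"
      using uv x y by (intro dev) auto
    moreover have "utility E ?f (S(v := y, u := x)) v = (\<Sum>f\<in>incident E v. h f (y f))"
      using uv x y by (intro dev) auto
    ultimately have "improving_bilateral_deviation V E B ?f S u v x y"
      using V uv x y by (auto simp: improving_bilateral_deviation_def util fun_upd_twist)
    then show False using S by (auto simp: min_effort_equilibrium_def pairwise_equilibrium_def)
  qed
  then have "blocked V E B h s" using feas by (simp add: blocked_def)
  then show ?thesis using that \<open>S = state_of V E s\<close> by blast
qed

section \<open>Cost bounds for programs\<close>

text \<open>Constants weigh their value, so that \<open>L * nsize a\<close> also bounds the bits of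
  a constant; the program text is fixed, so this costs only a constant factor.\<close>

primrec nsize :: "nexp \<Rightarrow> nat" where
  "nsize (NConst c) = 1 + c"
| "nsize (NRead x i) = 1 + nsize i"
| "nsize (NAdd a b) = 1 + nsize a + nsize b"
| "nsize (NSub a b) = 1 + nsize a + nsize b"
| "nsize (NMul a b) = 1 + nsize a + nsize b"
| "nsize (NDiv a b) = 1 + nsize a + nsize b"

primrec rsize :: "rexp \<Rightarrow> nat" where
  "rsize (RRead x i) = 1 + nsize i"
| "rsize (RAdd a b) = 1 + rsize a + rsize b"
| "rsize (RSub a b) = 1 + rsize a + rsize b"
| "rsize (RQuery i a b) = 1 + nsize i + nsize a + nsize b"

primrec bsize :: "bexp \<Rightarrow> nat" where
  "bsize (NLess a b) = 1 + nsize a + nsize b"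
| "bsize (RLess a b) = 1 + rsize a + rsize b"
| "bsize (BNot c) = 1 + bsize c"
| "bsize (BAnd c d) = 1 + bsize c + bsize d"

definition bounded_mem :: "nat \<Rightarrow> nmem \<Rightarrow> bool" where
  "bounded_mem L N \<longleftrightarrow> (\<forall>x i. N x i < 2 ^ L)"

lemma bounded_mem_upd: "bounded_mem L N \<Longrightarrow> v < 2 ^ L \<Longrightarrow>
  bounded_mem L (N(x := (N x)(i := v)))"
  by (auto simp: bounded_mem_def)

lemma binlen_le: "v < 2 ^ w \<Longrightarrow> binlen v \<le> w"
  by (simp add: floorlog_le_iff)

lemma nval_bound:
  assumes N: "bounded_mem L N" and L: "1 \<le> L"
  shows "nval N a < 2 ^ (L * nsize a)"
proof (induction a)
  case (NConst c)
  have "c < 2 ^ c" by (rule less_exp)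
  also have "c \<le> L * (1 + c)" using mult_le_mono1[OF L, of "1 + c"] by simp
  then have "2 ^ c \<le> (2::nat) ^ (L * (1 + c))" by (intro power_increasing) auto
  finally show ?case by simp
next
  case (NRead x i)
  have "N x (nval N i) < 2 ^ L" using N by (simp add: bounded_mem_def)
  also have "\<dots> \<le> (2::nat) ^ (L * (1 + nsize i))" by (intro power_increasing) auto
  finally show ?case by simp
next
  case (NAdd a b)
  have "nval N a + nval N b < 2 ^ (L * nsize a) + 2 ^ (L * nsize b)" using NAdd by linarith
  also have "\<dots> \<le> 2 ^ (L * nsize a + L * nsize b) + 2 ^ (L * nsize a + L * nsize b)"
    by (intro add_mono power_increasing) auto
  also have "\<dots> = 2 ^ (1 + L * nsize a + L * nsize b)" by simp
  also have "\<dots> \<le> (2::nat) ^ (L * nsize (NAdd a b))"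
    using L by (intro power_increasing) (auto simp: algebra_simps)
  finally show ?case by simp
next
  case (NSub a b)
  have "nval N a - nval N b \<le> nval N a" by simp
  also have "\<dots> < 2 ^ (L * nsize a)" by (rule NSub)
  also have "\<dots> \<le> (2::nat) ^ (L * nsize (NSub a b))" by (intro power_increasing) (auto simp: algebra_simps)
  finally show ?case by simp
next
  case (NMul a b)
  have "nval N a * nval N b \<le> 2 ^ (L * nsize a) * 2 ^ (L * nsize b)"
    using NMul by (intro mult_mono) auto
  also have "\<dots> = 2 ^ (L * nsize a + L * nsize b)" by (simp add: power_add)
  also have "\<dots> < (2::nat) ^ (L * nsize (NMul a b))"
    using L by (intro power_strict_increasing) (auto simp: algebra_simps)
  finally show ?case by simp
next
  case (NDiv a b)
  have "nval N a div nval N b \<le> nval N a" by simp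
  also have "\<dots> < 2 ^ (L * nsize a)" by (rule NDiv)
  also have "\<dots> \<le> (2::nat) ^ (L * nsize (NDiv a b))" by (intro power_increasing) (auto simp: algebra_simps)
  finally show ?case by simp
qed

text \<open>Induction step of all cost bounds: each of at most \<open>s\<close> nodes is charged one
  plus \<open>L * s\<close>, the largest bit length below the root.\<close>

lemma size_cost_step:
  fixes s :: nat
  assumes "c \<le> s1 * (1 + L * s1)" "d \<le> s2 * (1 + L * s2)" "s1 + s2 < s"
  shows "1 + L * s + c + d \<le> s * (1 + L * s)"
proof -
  have "s1 * (1 + L * s1) \<le> s1 * (1 + L * s)" "s2 * (1 + L * s2) \<le> s2 * (1 + L * s)"
    using assms(3) by (auto intro!: mult_left_mono)
  then have "c + d \<le> (s1 + s2) * (1 + L * s)"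
    using assms(1,2) by (simp only: distrib_right)
  then have "1 + L * s + c + d \<le> (1 + s1 + s2) * (1 + L * s)" by simp
  also have "\<dots> \<le> s * (1 + L * s)" using assms(3) by (intro mult_right_mono) auto
  finally show ?thesis .
qed

lemma ncost_bound:
  assumes N: "bounded_mem L N" and L: "1 \<le> L"
  shows "ncost N a \<le> nsize a * (1 + L * nsize a)"
proof (induction a)
  case (NConst c)
  then show ?case using binlen_le[OF nval_bound[OF assms, of "NConst c"]] by simp
next
  case (NRead x i)
  then show ?case
    using binlen_le[OF nval_bound[OF assms, of "NRead x i"]]
      size_cost_step[of _ "nsize i" L 0 0 "nsize (NRead x i)", OF NRead] by simp
next
  case (NAdd a b)
  show ?case using binlen_le[OF nval_bound[OF assms, of "NAdd a b"]]
      size_cost_step[OF NAdd, of "nsize (NAdd a b)"] by simp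
next
  case (NSub a b)
  show ?case using binlen_le[OF nval_bound[OF assms, of "NSub a b"]]
      size_cost_step[OF NSub, of "nsize (NSub a b)"] by simp
next
  case (NMul a b)
  show ?case using binlen_le[OF nval_bound[OF assms, of "NMul a b"]]
      size_cost_step[OF NMul, of "nsize (NMul a b)"] by simp
next
  case (NDiv a b)
  show ?case using binlen_le[OF nval_bound[OF assms, of "NDiv a b"]]
      size_cost_step[OF NDiv, of "nsize (NDiv a b)"] by simp
qed

lemma rcost_bound:
  assumes N: "bounded_mem L N" and L: "1 \<le> L"
  shows "rcost N a \<le> rsize a * (1 + L * rsize a)"
proof (induction a)
  case (RRead x i)
  then show ?case
    using size_cost_step[of _ "nsize i" L 0 0 "rsize (RRead x i)", OF ncost_bound[OF assms]] by simp
next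
  case (RAdd a b)
  show ?case using size_cost_step[OF RAdd, of "rsize (RAdd a b)"] by simp
next
  case (RSub a b)
  show ?case using size_cost_step[OF RSub, of "rsize (RSub a b)"] by simp
next
  case (RQuery i a b)
  have "ncost N a + ncost N b \<le> (nsize a + nsize b) * (1 + L * (nsize a + nsize b))"
  proof -
    have "ncost N a \<le> nsize a * (1 + L * (nsize a + nsize b))"
      by (rule order_trans[OF ncost_bound[OF assms]]) (intro mult_left_mono, auto)
    moreover have "ncost N b \<le> nsize b * (1 + L * (nsize a + nsize b))"
      by (rule order_trans[OF ncost_bound[OF assms]]) (intro mult_left_mono, auto)
    ultimately show ?thesis by (simp only: distrib_right)
  qed
  then show ?case
    using size_cost_step[OF ncost_bound[OF assms, of i], of _ _ "rsize (RQuery i a b)"] by fastforce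
qed

lemma bcost_bound:
  assumes N: "bounded_mem L N" and L: "1 \<le> L"
  shows "bcost N a \<le> bsize a * (1 + L * bsize a)"
proof (induction a)
  case (NLess a b)
  show ?case
    using size_cost_step[OF ncost_bound[OF assms] ncost_bound[OF assms], of a b "bsize (NLess a b)"]
    by simp
next
  case (RLess a b)
  show ?case
    using size_cost_step[OF rcost_bound[OF assms] rcost_bound[OF assms], of a b "bsize (RLess a b)"]
    by simp
next
  case (BNot a)
  then show ?case using size_cost_step[of _ "bsize a" L 0 0 "bsize (BNot a)", OF BNot] by simp
next
  case (BAnd a b)
  show ?case using size_cost_step[OF BAnd, of "bsize (BAnd a b)"] by simp
qed

definition set_var :: "nat \<Rightarrow> nexp \<Rightarrow> com" where
  "set_var x a = NWrite x (NConst 0) a"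

abbreviation var :: "nat \<Rightarrow> nexp" where
  "var x \<equiv> NRead x (NConst 0)"

definition for_loop :: "nat \<Rightarrow> nexp \<Rightarrow> com \<Rightarrow> com" where
  "for_loop x a c = Seq (set_var x (NConst 0))
     (Loop (NLess (var x) a) (Seq c (set_var x (NAdd (var x) (NConst 1)))))"

text \<open>
  Memories are described by abstract states via \<open>mk\<close>, \<open>L\<close> bounds the binary length of all memory
  cells and \<open>S\<close> the size of all expressions, so that \<open>step\<close> bounds the cost of one command apart
  from its components.
\<close>

locale cost_logic =
  fixes orc :: oracle_fun and mk :: "'st \<Rightarrow> nmem" and L S :: nat
  assumes L_pos: "1 \<le> L"
begin

definition step :: nat where
  "step = 1 + S * (1 + L * S)"

text \<open>A total-correctness triple with cost bound \<open>T\<close>. The real memory stays zero: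
  oracle answers are compared at once and never stored. The cell bound travels along because the
  cost of every command depends on it.\<close>

definition runs :: "com \<Rightarrow> 'st \<Rightarrow> nat \<Rightarrow> ('st \<Rightarrow> bool) \<Rightarrow> bool" where
  "runs c \<sigma> T Q \<longleftrightarrow> (bounded_mem L (mk \<sigma>) \<longrightarrow>
     (\<exists>t \<sigma>'. exec orc c (mk \<sigma>)
       (\<lambda>_ _. 0) t (mk \<sigma>') (\<lambda>_ _. 0) \<and> t \<le> T \<and>
       bounded_mem L (mk \<sigma>') \<and> Q \<sigma>'))"

definition loop_time :: "nat \<Rightarrow> nat \<Rightarrow> nat" where
  "loop_time q T = q * (step + T) + step"

definition for_time :: "nat \<Rightarrow> nat \<Rightarrow> nat" where
  "for_time q T = step + loop_time q (T + step)"

lemma size_cost_mono: "s \<le> S \<Longrightarrow> s * (1 + L * s) \<le> S * (1 + L * S)"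
  by (intro mult_mono) auto

lemma runs_conseq: "runs c \<sigma> T Q \<Longrightarrow> T \<le> T' \<Longrightarrow>
  (\<And>\<sigma>'. Q \<sigma>' \<Longrightarrow> Q' \<sigma>') \<Longrightarrow> runs c \<sigma> T' Q'"
  unfolding runs_def by (meson order_trans)

lemma runs_Skip: "Q \<sigma> \<Longrightarrow> runs Skip \<sigma> step Q"
  unfolding runs_def step_def using exec.Skip by force

lemma runs_NWrite:
  assumes "(mk \<sigma>)(x := (mk \<sigma> x)(p := nval (mk \<sigma>) a)) = mk \<sigma>'"
    and p: "nval (mk \<sigma>) i = p" and s: "nsize i + nsize a \<le> S"
    and v: "nval (mk \<sigma>) a < 2 ^ L" and Q: "Q \<sigma>'"
  shows "runs (NWrite x i a) \<sigma> step Q"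
  unfolding runs_def
proof
  assume b: "bounded_mem L (mk \<sigma>)"
  have e: "exec orc (NWrite x i a) (mk \<sigma>) (\<lambda>_ _. 0) (1 + ncost (mk \<sigma>) i + ncost (mk \<sigma>) a) (mk \<sigma>') (\<lambda>_ _. 0)"
    using exec.NWrite[of orc x i a "mk \<sigma>"] assms(1) p by simp
  have "1 + L * (1 + nsize i + nsize a) + ncost (mk \<sigma>) i + ncost (mk \<sigma>) a
      \<le> (1 + nsize i + nsize a) * (1 + L * (1 + nsize i + nsize a))"
    by (rule size_cost_step[OF ncost_bound[OF b L_pos] ncost_bound[OF b L_pos]]) simp
  then have "ncost (mk \<sigma>) i + ncost (mk \<sigma>) a
      \<le> (nsize i + nsize a) * (1 + L * (nsize i + nsize a))"
  proof -
    have "ncost (mk \<sigma>) i \<le> nsize i * (1 + L * (nsize i + nsize a))"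
      by (rule order_trans[OF ncost_bound[OF b L_pos]]) (intro mult_left_mono, auto)
    moreover have "ncost (mk \<sigma>) a \<le> nsize a * (1 + L * (nsize i + nsize a))"
      by (rule order_trans[OF ncost_bound[OF b L_pos]]) (intro mult_left_mono, auto)
    ultimately show ?thesis by (simp only: distrib_right)
  qed
  also have "\<dots> \<le> S * (1 + L * S)" by (rule size_cost_mono[OF s])
  finally have "1 + ncost (mk \<sigma>) i + ncost (mk \<sigma>) a \<le> step" by (simp add: step_def)
  moreover have "bounded_mem L (mk \<sigma>')"
    using bounded_mem_upd[OF b v, of x p] assms(1) by simp
  ultimately show "\<exists>t \<sigma>'. exec orc (NWrite x i a) (mk \<sigma>)
    (\<lambda>_ _. 0) t (mk \<sigma>') (\<lambda>_ _. 0) \<and>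
      t \<le> step \<and> bounded_mem L (mk \<sigma>') \<and> Q \<sigma>'"
    using e Q by blast
qed

lemma runs_set_var:
  assumes "(mk \<sigma>)(x := (mk \<sigma> x)(0 := nval (mk \<sigma>) a)) = mk \<sigma>'"
    and "nsize a < S" "nval (mk \<sigma>) a < 2 ^ L" "Q \<sigma>'"
  shows "runs (set_var x a) \<sigma> step Q"
  unfolding set_var_def by (rule runs_NWrite[OF assms(1)]) (use assms in auto)

lemma runs_Seq: "runs c \<sigma> T (\<lambda>\<sigma>'. runs d \<sigma>' T' Q) \<Longrightarrow>
  runs (Seq c d) \<sigma> (T + T') Q"
  unfolding runs_def using exec.Seq add_mono by meson

lemma guard_cost: "bounded_mem L (mk \<sigma>) \<Longrightarrow> bsize b \<le> S \<Longrightarrow>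
  1 + bcost (mk \<sigma>) b \<le> step"
  using order_trans[OF bcost_bound[OF _ L_pos] size_cost_mono, of "mk \<sigma>" b] by (simp add: step_def)

lemma runs_Cond:
  assumes s: "bsize b \<le> S"
    and c: "bval orc (mk \<sigma>) (\<lambda>_ _. 0) b \<Longrightarrow> runs c \<sigma> T Q"
    and d: "\<not> bval orc (mk \<sigma>) (\<lambda>_ _. 0) b \<Longrightarrow> runs d \<sigma> T Q"
  shows "runs (Cond b c d) \<sigma> (step + T) Q"
  unfolding runs_def
proof
  assume bd: "bounded_mem L (mk \<sigma>)"
  show "\<exists>t \<sigma>'. exec orc (Cond b c d) (mk \<sigma>)
    (\<lambda>_ _. 0) t (mk \<sigma>') (\<lambda>_ _. 0) \<and>
      t \<le> step + T \<and> bounded_mem L (mk \<sigma>') \<and> Q \<sigma>'"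
  proof (cases "bval orc (mk \<sigma>) (\<lambda>_ _. 0) b")
    case True
    obtain t \<sigma>' where t: "exec orc c (mk \<sigma>)
      (\<lambda>_ _. 0) t (mk \<sigma>') (\<lambda>_ _. 0)" "t \<le> T"
      "bounded_mem L (mk \<sigma>')" "Q \<sigma>'" using c[OF True] bd by (auto simp: runs_def)
    then show ?thesis using exec.CondTrue[of orc _ _ b, OF True t(1), of d] guard_cost[OF bd s]
      by (intro exI[of _ "1 + bcost (mk \<sigma>) b + t"] exI[of _ \<sigma>']) auto
  next
    case False
    obtain t \<sigma>' where t: "exec orc d (mk \<sigma>)
      (\<lambda>_ _. 0) t (mk \<sigma>') (\<lambda>_ _. 0)" "t \<le> T"
      "bounded_mem L (mk \<sigma>')" "Q \<sigma>'" using d[OF False] bd by (auto simp: runs_def)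
    then show ?thesis using exec.CondFalse[of orc _ _ b, OF False t(1), of c] guard_cost[OF bd s]
      by (intro exI[of _ "1 + bcost (mk \<sigma>) b + t"] exI[of _ \<sigma>']) auto
  qed
qed

text \<open>The index of \<open>I\<close> bounds the remaining iterations without counting them
  exactly; in the bisections it is the exponent of a power of two above the current width.\<close>

lemma runs_Loop:
  assumes s: "bsize b \<le> S"
    and body: "\<And>q \<sigma>. I q \<sigma> \<Longrightarrow>
      bval orc (mk \<sigma>) (\<lambda>_ _. 0) b \<Longrightarrow> 0 < q \<and> runs c \<sigma> T (I (q - 1))"
    and exit: "\<And>q \<sigma>. I q \<sigma> \<Longrightarrow>
      \<not> bval orc (mk \<sigma>) (\<lambda>_ _. 0) b \<Longrightarrow> Q \<sigma>"
    and init: "I q \<sigma>"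
  shows "runs (Loop b c) \<sigma> (loop_time q T) Q"
  using init
proof (induction q arbitrary: \<sigma>)
  case 0
  then have F: "\<not> bval orc (mk \<sigma>) (\<lambda>_ _. 0) b" using body by blast
  show ?case
    unfolding runs_def loop_time_def
    using exec.LoopFalse[of orc "mk \<sigma>" _ b, OF F, of c] guard_cost[OF _ s, of \<sigma>] exit[OF 0 F]
    by (auto intro!: exI[of _ "1 + bcost (mk \<sigma>) b"] exI[of _ \<sigma>])
next
  case (Suc q)
  show ?case
    unfolding runs_def
  proof
    assume bd: "bounded_mem L (mk \<sigma>)"
    show "\<exists>t \<sigma>'. exec orc (Loop b c) (mk \<sigma>)
      (\<lambda>_ _. 0) t (mk \<sigma>') (\<lambda>_ _. 0) \<and>
        t \<le> loop_time (Suc q) T \<and> bounded_mem L (mk \<sigma>') \<and> Q \<sigma>'"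
    proof (cases "bval orc (mk \<sigma>) (\<lambda>_ _. 0) b")
      case True
      have "runs c \<sigma> T (I q)" using body[OF Suc.prems True] by simp
      then obtain t \<sigma>' where t: "exec orc c (mk \<sigma>)
        (\<lambda>_ _. 0) t (mk \<sigma>') (\<lambda>_ _. 0)" "t \<le> T"
        "bounded_mem L (mk \<sigma>')" "I q \<sigma>'" using bd unfolding runs_def by blast
      obtain t' \<sigma>'' where t': "exec orc (Loop b c) (mk \<sigma>') (\<lambda>_ _. 0) t' (mk \<sigma>'') (\<lambda>_ _. 0)"
        "t' \<le> loop_time q T" "bounded_mem L (mk \<sigma>'')" "Q \<sigma>''"
        using Suc.IH[OF t(4)] t(3) unfolding runs_def by blast
      have "1 + bcost (mk \<sigma>) b + t + t' \<le> loop_time (Suc q) T"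
        using guard_cost[OF bd s] t(2) t'(2) by (simp add: loop_time_def)
      then show ?thesis using exec.LoopTrue[of orc _ _ b, OF True t(1) t'(1)] t'(3,4) by blast
    next
      case False
      have "1 + bcost (mk \<sigma>) b \<le> loop_time (Suc q) T"
        using guard_cost[OF bd s] by (simp add: loop_time_def)
      then show ?thesis
        using exec.LoopFalse[of orc "mk \<sigma>" _ b, OF False, of c] bd exit[OF Suc.prems False] by blast
    qed
  qed
qed

text \<open>\<open>b\<close> is the actual number of iterations and \<open>q\<close> an upper bound
  for it, so that times can be expressed by the input size alone.\<close>

lemma runs_for_loop:
  fixes upd :: "nat \<Rightarrow> 'st \<Rightarrow> 'st" and ctr :: "'st \<Rightarrow> nat"
  assumes upd: "\<And>\<sigma> v. (mk \<sigma>)(x := (mk \<sigma> x)(0 := v)) = mk (upd v \<sigma>)"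
    and ctr: "\<And>\<sigma>. mk \<sigma> x 0 = ctr \<sigma>" "\<And>\<sigma> v. ctr (upd v \<sigma>) = v"
    and s: "3 + nsize a < S" "6 < S" and B: "b \<le> q" "b < 2 ^ L"
    and frame: "\<And>i v \<sigma>. I i \<sigma> \<Longrightarrow> I i (upd v \<sigma>)"
    and bd: "\<And>i \<sigma>. I i \<sigma> \<Longrightarrow> nval (mk \<sigma>) a = b"
    and init: "I 0 \<sigma>"
    and body: "\<And>i \<sigma>. i < b \<Longrightarrow> I i \<sigma> \<Longrightarrow>
      ctr \<sigma> = i \<Longrightarrow> runs c \<sigma> T (\<lambda>\<sigma>'. ctr \<sigma>' = i \<and> I (Suc i) \<sigma>')"
    and exit: "\<And>\<sigma>. I b \<sigma> \<Longrightarrow> Q \<sigma>"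
  shows "runs (for_loop x a c) \<sigma> (for_time q T) Q"
  unfolding for_loop_def for_time_def
proof (rule runs_Seq, rule runs_set_var[OF upd])
  let ?I = "\<lambda>r \<sigma>. \<exists>i\<le>b. b - i \<le> r \<and> ctr \<sigma> = i \<and> I i \<sigma>"
  have "runs (Loop (NLess (var x) a) (Seq c (set_var x (NAdd (var x) (NConst 1))))) (upd 0 \<sigma>)
      (loop_time q (T + step)) Q"
  proof (rule runs_Loop[where I = ?I])
    fix r \<sigma> assume I: "?I r \<sigma>" and b: "bval orc (mk \<sigma>) (\<lambda>_ _. 0) (NLess (var x) a)"
    then obtain i where i: "i < b" "b - i \<le> r" "ctr \<sigma> = i" "I i \<sigma>" using bd by (auto simp: ctr)
    have "runs (Seq c (set_var x (NAdd (var x) (NConst 1)))) \<sigma> (T + step) (?I (r - 1))"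
    proof (rule runs_Seq, rule runs_conseq[OF body[OF i(1,4,3)] order.refl])
      fix \<sigma>' assume a: "ctr \<sigma>' = i \<and> I (Suc i) \<sigma>'"
      show "runs (set_var x (NAdd (var x) (NConst 1))) \<sigma>' step (?I (r - 1))"
      proof (rule runs_set_var[OF upd])
        show "nval (mk \<sigma>') (NAdd (var x) (NConst 1)) < 2 ^ L" using a i B by (simp add: ctr)
        show "?I (r - 1) (upd (nval (mk \<sigma>') (NAdd (var x) (NConst 1))) \<sigma>')"
          using a i frame by (intro exI[of _ "Suc i"]) (auto simp: ctr)
      qed (use s in simp)
    qed
    then show "0 < r \<and> runs (Seq c (set_var x (NAdd (var x) (NConst 1)))) \<sigma> (T + step) (?I (r - 1))"
      using i by simp
  next
    fix r \<sigma> assume I: "?I r \<sigma>" and b: "\<not> bval orc (mk \<sigma>) (\<lambda>_ _. 0) (NLess (var x) a)"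
    then obtain i where i: "i \<le> b" "ctr \<sigma> = i" "I i \<sigma>" by auto
    then have "i = b" using b bd[OF i(3)] by (simp add: ctr)
    then show "Q \<sigma>" using exit i by simp
  next
    show "?I q (upd 0 \<sigma>)" using init frame B by (intro exI[of _ 0]) (auto simp: ctr)
  qed (use s in simp)
  then show "runs (Loop (NLess (var x) a) (Seq c (set_var x (NAdd (var x) (NConst 1)))))
      (upd (nval (mk \<sigma>) (NConst 0)) \<sigma>) (loop_time q (T + step)) Q" by simp
qed (use s in auto)

end

section \<open>The program\<close>

text \<open>
  Array 5 contains the current allocation, array 6 the candidate that closes the unit below the
  target in variable 15, arrays 8 and 9 the loads of the vertices under either of them.
\<close>

definition cap_exp :: "nexp \<Rightarrow> nexp" where
  "cap_exp v = NDiv (NMul (NRead 3 v) (var 10)) (NRead 4 v)"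

text \<open>Here units are counted from 1: argument \<open>l\<close> means the unit with index
  \<open>l - 1\<close>, so amounts such as the target can be passed directly.\<close>

definition increment_exp :: "nexp \<Rightarrow> nexp \<Rightarrow> rexp" where
  "increment_exp e l = RSub (RQuery e l (var 10)) (RQuery e (NSub l (NConst 1)) (var 10))"

definition slack_exp :: "nexp \<Rightarrow> bexp" where
  "slack_exp v = NLess (NRead 8 v) (cap_exp v)"

definition bor :: "bexp \<Rightarrow> bexp \<Rightarrow> bexp" where
  "bor a b = BNot (BAnd (BNot a) (BNot b))"

definition eq_exp :: "nexp \<Rightarrow> nexp \<Rightarrow> bexp" where
  "eq_exp a b = BAnd (BNot (NLess a b)) (BNot (NLess b a))"

definition half_exp :: "nat \<Rightarrow> nexp" where
  "half_exp x = NDiv (var x) (NConst 2)"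

definition probe_exp :: nexp where
  "probe_exp = NAdd (NRead 6 (var 16)) (half_exp 17)"

text \<open>Decides \<open>pr\<close> for the last unit of the probed amount. The tie branch tests
  only that this unit is not worth less than the target, which amounts to equality once the first
  alternative has failed.\<close>

definition precedes_exp :: bexp where
  "precedes_exp =
     BAnd (BAnd (slack_exp (NRead 1 (var 16))) (slack_exp (NRead 2 (var 16))))
       (bor (RLess (increment_exp (var 13) (var 15)) (increment_exp (var 16) probe_exp))
         (BAnd (BNot (RLess (increment_exp (var 16) probe_exp) (increment_exp (var 13) (var 15))))
           (bor (NLess (var 16) (var 13))
             (BAnd (eq_exp (var 16) (var 13)) (BNot (NLess (var 15) probe_exp))))))"

text \<open>Bisection for \<open>closing_at\<close>. The initial width, capacity plus 2, ensures
  that a search in which every probe succeeds ends above the capacity and thus exposes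
  infeasibility.\<close>

definition close_edge_prog :: com where
  "close_edge_prog =
     Seq (NWrite 6 (var 16) (NRead 5 (var 16)))
    (Seq (set_var 17 (NAdd (cap_exp (NRead 1 (var 16))) (NConst 2)))
         (Loop (NLess (NConst 1) (var 17))
           (Seq (Cond precedes_exp (NWrite 6 (var 16) probe_exp) Skip)
                (set_var 17 (NSub (var 17) (half_exp 17))))))"

definition close_prog :: com where
  "close_prog = for_loop 16 (NRead 0 (NConst 1)) close_edge_prog"

definition load_vertex_prog :: com where
  "load_vertex_prog =
     Seq (set_var 20 (NConst 0))
    (Seq (for_loop 19 (NRead 0 (NConst 1))
           (Cond (bor (eq_exp (NRead 1 (var 19)) (var 18)) (eq_exp (NRead 2 (var 19)) (var 18)))
             (set_var 20 (NAdd (var 20) (NRead 6 (var 19)))) Skip))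
    (Seq (NWrite 9 (var 18) (var 20))
         (Cond (NLess (cap_exp (var 18)) (var 20)) (set_var 21 (NConst 0)) Skip)))"

definition load_prog :: com where
  "load_prog = Seq (set_var 21 (NConst 1)) (for_loop 18 (NRead 0 (NConst 0)) load_vertex_prog)"

text \<open>One loop over \<open>n + m\<close> cells serves both the array indexed by edges and the
  one indexed by vertices; surplus cells are copied harmlessly.\<close>

definition accept_prog :: com where
  "accept_prog = Cond (NLess (NConst 0) (var 21))
     (for_loop 22 (NAdd (NRead 0 (NConst 0)) (NRead 0 (NConst 1)))
       (Seq (NWrite 5 (var 22) (NRead 6 (var 22))) (NWrite 8 (var 22) (NRead 9 (var 22)))))
     Skip"

text \<open>The initial width is the capacity of an endpoint plus 1, an amount that no feasible
  allocation can add.\<close>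

definition search_prog :: com where
  "search_prog =
     Seq (set_var 14 (NAdd (cap_exp (NRead 1 (var 13))) (NConst 1)))
         (Loop (NLess (NConst 1) (var 14))
           (Seq (set_var 15 (NAdd (NRead 5 (var 13)) (half_exp 14)))
           (Seq close_prog
           (Seq load_prog
           (Seq accept_prog
                (set_var 14 (NSub (var 14) (half_exp 14))))))))"

definition power_prog :: "nat \<Rightarrow> nexp \<Rightarrow> com" where
  "power_prog x a = Seq (set_var x (NConst 1)) (for_loop 22 a (set_var x (NAdd (var x) (var x))))"

text \<open>The bits of the grid beyond the output precision: \<open>2 ^ (m * m + 3)\<close> is at
  least \<open>6 * (m + 1) ^ m\<close>, twice the stability factor for tolerances of one
  unit.\<close>

definition slope_bits_exp :: nexp where
  "slope_bits_exp = NAdd (NMul (NRead 0 (NConst 1)) (NRead 0 (NConst 1))) (NConst 3)"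

definition round_prog :: com where
  "round_prog = for_loop 22 (NRead 0 (NConst 1))
     (NWrite 5 (var 22) (NDiv (NAdd (NRead 5 (var 22)) (half_exp 11)) (var 11)))"

definition equilibrium_prog :: com where
  "equilibrium_prog =
     Seq (power_prog 10 (NAdd (NRead 0 (NConst 2)) slope_bits_exp))
    (Seq (power_prog 11 slope_bits_exp)
    (Seq (for_loop 12 (NRead 0 (NConst 1)) (for_loop 13 (NRead 0 (NConst 1)) search_prog))
         round_prog))"

record greedy_state =
  alloc :: "nat \<Rightarrow> nat"
  cand :: "nat \<Rightarrow> nat"
  alloc_load :: "nat \<Rightarrow> nat"
  cand_load :: "nat \<Rightarrow> nat"
  grid :: nat
  coarse :: nat
  round_var :: nat
  edge_var :: nat
  width_var :: nat
  target_var :: nat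
  close_var :: nat
  gap_var :: nat
  vertex_var :: nat
  load_var :: nat
  sum_var :: nat
  ok_var :: nat
  copy_var :: nat

definition cell :: "nat \<Rightarrow> nat \<Rightarrow> nat" where
  "cell a = (\<lambda>_. 0)(0 := a)"

lemma cell_simps [simp]: "cell a 0 = a" "(cell a)(0 := b) = cell b"
  by (auto simp: cell_def)

definition mem_of :: "nmem \<Rightarrow> greedy_state \<Rightarrow> nmem" where
  "mem_of N0 \<sigma> = N0
     (5 := alloc \<sigma>, 6 := cand \<sigma>, 8 := alloc_load \<sigma>, 9 := cand_load \<sigma>,
      10 := cell (grid \<sigma>), 11 := cell (coarse \<sigma>), 12 := cell (round_var \<sigma>),
      13 := cell (edge_var \<sigma>), 14 := cell (width_var \<sigma>), 15 := cell (target_var \<sigma>),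
      16 := cell (close_var \<sigma>), 17 := cell (gap_var \<sigma>), 18 := cell (vertex_var \<sigma>),
      19 := cell (load_var \<sigma>), 20 := cell (sum_var \<sigma>), 21 := cell (ok_var \<sigma>),
      22 := cell (copy_var \<sigma>))"

lemma mem_of_read [simp]:
  "mem_of N0 \<sigma> 0 = N0 0" "mem_of N0 \<sigma> (Suc 0) = N0 (Suc 0)" "mem_of N0 \<sigma> 2 = N0 2"
  "mem_of N0 \<sigma> 3 = N0 3" "mem_of N0 \<sigma> 4 = N0 4"
  "mem_of N0 \<sigma> 5 = alloc \<sigma>" "mem_of N0 \<sigma> 6 = cand \<sigma>"
  "mem_of N0 \<sigma> 8 = alloc_load \<sigma>" "mem_of N0 \<sigma> 9 = cand_load \<sigma>"
  "mem_of N0 \<sigma> 10 = cell (grid \<sigma>)" "mem_of N0 \<sigma> 11 = cell (coarse \<sigma>)"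
  "mem_of N0 \<sigma> 12 = cell (round_var \<sigma>)" "mem_of N0 \<sigma> 13 = cell (edge_var \<sigma>)"
  "mem_of N0 \<sigma> 14 = cell (width_var \<sigma>)" "mem_of N0 \<sigma> 15 = cell (target_var \<sigma>)"
  "mem_of N0 \<sigma> 16 = cell (close_var \<sigma>)" "mem_of N0 \<sigma> 17 = cell (gap_var \<sigma>)"
  "mem_of N0 \<sigma> 18 = cell (vertex_var \<sigma>)" "mem_of N0 \<sigma> 19 = cell (load_var \<sigma>)"
  "mem_of N0 \<sigma> 20 = cell (sum_var \<sigma>)" "mem_of N0 \<sigma> 21 = cell (ok_var \<sigma>)"
  "mem_of N0 \<sigma> 22 = cell (copy_var \<sigma>)"
  by (auto simp: mem_of_def)

lemma mem_of_upd:
  "(mem_of N0 \<sigma>)(5 := (mem_of N0 \<sigma> 5)(p := v)) = mem_of N0 (\<sigma>\<lparr>alloc := (alloc \<sigma>)(p := v)\<rparr>)"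
  "(mem_of N0 \<sigma>)(6 := (mem_of N0 \<sigma> 6)(p := v)) = mem_of N0 (\<sigma>\<lparr>cand := (cand \<sigma>)(p := v)\<rparr>)"
  "(mem_of N0 \<sigma>)(8 := (mem_of N0 \<sigma> 8)(p := v)) = mem_of N0 (\<sigma>\<lparr>alloc_load := (alloc_load \<sigma>)(p := v)\<rparr>)"
  "(mem_of N0 \<sigma>)(9 := (mem_of N0 \<sigma> 9)(p := v)) = mem_of N0 (\<sigma>\<lparr>cand_load := (cand_load \<sigma>)(p := v)\<rparr>)"
  "(mem_of N0 \<sigma>)(10 := (mem_of N0 \<sigma> 10)(0 := v)) = mem_of N0 (\<sigma>\<lparr>grid := v\<rparr>)"
  "(mem_of N0 \<sigma>)(11 := (mem_of N0 \<sigma> 11)(0 := v)) = mem_of N0 (\<sigma>\<lparr>coarse := v\<rparr>)"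
  "(mem_of N0 \<sigma>)(12 := (mem_of N0 \<sigma> 12)(0 := v)) = mem_of N0 (\<sigma>\<lparr>round_var := v\<rparr>)"
  "(mem_of N0 \<sigma>)(13 := (mem_of N0 \<sigma> 13)(0 := v)) = mem_of N0 (\<sigma>\<lparr>edge_var := v\<rparr>)"
  "(mem_of N0 \<sigma>)(14 := (mem_of N0 \<sigma> 14)(0 := v)) = mem_of N0 (\<sigma>\<lparr>width_var := v\<rparr>)"
  "(mem_of N0 \<sigma>)(15 := (mem_of N0 \<sigma> 15)(0 := v)) = mem_of N0 (\<sigma>\<lparr>target_var := v\<rparr>)"
  "(mem_of N0 \<sigma>)(16 := (mem_of N0 \<sigma> 16)(0 := v)) = mem_of N0 (\<sigma>\<lparr>close_var := v\<rparr>)"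
  "(mem_of N0 \<sigma>)(17 := (mem_of N0 \<sigma> 17)(0 := v)) = mem_of N0 (\<sigma>\<lparr>gap_var := v\<rparr>)"
  "(mem_of N0 \<sigma>)(18 := (mem_of N0 \<sigma> 18)(0 := v)) = mem_of N0 (\<sigma>\<lparr>vertex_var := v\<rparr>)"
  "(mem_of N0 \<sigma>)(19 := (mem_of N0 \<sigma> 19)(0 := v)) = mem_of N0 (\<sigma>\<lparr>load_var := v\<rparr>)"
  "(mem_of N0 \<sigma>)(20 := (mem_of N0 \<sigma> 20)(0 := v)) = mem_of N0 (\<sigma>\<lparr>sum_var := v\<rparr>)"
  "(mem_of N0 \<sigma>)(21 := (mem_of N0 \<sigma> 21)(0 := v)) = mem_of N0 (\<sigma>\<lparr>ok_var := v\<rparr>)"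
  "(mem_of N0 \<sigma>)(22 := (mem_of N0 \<sigma> 22)(0 := v)) = mem_of N0 (\<sigma>\<lparr>copy_var := v\<rparr>)"
  by (auto simp: mem_of_def fun_eq_iff)

section \<open>Correctness and running time of the program on an encoded game\<close>

locale encoded_game =
  fixes n :: nat and es bs :: "(nat \<times> nat) list" and h :: "nat set \<Rightarrow> real \<Rightarrow> real" and k :: nat
  assumes valid: "valid_input n es bs"
    and rewards: "\<forall>e\<in>edges_of es. concave_reward (h e)"
begin

definition m :: nat where "m = length es"
definition ed :: "nat \<Rightarrow> nat set" where "ed i = endpoints (es ! i)"
definition z :: nat where "z = input_size n es bs k"
definition L :: nat where "L = (z + 3) * (z + 3)"
definition D :: nat where "D = 2 ^ (k + (m * m + 3))"
definition cap :: "nat \<Rightarrow> nat" where "cap v = fst (bs ! v) * D div snd (bs ! v)"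
definition incr :: "nat \<Rightarrow> nat \<Rightarrow> real" where
  "incr e l = h (ed e) (real (l + 1) / D) - h (ed e) (real l / D)"
definition N0 :: nmem where "N0 = input_mem n es bs k"

lemma D_pos: "0 < D"
  by (simp add: D_def)

lemma graph: "simple_graph {..<n} (edges_of es)"
  using valid by (simp add: valid_input_def)

lemma bij_ed: "bij_betw ed {..<m} (edges_of es)"
proof -
  have "distinct (map endpoints es)" using valid by (simp add: valid_input_def)
  then have "bij_betw ((!) (map endpoints es)) {..<m} (set (map endpoints es))"
    by (intro bij_betw_nth) (auto simp: m_def)
  moreover have "bij_betw ((!) (map endpoints es)) {..<m} (set (map endpoints es))
      \<longleftrightarrow> bij_betw ed {..<m} (set (map endpoints es))"
    by (intro bij_betw_cong) (simp add: ed_def m_def)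
  ultimately show ?thesis by (simp add: edges_of_def)
qed

lemma card_edges: "card (edges_of es) = m"
  using bij_betw_same_card[OF bij_ed] by simp

lemma budget_nonneg: "\<forall>v\<in>{..<n}. 0 \<le> budget_of bs v"
  by (simp add: budget_of_def)

lemma concave_h: "\<forall>e\<in>edges_of es. concave_on {0..} (h e)"
  and continuous_h: "\<forall>e\<in>edges_of es. continuous_on {0..} (h e)"
  and mono_h: "\<forall>e\<in>edges_of es. mono_on {0..} (h e)"
  using rewards by (auto simp: concave_reward_def)

lemma cap_floor: "v \<in> {..<n} \<Longrightarrow> cap v = nat \<lfloor>budget_of bs v * D\<rfloor>"
  unfolding cap_def budget_of_def
  by (metis floor_divide_of_nat_eq nat_int of_nat_mult times_divide_eq_left)

sublocale unit_greedy "{..<n}" m ed cap incr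
  by (rule greedy_approx_blocked(1)[OF graph bij_ed concave_h budget_nonneg D_pos cap_floor incr_def])

lemma ed_eq: "i < m \<Longrightarrow> ed i = {fst (es ! i), snd (es ! i)}"
  by (simp add: ed_def endpoints_def)

lemma endpoints_lt: "i < m \<Longrightarrow> fst (es ! i) < n" "i < m \<Longrightarrow> snd (es ! i) < n"
  using ed_V[of i] ed_eq[of i] by auto

lemma N0_simps [simp]:
  "N0 0 0 = n" "N0 0 (Suc 0) = m" "N0 0 2 = k"
  "i < m \<Longrightarrow> N0 (Suc 0) i = fst (es ! i)" "i < m \<Longrightarrow> N0 2 i = snd (es ! i)"
  "v < n \<Longrightarrow> N0 3 v = fst (bs ! v)" "v < n \<Longrightarrow> N0 4 v = snd (bs ! v)"
  using valid by (auto simp: N0_def input_mem_def nth_default_def m_def valid_input_def)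

lemma sizes: "n \<le> z" "m \<le> z" "k \<le> z" "n + m + k \<le> z"
  "v < n \<Longrightarrow> fst (bs ! v) < 2 ^ z" "v < n \<Longrightarrow> snd (bs ! v) < 2 ^ z"
proof -
  show "n \<le> z" "m \<le> z" "k \<le> z" "n + m + k \<le> z" by (auto simp: z_def input_size_def m_def)
  assume "v < n"
  then have v: "bs ! v \<in> set bs" using valid by (simp add: valid_input_def)
  have "(\<lambda>(a, b). binlen a + binlen b) (bs ! v) \<le> (\<Sum>(a, b)\<leftarrow>bs. binlen a + binlen b)"
    using v by (intro member_le_sum_list) auto
  then have "binlen (fst (bs ! v)) + binlen (snd (bs ! v)) \<le> z"
    by (simp add: z_def input_size_def case_prod_beta)
  then have "binlen (fst (bs ! v)) \<le> z" "binlen (snd (bs ! v)) \<le> z" by auto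
  then show "fst (bs ! v) < 2 ^ z" "snd (bs ! v) < 2 ^ z" by (simp_all add: floorlog_le_iff)
qed

lemma bits_le: "k + (m * m + 3) + z + m + 2 \<le> L"
proof -
  have "m * m \<le> z * z" using sizes by (intro mult_mono) auto
  moreover have "k + m \<le> z" using sizes by simp
  ultimately show ?thesis by (simp add: L_def algebra_simps)
qed

text \<open>Candidates need not be feasible: a bisection may end near twice the capacity. The factor
  \<open>2 ^ m\<close> leaves room for adding up such amounts over all edges at a vertex, which
  \<open>bounded_load\<close> exploits through \<open>m < 2 ^ m\<close>.\<close>

lemma cap_less: "v < n \<Longrightarrow> (2 * cap v + 2) * 2 ^ m < 2 ^ L"
proof -
  assume v: "v < n"
  have "cap v \<le> fst (bs ! v) * D" by (simp add: cap_def)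
  also have "\<dots> < 2 ^ z * D" using sizes(5)[OF v] D_pos by simp
  finally have "2 * (cap v + 1) \<le> 2 * (2 ^ z * D)" by (intro mult_left_mono) auto
  then have "(2 * cap v + 2) * 2 ^ m \<le> 2 * (2 ^ z * D) * 2 ^ m" by (intro mult_right_mono) auto
  also have "\<dots> = 2 ^ (1 + z + (k + (m * m + 3)) + m)" by (simp add: D_def power_add)
  also have "\<dots> < (2::nat) ^ L" using bits_le by (intro power_strict_increasing) auto
  finally show ?thesis .
qed

lemma cap_less': "v < n \<Longrightarrow> 2 * cap v + 2 < 2 ^ L"
  using cap_less[of v] mult_le_mono2[of 1 "2 ^ m" "2 * cap v + 2"] by simp

lemma small_less: "w \<le> k + (m * m + 3) + z + m \<Longrightarrow> w < 2 ^ L"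
  using bits_le less_exp[of L] by linarith

lemma N0_bounded: "N0 x i < 2 ^ L"
proof -
  have "2 ^ z \<le> (2::nat) ^ L" using bits_le by (intro power_increasing) auto
  moreover have "i < length es \<Longrightarrow> fst (es ! i) < 2 ^ L \<and> snd (es ! i) < 2 ^ L"
    using endpoints_lt[of i] small_less[of n] sizes by (auto simp: m_def)
  moreover have "i < length bs \<Longrightarrow> fst (bs ! i) < 2 ^ z \<and> snd (bs ! i) < 2 ^ z"
    using sizes(5,6) valid by (auto simp: valid_input_def)
  moreover have "i < 3 \<Longrightarrow> [n, length es, k] ! i < 2 ^ L"
    using small_less sizes by (auto simp: m_def less_Suc_eq numeral_3_eq_3)
  ultimately show ?thesis
    by (auto simp: N0_def input_mem_def nth_default_def intro: less_le_trans)
qed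

abbreviation orc :: oracle_fun where "orc \<equiv> reward_oracle es h"
abbreviation mk :: "greedy_state \<Rightarrow> nmem" where "mk \<equiv> mem_of N0"

text \<open>500 generously bounds the size of every expression in the program, the largest being
  \<open>precedes_exp\<close>.\<close>

sublocale cost_logic orc mk L 500
  by standard (simp add: L_def)

lemmas runs_set = mem_of_upd(5-)[THEN runs_set_var]
lemmas runs_arr = mem_of_upd(1-4)[THEN runs_NWrite]
lemmas exp_defs = cap_exp_def increment_exp_def slack_exp_def bor_def eq_exp_def half_exp_def
  probe_exp_def precedes_exp_def slope_bits_exp_def

lemma nval_cap [simp]: "nval (mk \<sigma>) v < n \<Longrightarrow> grid \<sigma> = D \<Longrightarrow>
  nval (mk \<sigma>) (cap_exp v) = cap (nval (mk \<sigma>) v)"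
  by (simp add: cap_exp_def cap_def)

lemma rval_increment:
  "nval (mk \<sigma>) e < m \<Longrightarrow> nval (mk \<sigma>) l = Suc l' \<Longrightarrow>
    grid \<sigma> = D \<Longrightarrow>
   rval orc (mk \<sigma>) R (increment_exp e l) = incr (nval (mk \<sigma>) e) l'"
  by (simp add: increment_exp_def incr_def reward_oracle_def m_def ed_def)

definition good :: "greedy_state \<Rightarrow> bool" where
  "good \<sigma> \<longleftrightarrow> grid \<sigma> = D \<and> coarse \<sigma> = 2 ^ (m * m + 3) \<and>
     (\<forall>v<n. alloc_load \<sigma> v = load (alloc \<sigma>) v)"

lemma act_iff:
  "f < m \<Longrightarrow> f \<in> act x \<longleftrightarrow>
    load x (fst (es ! f)) < cap (fst (es ! f)) \<and> load x (snd (es ! f)) < cap (snd (es ! f))"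
  by (simp add: act_def ed_eq)

lemma bval_precedes:
  assumes "good \<sigma>" "close_var \<sigma> = f" "f < m" "edge_var \<sigma> = e" "e < m"
    and "target_var \<sigma> = j" "0 < j" "cand \<sigma> f + gap_var \<sigma> div 2 = Suc l"
  shows "bval orc (mk \<sigma>) R precedes_exp \<longleftrightarrow> pr (alloc \<sigma>) e j f l"
proof -
  have j: "j = Suc (j - 1)" using assms by simp
  have a: "rval orc (mk \<sigma>) R (increment_exp (var 13) (var 15)) = incr e (j - 1)"
    using assms j by (subst rval_increment[where l' = "j - 1"]) (auto simp: good_def)
  have b: "rval orc (mk \<sigma>) R (increment_exp (var 16) probe_exp) = incr f l"
    using assms by (subst rval_increment[where l' = l]) (auto simp: good_def probe_exp_def half_exp_def)
  have c: "nval (mk \<sigma>) probe_exp = Suc l" using assms by (simp add: probe_exp_def half_exp_def)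
  show ?thesis
    using assms(1-7) endpoints_lt[OF assms(3)]
    by (auto simp: precedes_exp_def a b c bor_def eq_exp_def slack_exp_def pr_def act_iff good_def)
qed

definition close_edge_time :: nat where
  "close_edge_time = step + (step + loop_time L ((step + step) + step))"

lemma close_edge_runs:
  assumes g: "good \<sigma>" and f: "close_var \<sigma> = f" "f < m" and e: "edge_var \<sigma> = e" "e < m"
    and j: "target_var \<sigma> = j" "0 < j" and x: "feas (alloc \<sigma>)"
    and Q: "\<And>y g. \<lbrakk>closing_at (alloc \<sigma>) e j f y; y \<le> 2 * cap (fst (es ! f)) + 2\<rbrakk>
      \<Longrightarrow> Q (\<sigma>\<lparr>cand := (cand \<sigma>)(f := y), gap_var := g\<rparr>)"
  shows "runs close_edge_prog \<sigma> close_edge_time Q"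
proof -
  define a where "a = fst (es ! f)"
  define xs where "xs = alloc \<sigma>"
  have a: "a < n" "a \<in> ed f" using endpoints_lt[OF f(2)] ed_eq[OF f(2)] by (auto simp: a_def)
  have xa: "xs f \<le> cap a" using feas_le[OF x f(2) a(2)] by (simp add: xs_def)
  note cl = cap_less'[OF a(1)]
  define St where "St y q = \<sigma>\<lparr>cand := (cand \<sigma>)(f := y), gap_var := q\<rparr>" for y q
  \<comment> \<open>All units below \<open>y\<close> precede the target, and unit
    \<open>y + q - 1\<close> does not, unless it lies beyond the capacity; at \<open>q = 1\<close>
    this is \<open>closing_at\<close>.\<close>
  let ?I = "\<lambda>r \<sigma>'. \<exists>y q. \<sigma>' = St y q \<and> q \<le> 2 ^ r \<and> 1 \<le> q \<and> xs f \<le> y \<and>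
     y + q \<le> xs f + cap a + 2 \<and> (\<forall>l. xs f \<le> l \<and> l < y \<longrightarrow> pr xs e j f l) \<and>
     (\<not> pr xs e j f (y + q - 1) \<or> cap a + 1 < y + q)"
  have loop: "runs (Loop (NLess (NConst 1) (var 17))
           (Seq (Cond precedes_exp (NWrite 6 (var 16) probe_exp) Skip)
                (set_var 17 (NSub (var 17) (half_exp 17))))) (St (xs f) (cap a + 2))
        (loop_time L ((step + step) + step)) Q"
  proof (rule runs_Loop[where I = ?I])
    fix r \<sigma>' assume I: "?I r \<sigma>'" and b: "bval orc (mk \<sigma>') (\<lambda>_ _. 0) (NLess (NConst 1) (var 17))"
    then obtain y q where s: "\<sigma>' = St y q" and q: "q \<le> 2 ^ r" "2 \<le> q" and y: "xs f \<le> y"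
      "y + q \<le> xs f + cap a + 2" "\<forall>l. xs f \<le> l \<and> l < y \<longrightarrow> pr xs e j f l"
      "\<not> pr xs e j f (y + q - 1) \<or> cap a + 1 < y + q" by (auto simp: St_def)
    have r: "0 < r" using q by (cases r) auto
    \<comment> \<open>The width becomes \<open>q - d\<close>, half of \<open>q\<close> rounded up,
      in both branches; rounding up still stays below the next smaller power of two and never
      reaches 0.\<close>
    obtain d where d: "q div 2 = d" "1 \<le> d" "d < q" "d \<le> q - d" using q by force
    have qr: "q - d \<le> 2 ^ (r - 1)" using q r d(1) by (cases r) auto
    have qL: "q - d < 2 ^ L" using y(1,2) xa cl by linarith
    have bp: "bval orc (mk \<sigma>') R precedes_exp \<longleftrightarrow> pr xs e j f (y + d - 1)" for R
      using g f e j d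
      by (subst bval_precedes[where l = "y + d - 1"]) (auto simp: s St_def good_def xs_def)
    have "runs (Seq (Cond precedes_exp (NWrite 6 (var 16) probe_exp) Skip)
        (set_var 17 (NSub (var 17) (half_exp 17)))) \<sigma>' ((step + step) + step) (?I (r - 1))"
    proof (rule runs_Seq, rule runs_Cond)
      show "bsize precedes_exp \<le> 500" by (simp add: exp_defs)
      assume "bval orc (mk \<sigma>') (\<lambda>_ _. 0) precedes_exp"
      then have p: "pr xs e j f (y + d - 1)" using bp by simp
      show "runs (NWrite 6 (var 16) probe_exp) \<sigma>' step
         (\<lambda>\<sigma>'. runs (set_var 17 (NSub (var 17) (half_exp 17))) \<sigma>' step (?I (r - 1)))"
      proof (rule runs_arr(2)[where p = f], goal_cases)
        case 3
        then show ?case using y d xa cl f by (simp add: s St_def probe_exp_def half_exp_def)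
      next
        case 4
        show ?case
        proof (rule runs_set(8), goal_cases)
          case 3
          have new: "pr xs e j f l" if "xs f \<le> l" "l < y + d" for l
            using pr_antimono[OF p] that by auto
          have eq: "(nval (mk \<sigma>') probe_exp) = y + d" using f d(1)
            by (simp add: s St_def probe_exp_def half_exp_def)
          show ?case
          proof (rule exI[of _ "y + d"], rule exI[of _ "q - d"], intro conjI)
            show "\<forall>l. xs f \<le> l \<and> l < y + d \<longrightarrow> pr xs e j f l" using new by blast
            show "\<not> pr xs e j f (y + d + (q - d) - 1) \<or> cap a + 1 < y + d + (q - d)"
              using y(4) d(3) by simp
          qed (use y d qr f eq in \<open>auto simp: s St_def half_exp_def\<close>)
        next
          case 2
          show ?case by (simp add: s St_def half_exp_def d(1) qL)
        qed (simp add: half_exp_def)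
      qed (use f in \<open>auto simp: s St_def probe_exp_def half_exp_def\<close>)
    next
      assume "\<not> bval orc (mk \<sigma>') (\<lambda>_ _. 0) precedes_exp"
      then have p: "\<not> pr xs e j f (y + d - 1)" using bp by simp
      \<comment> \<open>The remaining width may exceed the failed probe by one; later units fail as
        well.\<close>
      have "y + d - 1 \<le> y + (q - d) - 1" using d(4) by (intro diff_le_mono add_left_mono)
      then have p': "\<not> pr xs e j f (y + (q - d) - 1)" using p pr_antimono by blast
      show "runs Skip \<sigma>' step
         (\<lambda>\<sigma>'. runs (set_var 17 (NSub (var 17) (half_exp 17))) \<sigma>' step (?I (r - 1)))"
      proof (rule runs_Skip, rule runs_set(8), goal_cases)
        case 3
        show ?case
          by (rule exI[of _ y], rule exI[of _ "q - d"]) (use y d qr p' in \<open>auto simp: s St_def half_exp_def\<close>)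
      next
        case 2
        show ?case by (simp add: s St_def half_exp_def d(1) qL)
      qed (simp add: half_exp_def)
    qed
    then show "0 < r \<and> runs (Seq (Cond precedes_exp (NWrite 6 (var 16) probe_exp) Skip)
        (set_var 17 (NSub (var 17) (half_exp 17)))) \<sigma>' ((step + step) + step) (?I (r - 1))"
      using r by simp
  next
    fix r \<sigma>' assume I: "?I r \<sigma>'" and b: "\<not> bval orc (mk \<sigma>') (\<lambda>_ _. 0) (NLess (NConst 1) (var 17))"
    then obtain y q where s: "\<sigma>' = St y q" and q: "q = 1" and y: "xs f \<le> y"
      "y + q \<le> xs f + cap a + 2" "\<forall>l. xs f \<le> l \<and> l < y \<longrightarrow> pr xs e j f l"
      "\<not> pr xs e j f (y + q - 1) \<or> cap a + 1 < y + q" by (auto simp: St_def)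
    have "closing_at xs e j f y" using y q a by (auto simp: closing_at_def)
    then show "Q \<sigma>'" using Q[of y q] y xa by (auto simp: s St_def xs_def a_def)
  next
    show "?I L (St (xs f) (cap a + 2))"
      by (rule exI[of _ "xs f"], rule exI[of _ "cap a + 2"]) (use cl in auto)
  qed simp
  show ?thesis
    unfolding close_edge_prog_def close_edge_time_def
  proof (rule runs_Seq, rule runs_arr(2)[where p = f], goal_cases)
    case 4
    show ?case
    proof (rule runs_Seq, rule runs_set(8), goal_cases)
      case 3
      have "nval (mk (\<sigma>\<lparr>cand := (cand \<sigma>)(f := nval (mk \<sigma>) (NRead 5 (var 16)))\<rparr>))
          (NAdd (cap_exp (NRead 1 (var 16))) (NConst 2)) = cap a + 2"
        using g f a by (simp add: good_def a_def)
      then show ?case using loop f by (simp add: St_def xs_def)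
    next
      case 2
      then show ?case using g f a cl by (simp add: good_def a_def)
    qed (simp add: cap_exp_def)
  qed (use f xa cl in \<open>auto simp: xs_def\<close>)
qed

definition close_time :: nat where
  "close_time = for_time z close_edge_time"

lemma close_runs:
  assumes g: "good \<sigma>" and e: "edge_var \<sigma> = e" "e < m"
    and j: "target_var \<sigma> = j" "0 < j" and x: "feas (alloc \<sigma>)"
    and Q: "\<And>y c g. \<lbrakk>closing (alloc \<sigma>) e j y; \<forall>f<m. y f \<le> 2 * cap (fst (es ! f)) + 2\<rbrakk>
      \<Longrightarrow> Q (\<sigma>\<lparr>cand := y, close_var := c, gap_var := g\<rparr>)"
  shows "runs close_prog \<sigma> close_time Q"
  unfolding close_prog_def close_time_def
proof (rule runs_for_loop[where upd = "\<lambda>v \<sigma>. \<sigma>\<lparr>close_var := v\<rparr>" and ctr = close_var and b = m and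
    I = "\<lambda>i \<sigma>'. \<exists>y c q. \<sigma>' = \<sigma>\<lparr>cand := y, close_var := c, gap_var := q\<rparr> \<and>
      (\<forall>f<i. closing_at (alloc \<sigma>) e j f (y f) \<and> y f \<le> 2 * cap (fst (es ! f)) + 2)", OF mem_of_upd(11)],
    goal_cases)
  case (7 i v \<sigma>')
  then obtain y c q where s: "\<sigma>' = \<sigma>\<lparr>cand := y, close_var := c, gap_var := q\<rparr>"
    "\<forall>f<i. closing_at (alloc \<sigma>) e j f (y f) \<and> y f \<le> 2 * cap (fst (es ! f)) + 2" by blast
  show ?case by (rule exI[of _ y], rule exI[of _ v], rule exI[of _ q]) (use s in simp)
next
  case 9
  show ?case by (rule exI[of _ "cand \<sigma>"], rule exI[of _ "close_var \<sigma>"], rule exI[of _ "gap_var \<sigma>"]) simp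
next
  case (10 i \<sigma>')
  then obtain y c q where s: "\<sigma>' = \<sigma>\<lparr>cand := y, close_var := c, gap_var := q\<rparr>" "c = i"
    "\<forall>f<i. closing_at (alloc \<sigma>) e j f (y f) \<and> y f \<le> 2 * cap (fst (es ! f)) + 2" by auto
  show ?case
  proof (rule close_edge_runs[where f = i and e = e and j = j], goal_cases)
    case (9 y' q')
    show ?case
    proof (intro conjI)
      show "\<exists>y c q. \<sigma>'\<lparr>cand := (cand \<sigma>')(i := y'), gap_var := q'\<rparr> =
          \<sigma>\<lparr>cand := y, close_var := c, gap_var := q\<rparr> \<and>
          (\<forall>f<Suc i. closing_at (alloc \<sigma>) e j f (y f) \<and> y f \<le> 2 * cap (fst (es ! f)) + 2)"
        by (rule exI[of _ "y(i := y')"], rule exI[of _ i], rule exI[of _ q'])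
          (use 9 s in \<open>auto simp: less_Suc_eq\<close>)
    qed (use s in simp)
  qed (use g e j x s 10 in \<open>auto simp: good_def\<close>)
next
  case (11 \<sigma>')
  then show ?case using Q by (auto simp: closing_def)
qed (use sizes small_less[of m] in \<open>auto simp: m_def\<close>)

lemma bounded_load:
  assumes "\<forall>f<m. y f \<le> 2 * cap (fst (es ! f)) + 2"
  shows "load y v < 2 ^ L"
proof -
  have "load y v * 2 ^ m = (\<Sum>f | f < m \<and> v \<in> ed f. y f * 2 ^ m)"
    by (simp add: load_def sum_distrib_right)
  also have "\<dots> \<le> (\<Sum>f | f < m \<and> v \<in> ed f. 2 ^ L)"
  proof (intro sum_mono)
    fix f assume "f \<in> {f. f < m \<and> v \<in> ed f}"
    then have f: "f < m" by simp
    have "y f * 2 ^ m \<le> (2 * cap (fst (es ! f)) + 2) * 2 ^ m" using assms f by (intro mult_right_mono) auto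
    then show "y f * 2 ^ m \<le> 2 ^ L" using cap_less[OF endpoints_lt(1)[OF f]] by linarith
  qed
  also have "\<dots> \<le> m * 2 ^ L"
    using card_mono[of "{..<m}" "{f. f < m \<and> v \<in> ed f}"] by (auto intro!: mult_right_mono)
  also have "\<dots> < 2 ^ m * 2 ^ L" by simp
  finally show ?thesis by (simp add: mult.commute)
qed

definition load_vertex_time :: nat where
  "load_vertex_time = step + (for_time z (step + step) + (step + (step + step)))"

lemma load_vertex_runs:
  assumes g: "good \<sigma>" and v: "vertex_var \<sigma> = v" "v < n"
    and y: "\<forall>f<m. cand \<sigma> f \<le> 2 * cap (fst (es ! f)) + 2"
    and Q: "\<And>l s. Q (\<sigma>\<lparr>cand_load := (cand_load \<sigma>)(v := load (cand \<sigma>) v), load_var := l, sum_var := s,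
      ok_var := (if cap v < load (cand \<sigma>) v then 0 else ok_var \<sigma>)\<rparr>)"
  shows "runs load_vertex_prog \<sigma> load_vertex_time Q"
proof -
  define P where "P i = (\<Sum>f | f < i \<and> v \<in> ed f. cand \<sigma> f)" for i
  have Pm: "P m = load (cand \<sigma>) v" by (simp add: P_def load_def)
  have PL: "P i < 2 ^ L" if "i \<le> m" for i
  proof -
    have "P i \<le> load (cand \<sigma>) v" unfolding P_def load_def using that by (intro sum_mono2) auto
    then show ?thesis using bounded_load[OF y, of v] by linarith
  qed
  have PS: "P (Suc i) = P i + (if v \<in> ed i then cand \<sigma> i else 0)" for i
  proof -
    have "{f. f < Suc i \<and> v \<in> ed f} = {f. f < i \<and> v \<in> ed f} \<union> (if v \<in> ed i then {i} else {})"
      by (auto simp: less_Suc_eq)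
    then show ?thesis by (simp add: P_def)
  qed
  define St where "St l s = \<sigma>\<lparr>load_var := l, sum_var := s\<rparr>" for l s
  have loop: "runs (for_loop 19 (NRead 0 (NConst 1))
           (Cond (bor (eq_exp (NRead 1 (var 19)) (var 18)) (eq_exp (NRead 2 (var 19)) (var 18)))
             (set_var 20 (NAdd (var 20) (NRead 6 (var 19)))) Skip)) (\<sigma>\<lparr>sum_var := 0\<rparr>) (for_time z (step + step))
      (\<lambda>\<sigma>'. \<exists>l. \<sigma>' = St l (P m))"
  proof (rule runs_for_loop[where upd = "\<lambda>v \<sigma>. \<sigma>\<lparr>load_var := v\<rparr>" and ctr = load_var and b = m and
      I = "\<lambda>i \<sigma>'. \<exists>l. \<sigma>' = St l (P i)", OF mem_of_upd(14)], goal_cases)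
    case (7 i v \<sigma>')
    then obtain l where "\<sigma>' = St l (P i)" by blast
    then show ?case by (intro exI[of _ v]) (simp add: St_def)
  next
    case 9
    then show ?case by (intro exI[of _ "load_var \<sigma>"]) (simp add: St_def P_def)
  next
    case (10 i \<sigma>')
    then obtain l where "\<sigma>' = St l (P i)" by blast
    moreover from this have "l = i" using 10(3) by (simp add: St_def)
    ultimately have s: "\<sigma>' = St i (P i)" by simp
    have i: "i < m" by (rule 10(1))
    have lv: "load_var \<sigma>' = i" "vertex_var \<sigma>' = v" using v(1) by (simp_all add: s St_def)
    have bv: "bval orc (mk \<sigma>') R (bor (eq_exp (NRead 1 (var 19)) (var 18))
        (eq_exp (NRead 2 (var 19)) (var 18))) \<longleftrightarrow> v \<in> ed i" for R
      unfolding ed_eq[OF i] bor_def eq_exp_def using i lv by auto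
    show ?case
    proof (rule runs_Cond, goal_cases)
      case 2
      then have vi: "v \<in> ed i" using bv by simp
      have P: "P (Suc i) = P i + cand \<sigma> i" using PS[of i] vi by simp
      moreover have "P (Suc i) < 2 ^ L" using PL[of "Suc i"] i by simp
      moreover have v: "nval (mk \<sigma>') (NAdd (var 20) (NRead 6 (var 19))) = P i + cand \<sigma> i"
        by (simp add: s St_def)
      ultimately have "nval (mk \<sigma>') (NAdd (var 20) (NRead 6 (var 19))) < 2 ^ L" by simp
      then show ?case
      proof (rule runs_set(11)[rotated])
        have "\<sigma>'\<lparr>sum_var := nval (mk \<sigma>') (NAdd (var 20) (NRead 6 (var 19)))\<rparr> = St i (P (Suc i))"
          unfolding v P by (simp add: s St_def)
        then show "load_var (\<sigma>'\<lparr>sum_var := nval (mk \<sigma>') (NAdd (var 20) (NRead 6 (var 19)))\<rparr>) = i \<and>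
            (\<exists>l. \<sigma>'\<lparr>sum_var := nval (mk \<sigma>') (NAdd (var 20) (NRead 6 (var 19)))\<rparr> = St l (P (Suc i)))"
          by (auto simp: St_def)
      qed simp
    next
      case 3
      then have vi: "v \<notin> ed i" using bv by simp
      then have "P (Suc i) = P i" using PS[of i] by simp
      then have "load_var \<sigma>' = i \<and> (\<exists>l. \<sigma>' = St l (P (Suc i)))" unfolding s
        by (auto simp: St_def)
      then show ?case by (rule runs_Skip)
    qed (simp add: exp_defs)
  qed (use sizes small_less[of m] in \<open>auto simp: St_def\<close>)
  show ?thesis
    unfolding load_vertex_prog_def load_vertex_time_def
  proof (rule runs_Seq, rule runs_set(11), goal_cases)
    case 3
    show ?case
    proof (rule runs_Seq, rule runs_conseq[OF _ order.refl])
      show "runs (for_loop 19 (NRead 0 (NConst 1))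
           (Cond (bor (eq_exp (NRead 1 (var 19)) (var 18)) (eq_exp (NRead 2 (var 19)) (var 18)))
             (set_var 20 (NAdd (var 20) (NRead 6 (var 19)))) Skip))
           (\<sigma>\<lparr>sum_var := nval (mk \<sigma>) (NConst 0)\<rparr>) (for_time z (step + step))
           (\<lambda>\<sigma>'. \<exists>l. \<sigma>' = St l (P m))" using loop by simp
      fix \<sigma>' assume "\<exists>l. \<sigma>' = St l (P m)"
      then obtain l where s: "\<sigma>' = St l (load (cand \<sigma>) v)" using Pm by auto
      show "runs (Seq (NWrite 9 (var 18) (var 20))
          (Cond (NLess (cap_exp (var 18)) (var 20)) (set_var 21 (NConst 0)) Skip)) \<sigma>'
          (step + (step + step)) Q"
      proof (rule runs_Seq, rule runs_arr(4)[where p = v], goal_cases)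
        case 4
        let ?\<tau> = "\<sigma>\<lparr>cand_load := (cand_load \<sigma>)(v := load (cand \<sigma>) v), load_var := l,
          sum_var := load (cand \<sigma>) v\<rparr>"
        have eq: "\<sigma>'\<lparr>cand_load := (cand_load \<sigma>')(v := nval (mk \<sigma>') (var 20))\<rparr> = ?\<tau>"
          by (simp add: s St_def)
        have cap: "nval (mk ?\<tau>) (cap_exp (var 18)) = cap v"
          using g v by (subst nval_cap) (auto simp: good_def)
        show ?case
          unfolding eq
        proof (rule runs_Cond, goal_cases)
          case 2
          then have "cap v < load (cand \<sigma>) v" using cap by simp
          then have "Q (?\<tau>\<lparr>ok_var := nval (mk ?\<tau>) (NConst 0)\<rparr>)"
            using Q[where l = l and s = "load (cand \<sigma>) v"] by simp
          then show ?case by (intro runs_set(12)) auto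
        next
          case 3
          then have "\<not> cap v < load (cand \<sigma>) v" using cap by simp
          moreover have "?\<tau>\<lparr>ok_var := ok_var \<sigma>\<rparr> = ?\<tau>" by simp
          ultimately have "Q ?\<tau>" using Q[where l = l and s = "load (cand \<sigma>) v"] by simp
          then show ?case by (rule runs_Skip)
        qed (simp add: cap_exp_def)
      next
        case 3
        then show ?case using PL[of m] Pm by (simp add: s St_def)
      qed (use v in \<open>auto simp: s St_def\<close>)
    qed
  qed auto
qed

definition load_time :: nat where
  "load_time = step + for_time z load_vertex_time"

lemma load_runs:
  assumes g: "good \<sigma>" and y: "\<forall>f<m. cand \<sigma> f \<le> 2 * cap (fst (es ! f)) + 2"
    and Q: "\<And>c v l s ok. \<lbrakk>\<forall>v<n. c v = load (cand \<sigma>) v; 0 < ok \<longleftrightarrow>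
      feas (cand \<sigma>)\<rbrakk> \<Longrightarrow>
      Q (\<sigma>\<lparr>cand_load := c, vertex_var := v, load_var := l, sum_var := s, ok_var := ok\<rparr>)"
  shows "runs load_prog \<sigma> load_time Q"
proof -
  define St where "St c v l s ok =
    \<sigma>\<lparr>cand_load := c, vertex_var := v, load_var := l, sum_var := s, ok_var := ok\<rparr>" for c v l s ok
  let ?I = "\<lambda>i \<sigma>'. \<exists>c v l s ok. \<sigma>' = St c v l s ok \<and> (\<forall>v<i. c v = load (cand \<sigma>) v) \<and>
     (0 < ok \<longleftrightarrow> (\<forall>v<i. load (cand \<sigma>) v \<le> cap v))"
  have "runs (for_loop 18 (NRead 0 (NConst 0)) load_vertex_prog) (\<sigma>\<lparr>ok_var := 1\<rparr>)
      (for_time z load_vertex_time) Q"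
  proof (rule runs_for_loop[where upd = "\<lambda>v \<sigma>. \<sigma>\<lparr>vertex_var := v\<rparr>" and ctr = vertex_var and b = n and
      I = ?I, OF mem_of_upd(13)], goal_cases)
    case (7 i v \<sigma>')
    then obtain c v' l s ok where s: "\<sigma>' = St c v' l s ok" "\<forall>v<i. c v = load (cand \<sigma>) v"
      "0 < ok \<longleftrightarrow> (\<forall>v<i. load (cand \<sigma>) v \<le> cap v)" by blast
    show ?case
      by (rule exI[of _ c], rule exI[of _ v], rule exI[of _ l], rule exI[of _ s], rule exI[of _ ok])
        (use s in \<open>simp add: St_def\<close>)
  next
    case 9
    show ?case
      by (rule exI[of _ "cand_load \<sigma>"], rule exI[of _ "vertex_var \<sigma>"], rule exI[of _ "load_var \<sigma>"],
          rule exI[of _ "sum_var \<sigma>"], rule exI[of _ 1]) (simp add: St_def)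
  next
    case (10 i \<sigma>')
    then obtain c v l s ok where "\<sigma>' = St c v l s ok" "\<forall>v<i. c v = load (cand \<sigma>) v"
      "0 < ok \<longleftrightarrow> (\<forall>v<i. load (cand \<sigma>) v \<le> cap v)" by blast
    moreover from this(1) have "v = i" using 10(3) by (simp add: St_def)
    ultimately have s: "\<sigma>' = St c i l s ok" "\<forall>v<i. c v = load (cand \<sigma>) v"
      "0 < ok \<longleftrightarrow> (\<forall>v<i. load (cand \<sigma>) v \<le> cap v)" by auto
    show ?case
    proof (rule load_vertex_runs[where v = i], goal_cases)
      case (5 l' s')
      let ?ok = "if cap i < load (cand \<sigma>) i then 0 else ok"
      show ?case
      proof (intro conjI)
        show "?I (Suc i) (\<sigma>'\<lparr>cand_load := (cand_load \<sigma>')(i := load (cand \<sigma>') i), load_var := l',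
            sum_var := s', ok_var := if cap i < load (cand \<sigma>') i then 0 else ok_var \<sigma>'\<rparr>)"
          by (rule exI[of _ "c(i := load (cand \<sigma>) i)"], rule exI[of _ i], rule exI[of _ l'],
              rule exI[of _ s'], rule exI[of _ ?ok])
            (use s in \<open>auto simp: St_def less_Suc_eq not_less\<close>)
      qed (simp add: s St_def)
    qed (use g y s 10 in \<open>auto simp: good_def St_def\<close>)
  next
    case (11 \<sigma>')
    then obtain c v l s ok where s: "\<sigma>' = St c v l s ok" "\<forall>v<n. c v = load (cand \<sigma>) v"
      "0 < ok \<longleftrightarrow> (\<forall>v<n. load (cand \<sigma>) v \<le> cap v)" by blast
    then show ?case using Q[where c = c and ok = ok and v = v and l = l and s = s] by (auto simp: St_def feas_def)
  qed (use sizes small_less[of n] in \<open>auto simp: St_def\<close>)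
  then show ?thesis
    unfolding load_prog_def load_time_def
    by (intro runs_Seq runs_set(12)) (use small_less[of 1] in auto)
qed

definition accept_time :: nat where
  "accept_time = step + for_time z (step + step)"

lemma accept_runs:
  assumes b: "\<forall>f<n + m. cand \<sigma> f < 2 ^ L \<and> cand_load \<sigma> f < 2 ^ L"
    and no: "ok_var \<sigma> = 0 \<Longrightarrow> Q \<sigma>"
    and yes: "\<And>x l c. \<lbrakk>0 < ok_var \<sigma>; \<forall>i<n + m. x i = cand \<sigma> i \<and> l i = cand_load \<sigma> i\<rbrakk> \<Longrightarrow>
      Q (\<sigma>\<lparr>alloc := x, alloc_load := l, copy_var := c\<rparr>)"
  shows "runs accept_prog \<sigma> accept_time Q"
  unfolding accept_prog_def accept_time_def
proof (rule runs_Cond, goal_cases)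
  case 2
  define St where "St x l c = \<sigma>\<lparr>alloc := x, alloc_load := l, copy_var := c\<rparr>" for x l c
  let ?I = "\<lambda>i \<sigma>'. \<exists>x l c. \<sigma>' = St x l c \<and> (\<forall>j<i. x j = cand \<sigma> j \<and> l j = cand_load \<sigma> j)"
  show ?case
  proof (rule runs_for_loop[where upd = "\<lambda>v \<sigma>. \<sigma>\<lparr>copy_var := v\<rparr>" and ctr = copy_var and b = "n + m" and
      I = ?I, OF mem_of_upd(17)], goal_cases)
    case (7 i v \<sigma>')
    then obtain x l c where s: "\<sigma>' = St x l c" "\<forall>j<i. x j = cand \<sigma> j \<and> l j = cand_load \<sigma> j" by blast
    show ?case by (rule exI[of _ x], rule exI[of _ l], rule exI[of _ v]) (use s in \<open>simp add: St_def\<close>)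
  next
    case 9
    show ?case by (rule exI[of _ "alloc \<sigma>"], rule exI[of _ "alloc_load \<sigma>"], rule exI[of _ "copy_var \<sigma>"])
        (simp add: St_def)
  next
    case (10 i \<sigma>')
    then obtain x l where s: "\<sigma>' = St x l i" "\<forall>j<i. x j = cand \<sigma> j \<and> l j = cand_load \<sigma> j"
      by (auto simp: St_def)
    show ?case
    proof (rule runs_Seq, rule runs_arr(1)[where p = i], goal_cases)
      case 4
      show ?case
      proof (rule runs_arr(3)[where p = i], goal_cases)
        case 4
        show ?case
        proof (rule conjI, goal_cases)
          case 2
          show ?case
            by (rule exI[of _ "x(i := cand \<sigma> i)"], rule exI[of _ "l(i := cand_load \<sigma> i)"], rule exI[of _ i])
              (use s in \<open>auto simp: St_def less_Suc_eq\<close>)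
        qed (simp add: s St_def)
      qed (use b 10 s in \<open>auto simp: St_def\<close>)
    qed (use b 10 s in \<open>auto simp: St_def\<close>)
  next
    case (11 \<sigma>')
    then obtain x l c where "\<sigma>' = St x l c" "\<forall>j<n+m. x j = cand \<sigma> j \<and> l j = cand_load \<sigma> j" by blast
    then show ?case using yes[of x l c] 2 by (simp add: St_def)
  qed (use sizes small_less[of "n + m"] in \<open>auto simp: St_def\<close>)
next
  case 3
  then have "runs Skip \<sigma> step Q" using no by (intro runs_Skip) simp
  then show ?case by (rule runs_conseq) (simp_all add: for_time_def loop_time_def)
qed simp

definition search_time :: nat where
  "search_time = step + loop_time L (step + (close_time + (load_time + (accept_time + step))))"

text \<open>Gives access to the bound on all cells within a triple. The copy loop needs it, as it
  also touches cells beyond the edges or vertices, of which nothing else is known.\<close>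

lemma runs_bounded_pre: "(bounded_mem L (mk \<sigma>) \<Longrightarrow> runs c \<sigma> T Q) \<Longrightarrow>
  runs c \<sigma> T Q"
  unfolding runs_def by blast

lemma search_runs:
  assumes g: "good \<sigma>" and e: "edge_var \<sigma> = e" "e < m" and r: "round_var \<sigma> = r"
    and inv: "round_inv A e (alloc \<sigma>)"
  shows "runs search_prog \<sigma> search_time (\<lambda>\<sigma>'. good \<sigma>' \<and> edge_var \<sigma>' = e \<and> round_var \<sigma>' = r \<and>
    round_inv A (Suc e) (alloc \<sigma>'))"
    (is "runs _ _ _ ?Q")
proof -
  define a where "a = fst (es ! e)"
  have a: "a < n" "a \<in> ed e" using endpoints_lt[OF e(2)] ed_eq[OF e(2)] by (auto simp: a_def)
  note cl = cap_less'[OF a(1)]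
  let ?body = "Seq (set_var 15 (NAdd (NRead 5 (var 13)) (half_exp 14)))
    (Seq close_prog (Seq load_prog (Seq accept_prog (set_var 14 (NSub (var 14) (half_exp 14))))))"
  let ?I = "\<lambda>q \<sigma>'. good \<sigma>' \<and> edge_var \<sigma>' = e \<and> round_var \<sigma>' = r \<and>
    search_inv A e (width_var \<sigma>') (alloc \<sigma>') \<and> 1 \<le> width_var \<sigma>' \<and> width_var \<sigma>' \<le> 2 ^ q \<and>
    width_var \<sigma>' \<le> cap a + 1"
  have body: "runs ?body \<sigma>' (step + (close_time + (load_time + (accept_time + step)))) (?I (q - 1))"
    if I: "?I q \<sigma>'" and w: "2 \<le> width_var \<sigma>'" and q: "0 < q" for q \<sigma>'
  proof -
    define w where "w = width_var \<sigma>'"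
    define x where "x = alloc \<sigma>'"
    obtain d where d: "w div 2 = d" "1 \<le> d" "d < w" "d \<le> w - d"
      using \<open>2 \<le> width_var \<sigma>'\<close>
      by (force simp: w_def)
    have "w \<le> 2 ^ q" using I by (simp add: w_def)
    then have wq: "w - d \<le> 2 ^ (q - 1)" using q d(1) by (cases q) auto
    have wc: "w \<le> cap a + 1" using I by (simp add: w_def)
    have g': "good \<sigma>'" and s: "search_inv A e w x" using I by (auto simp: w_def x_def)
    have fx: "feas x" using s by (simp add: search_inv_def round_inv_def greedy_inv_def)
    have xe: "x e \<le> cap a" using feas_le[OF fx e(2) a(2)] .
    have tL: "x e + d < 2 ^ L" "w - d < 2 ^ L" using xe wc d(3) cl by linarith+
    have fin: "runs (set_var 14 (NSub (var 14) (half_exp 14))) \<tau> step (?I (q - 1))"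
      if "good \<tau>" "edge_var \<tau> = e" "round_var \<tau> = r" "width_var \<tau> = w"
        "search_inv A e (w - d) (alloc \<tau>)" for \<tau>
    proof (rule runs_set(5), goal_cases)
      case 2
      then show ?case using that tL d by (simp add: half_exp_def)
    next
      case 3
      then show ?case using that d wq wc by (auto simp: half_exp_def good_def)
    qed (simp add: half_exp_def)
    show ?thesis
    proof (rule runs_Seq, rule runs_set(6), goal_cases)
      case 2
      then show ?case using I d(1) tL by (simp add: half_exp_def x_def w_def)
    next
      case 3
      define \<tau> where "\<tau> = \<sigma>'\<lparr>target_var := x e + d\<rparr>"
      have "runs (Seq close_prog (Seq load_prog (Seq accept_prog (set_var 14 (NSub (var 14) (half_exp 14))))))
        \<tau> (close_time + (load_time + (accept_time + step))) (?I (q - 1))"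
      proof (rule runs_Seq, rule close_runs[where e = e and j = "x e + d"], goal_cases)
        case (7 y c q')
        then have y: "closing x e (x e + d) y" "\<forall>f<m. y f \<le> 2 * cap (fst (es ! f)) + 2"
          by (auto simp: \<tau>_def x_def)
        show ?case
        proof (rule runs_Seq, rule load_runs, goal_cases)
          case (3 ly v l su ok)
          define \<rho> where "\<rho> = \<tau>\<lparr>cand := y, close_var := c, gap_var := q', cand_load := ly,
            vertex_var := v, load_var := l, sum_var := su, ok_var := ok\<rparr>"
          have ly: "\<forall>v<n. ly v = load y v" "0 < ok \<longleftrightarrow> feas y" using 3 by auto
          have sr: "alloc \<rho> = x" "good \<rho>" "edge_var \<rho> = e" "round_var \<rho> = r" "width_var \<rho> = w"
            using I by (auto simp: \<rho>_def \<tau>_def x_def w_def good_def)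
          have "runs (Seq accept_prog (set_var 14 (NSub (var 14) (half_exp 14)))) \<rho> (accept_time + step) (?I (q - 1))"
          proof (rule runs_bounded_pre, rule runs_Seq, rule accept_runs)
            assume "bounded_mem L (mk \<rho>)"
            then have "mk \<rho> 6 i < 2 ^ L \<and> mk \<rho> 9 i < 2 ^ L" for i
              unfolding bounded_mem_def by blast
            then show "\<forall>f<n + m. cand \<rho> f < 2 ^ L \<and> cand_load \<rho> f < 2 ^ L" by simp
          next
            assume "ok_var \<rho> = 0"
            then have "\<not> feas y" using ly by (simp add: \<rho>_def)
            then show "runs (set_var 14 (NSub (var 14) (half_exp 14))) \<rho> step (?I (q - 1))"
              using search_inv_reject[OF s y(1) _ e(2) d(4)] sr by (intro fin) auto
          next
            fix x' l' c' assume ok: "0 < ok_var \<rho>"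
              and x': "\<forall>i<n + m. x' i = cand \<rho> i \<and> l' i = cand_load \<rho> i"
            \<comment> \<open>The copy agrees with the candidate only on the copied cells, but
              \<open>load\<close> and \<open>closing\<close> look at no edge from \<open>m\<close>
              on.\<close>
            have eq: "x' f = y f" if "f < m" for f using x' that by (simp add: \<rho>_def)
            have ld: "load x' v = load y v" for v using eq by (intro load_cong)
            have "feas x'" using ok ly ld by (simp add: \<rho>_def feas_def)
            moreover have "closing x e (x e + d) x'" using y(1) eq by (simp add: closing_def)
            ultimately have si: "search_inv A e (w - d) x'"
              using search_inv_accept[OF s] d by simp
            have "l' v = load x' v" if "v < n" for v using x' ly ld that by (simp add: \<rho>_def)
            then show "runs (set_var 14 (NSub (var 14) (half_exp 14)))
                (\<rho>\<lparr>alloc := x', alloc_load := l', copy_var := c'\<rparr>) step (?I (q - 1))"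
              using sr si by (intro fin) (auto simp: good_def)
          qed
          then show ?case by (simp add: \<rho>_def)
        qed (use g' y in \<open>auto simp: \<tau>_def good_def\<close>)
      qed (use g' e I d fx in \<open>auto simp: \<tau>_def good_def x_def\<close>)
      moreover have "nval (mk \<sigma>') (NAdd (NRead 5 (var 13)) (half_exp 14)) = x e + d"
        using I d(1) by (simp add: half_exp_def x_def w_def)
      ultimately show ?case by (simp only: \<tau>_def)
    qed (simp add: half_exp_def)
  qed
  have loop: "runs (Loop (NLess (NConst 1) (var 14)) ?body) (\<sigma>\<lparr>width_var := cap a + 1\<rparr>)
      (loop_time L (step + (close_time + (load_time + (accept_time + step))))) ?Q"
  proof (rule runs_Loop[where I = ?I])
    fix q \<sigma>' assume I: "?I q \<sigma>'" and b: "bval orc (mk \<sigma>') (\<lambda>_ _. 0) (NLess (NConst 1) (var 14))"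
    then have w: "2 \<le> width_var \<sigma>'" by simp
    moreover from this have "0 < q" using I by (cases q) auto
    ultimately show "0 < q \<and> runs ?body \<sigma>' (step + (close_time + (load_time + (accept_time + step)))) (?I (q - 1))"
      using body[OF I] by simp
  next
    fix q \<sigma>' assume I: "?I q \<sigma>'" and b: "\<not> bval orc (mk \<sigma>') (\<lambda>_ _. 0) (NLess (NConst 1) (var 14))"
    then have "width_var \<sigma>' = 1" by simp
    then show "?Q \<sigma>'" using I search_inv_done by auto
  next
    show "?I L (\<sigma>\<lparr>width_var := cap a + 1\<rparr>)"
      using g e r search_inv_init[OF inv a(2), of "cap a + 1"] cl by (auto simp: good_def)
  qed simp
  have eq: "nval (mk \<sigma>) (NAdd (cap_exp (NRead 1 (var 13))) (NConst 1)) = cap a + 1"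
    using g e a by (simp add: good_def a_def)
  show ?thesis
    unfolding search_prog_def search_time_def
    by (rule runs_Seq, rule runs_set(5)) (use loop eq cl in \<open>auto simp: cap_exp_def simp del: nval.simps\<close>)
qed

definition rounds_time :: nat where
  "rounds_time = for_time z (for_time z search_time)"

text \<open>Each round loses an active edge or ends with none, so \<open>m\<close> rounds suffice;
  surplus rounds preserve an empty active set.\<close>

lemma rounds_runs:
  assumes g: "good \<sigma>" and x: "greedy_inv (alloc \<sigma>)"
  shows "runs (for_loop 12 (NRead 0 (NConst 1)) (for_loop 13 (NRead 0 (NConst 1)) search_prog)) \<sigma>
    rounds_time (\<lambda>\<sigma>'. good \<sigma>' \<and> greedy_inv (alloc \<sigma>') \<and> act (alloc \<sigma>') = {})"
  unfolding rounds_time_def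
proof (rule runs_for_loop[where upd = "\<lambda>v \<sigma>. \<sigma>\<lparr>round_var := v\<rparr>" and ctr = round_var and b = m and
    I = "\<lambda>i \<sigma>'. good \<sigma>' \<and> greedy_inv (alloc \<sigma>') \<and> (card (act (alloc \<sigma>')) + i \<le> m \<or> act (alloc \<sigma>') = {})",
    OF mem_of_upd(7)], goal_cases)
  case 9
  have "card (act (alloc \<sigma>)) \<le> card {..<m}" using act_lt by (intro card_mono) auto
  then show ?case using g x by simp
next
  case (10 i \<sigma>')
  define A where "A = act (alloc \<sigma>')"
  show ?case
  proof (rule runs_for_loop[where upd = "\<lambda>v \<sigma>. \<sigma>\<lparr>edge_var := v\<rparr>" and ctr = edge_var and b = m and
      I = "\<lambda>e \<sigma>''. good \<sigma>'' \<and> round_var \<sigma>'' = i \<and> round_inv A e (alloc \<sigma>'')",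
      OF mem_of_upd(8)], goal_cases)
    case 9
    then show ?case using 10 round_inv_init by (simp add: A_def)
  next
    case (10 e \<sigma>'')
    then show ?case using search_runs[of \<sigma>'' e i A] by (auto elim: runs_conseq)
  next
    case (11 \<sigma>'')
    then have d: "greedy_inv (alloc \<sigma>'')" "card (act (alloc \<sigma>'')) < card A \<or> act (alloc \<sigma>'') = {}"
      using round_inv_done[of A "alloc \<sigma>''"] finite_act by (auto simp: A_def)
    then show ?case using 10 11 by (auto simp: A_def)
  qed (use sizes small_less[of m] in \<open>auto simp: good_def\<close>)
next
  case (11 \<sigma>')
  then show ?case using finite_act[of "alloc \<sigma>'"] by auto
qed (use sizes small_less[of m] in \<open>auto simp: good_def\<close>)

definition power_time :: nat where
  "power_time = step + for_time L step"

lemma power_runs: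
  assumes upd: "\<And>\<sigma> v. (mk \<sigma>)(x := (mk \<sigma> x)(0 := v)) = mk (U v \<sigma>)"
    and get: "\<And>\<sigma>. mk \<sigma> x 0 = G \<sigma>" "\<And>\<sigma> v. G (U v \<sigma>) = v" "\<And>\<sigma> v w. U v (U w \<sigma>) = U v \<sigma>"
    and cp: "\<And>\<sigma> v w. U v (\<sigma>\<lparr>copy_var := w\<rparr>) = (U v \<sigma>)\<lparr>copy_var := w\<rparr>"
      "\<And>\<sigma> v. copy_var (U v \<sigma>) = copy_var \<sigma>"
      "\<And>\<sigma> w. G (\<sigma>\<lparr>copy_var := w\<rparr>) = G \<sigma>"
    and b: "\<And>\<sigma>. nval (mk \<sigma>) a = b" "b < L" "nsize a \<le> 100"
    and Q: "\<And>c. Q ((U (2 ^ b) \<sigma>)\<lparr>copy_var := c\<rparr>)"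
  shows "runs (power_prog x a) \<sigma> power_time Q"
  unfolding power_prog_def power_time_def
proof (rule runs_Seq, rule runs_set_var[OF upd])
  have pL: "2 ^ i < (2::nat) ^ L" if "i \<le> b" for i
    using that b by (intro power_strict_increasing) auto
  show "nval (mk \<sigma>) (NConst 1) < 2 ^ L" using pL[of 0] by simp
  show "runs (for_loop 22 a (set_var x (NAdd (var x) (var x)))) (U (nval (mk \<sigma>) (NConst 1)) \<sigma>)
      (for_time L step) Q"
  proof (rule runs_for_loop[where upd = "\<lambda>v \<sigma>. \<sigma>\<lparr>copy_var := v\<rparr>" and ctr = copy_var and b = b and
    I = "\<lambda>i \<sigma>'. \<exists>c. \<sigma>' = (U (2 ^ i) \<sigma>)\<lparr>copy_var := c\<rparr>", OF mem_of_upd(17)], goal_cases)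
    case 9
    then show ?case by (intro exI[of _ "copy_var (U 1 \<sigma>)"]) simp
  next
    case (10 i \<sigma>')
    then obtain c where s: "\<sigma>' = (U (2 ^ i) \<sigma>)\<lparr>copy_var := c\<rparr>" by auto
    have G: "G \<sigma>' = 2 ^ i" by (simp add: s cp get)
    show ?case
    proof (rule runs_set_var[OF upd])
      show "nval (mk \<sigma>') (NAdd (var x) (var x)) < 2 ^ L" using pL[of "Suc i"] 10 by (simp add: get(1) G)
      show "copy_var (U (nval (mk \<sigma>') (NAdd (var x) (var x))) \<sigma>') = i \<and>
          (\<exists>c. U (nval (mk \<sigma>') (NAdd (var x) (var x))) \<sigma>' = (U (2 ^ Suc i) \<sigma>)\<lparr>copy_var := c\<rparr>)"
        using 10 by (auto simp: get cp s mult_2[symmetric] intro!: exI[of _ i])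
    qed simp
  next
    case (8 i \<sigma>')
    then show ?case using b by simp
  next
    case (11 \<sigma>')
    then show ?case using Q by auto
  qed (use b less_trans[OF b(2) less_exp] in auto)
qed simp

lemma round_runs:
  assumes g: "good \<sigma>" and x: "feas (alloc \<sigma>)"
    and Q: "\<And>\<sigma>'. \<forall>i<m. alloc \<sigma>' i = (alloc \<sigma> i + 2 ^ (m * m + 3) div 2) div 2 ^ (m * m + 3) \<Longrightarrow> Q \<sigma>'"
  shows "runs round_prog \<sigma> (for_time z step) Q"
  unfolding round_prog_def
proof (rule runs_for_loop[where upd = "\<lambda>v \<sigma>. \<sigma>\<lparr>copy_var := v\<rparr>" and ctr = copy_var and b = m and
    I = "\<lambda>i \<sigma>'. coarse \<sigma>' = 2 ^ (m * m + 3) \<and> (\<forall>j\<ge>i. alloc \<sigma>' j = alloc \<sigma> j) \<and>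
      (\<forall>j<i. alloc \<sigma>' j = (alloc \<sigma> j + 2 ^ (m * m + 3) div 2) div 2 ^ (m * m + 3))",
    OF mem_of_upd(17)], goal_cases)
  case 9
  then show ?case using g by (simp add: good_def)
next
  case (10 i \<sigma>')
  have v: "nval (mk \<sigma>') (NDiv (NAdd (NRead 5 (var 22)) (half_exp 11)) (var 11))
      = (alloc \<sigma> i + 2 ^ (m * m + 3) div 2) div 2 ^ (m * m + 3)"
    using 10 by (simp add: half_exp_def)
  have "alloc \<sigma> i \<le> cap (fst (es ! i))"
    using feas_le[OF x, of i "fst (es ! i)"] ed_eq[of i] 10 by auto
  then have "alloc \<sigma> i + 1 < 2 ^ L" using cap_less'[OF endpoints_lt(1), of i] 10 by linarith
  moreover have "(alloc \<sigma> i + 2 ^ (m * m + 3) div 2) div 2 ^ (m * m + 3) \<le> alloc \<sigma> i + 1"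
  proof -
    have "(b + q div 2) div q \<le> b + 1" if "1 \<le> q" for b q :: nat
    proof -
      have "b \<le> b * q" using that by simp
      then have "b + q div 2 \<le> (b + 1) * q"
        using div_le_dividend[of q 2] by (simp only: distrib_right mult_1)
      then have "(b + q div 2) div q \<le> (b + 1) * q div q" by (rule div_le_mono)
      then show ?thesis using that by simp
    qed
    then show ?thesis by simp
  qed
  ultimately have vL: "nval (mk \<sigma>') (NDiv (NAdd (NRead 5 (var 22)) (half_exp 11)) (var 11)) < 2 ^ L"
    using v by linarith
  show ?case
  proof (rule runs_arr(1)[where p = i], goal_cases)
    case 3
    show ?case by (rule vL)
  next
    case 4
    show ?case unfolding v using 10 by (auto simp: less_Suc_eq)
  qed (use 10 in \<open>simp_all add: half_exp_def\<close>)
qed (use sizes small_less[of m] Q in \<open>auto simp: half_exp_def\<close>)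

definition total_time :: nat where
  "total_time = power_time + (power_time + (rounds_time + for_time z step))"

lemma equilibrium_prog_runs:
  obtains t \<sigma> x where
    "exec orc equilibrium_prog (input_mem n es bs k) (\<lambda>_ _. 0) t (mk \<sigma>) (\<lambda>_ _. 0)"
    "t \<le> total_time" "greedy_inv x" "act x = {}"
    "\<forall>i<m. mk \<sigma> 5 i = (x i + 2 ^ (m * m + 3) div 2) div 2 ^ (m * m + 3)"
proof -
  define \<sigma>0 where "\<sigma>0 = \<lparr>alloc = \<lambda>_. 0, cand = \<lambda>_. 0, alloc_load = \<lambda>_. 0, cand_load = \<lambda>_. 0,
    grid = 0, coarse = 0, round_var = 0, edge_var = 0, width_var = 0, target_var = 0,
    close_var = 0, gap_var = 0, vertex_var = 0, load_var = 0, sum_var = 0, ok_var = 0, copy_var = 0\<rparr>"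
  have N0: "mk \<sigma>0 = N0"
    by (auto simp: mem_of_def \<sigma>0_def N0_def input_mem_def cell_def fun_eq_iff)
  have "runs equilibrium_prog \<sigma>0 total_time (\<lambda>\<sigma>. \<exists>x. greedy_inv x \<and> act x = {} \<and>
      (\<forall>i<m. alloc \<sigma> i = (x i + 2 ^ (m * m + 3) div 2) div 2 ^ (m * m + 3)))"
    (is "runs _ _ _ ?Q")
    unfolding equilibrium_prog_def total_time_def
  proof (rule runs_Seq, rule power_runs[where b = "k + (m * m + 3)" and U = "\<lambda>v \<sigma>. \<sigma>\<lparr>grid := v\<rparr>" and G = grid,
      OF mem_of_upd(5)], goal_cases)
    case (10 c)
    show ?case
    proof (rule runs_Seq, rule power_runs[where b = "m * m + 3" and U = "\<lambda>v \<sigma>. \<sigma>\<lparr>coarse := v\<rparr>" and G = coarse,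
      OF mem_of_upd(6)], goal_cases)
      case (10 c')
      let ?\<sigma> = "\<sigma>0\<lparr>grid := 2 ^ (k + (m * m + 3)), copy_var := c, coarse := 2 ^ (m * m + 3), copy_var := c'\<rparr>"
      have al: "alloc ?\<sigma> = (\<lambda>_. 0)" by (simp add: \<sigma>0_def)
      have g: "good ?\<sigma>" by (simp add: good_def \<sigma>0_def load_def D_def)
      have "greedy_inv (alloc ?\<sigma>)" using greedy_inv_init al by simp
      then have "runs (for_loop 12 (NRead 0 (NConst 1)) (for_loop 13 (NRead 0 (NConst 1)) search_prog)) ?\<sigma>
        rounds_time (\<lambda>\<sigma>'. good \<sigma>' \<and> greedy_inv (alloc \<sigma>') \<and> act (alloc \<sigma>') = {})"
        by (rule rounds_runs[OF g])
      then show ?case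
      proof (intro runs_Seq, elim runs_conseq)
        fix \<sigma>' assume s: "good \<sigma>' \<and> greedy_inv (alloc \<sigma>') \<and> act (alloc \<sigma>') = {}"
        show "runs round_prog \<sigma>' (for_time z step) ?Q"
          by (rule round_runs) (use s in \<open>auto simp: greedy_inv_def\<close>)
      qed simp
    qed (use bits_le in \<open>auto simp: slope_bits_exp_def\<close>)
  qed (use bits_le in \<open>auto simp: slope_bits_exp_def\<close>)
  moreover have "bounded_mem L (mk \<sigma>0)" using N0_bounded by (simp add: N0 bounded_mem_def)
  ultimately show ?thesis using that unfolding runs_def N0 by (fastforce simp: N0_def)
qed

end

section \<open>Precision of the output and polynomial running time\<close>

lemma rounding_error:
  fixes a q :: nat
  assumes "even q" "0 < q"
  shows "\<bar>real ((a + q div 2) div q) - real a / real q\<bar> \<le> 1 / 2"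
proof -
  define b where "b = (a + q div 2) div q"
  have "b * q \<le> a + q div 2" "a + q div 2 < (b + 1) * q"
    using assms dividend_less_div_times[of q "a + q div 2"] by (auto simp: b_def)
  then have "2 * (b * q) \<le> 2 * a + q" "2 * a + q \<le> 2 * (b * q) + 2 * q"
    using assms(1) by (auto elim!: evenE)
  then have "2 * (real b * q) \<le> 2 * real a + q" "2 * real a + q \<le> 2 * (real b * q) + 2 * q"
    by (metis (mono_tags) of_nat_add of_nat_le_iff of_nat_mult of_nat_numeral)+
  then have "\<bar>real b * q - a\<bar> \<le> q / 2" by linarith
  then have "\<bar>real b * q - a\<bar> / q \<le> q / 2 / q" by (intro divide_right_mono) auto
  moreover have "\<bar>real b * q - a\<bar> / q = \<bar>real b - real a / q\<bar>"
  proof -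
    have "real b - real a / q = (real b * q - a) / q" using assms(2) by (simp add: diff_divide_distrib)
    then show ?thesis by (simp add: abs_divide)
  qed
  ultimately show ?thesis using assms(2) by (simp add: b_def[symmetric])
qed

text \<open>\<open>total_time\<close> unfolded into a function of the input size alone, so that one
  polynomial can be chosen before any game is fixed.\<close>

definition time_bound :: "nat \<Rightarrow> nat" where
  "time_bound z =
     (let L = (z + 3) * (z + 3); st = cost_logic.step L 500;
          lp = cost_logic.loop_time L 500; fr = cost_logic.for_time L 500;
          ce = fr z (st + (st + lp L ((st + st) + st)));
          ld = st + fr z (st + (fr z (st + st) + (st + (st + st))));
          ac = st + fr z (st + st);
          se = st + lp L (st + (ce + (ld + (ac + st))));
          po = st + fr L st
      in po + (po + (fr z (fr z se) + fr z st)))"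

definition polynomial_fun :: "(nat \<Rightarrow> nat) \<Rightarrow> bool" where
  "polynomial_fun T \<longleftrightarrow> (\<exists>p. \<forall>z. T z = poly p z)"

lemma polynomial_fun_intros:
  "polynomial_fun (\<lambda>z. c)" "polynomial_fun (\<lambda>z. z)"
  "polynomial_fun S \<Longrightarrow> polynomial_fun T \<Longrightarrow> polynomial_fun (\<lambda>z. S z + T z)"
  "polynomial_fun S \<Longrightarrow> polynomial_fun T \<Longrightarrow> polynomial_fun (\<lambda>z. S z * T z)"
proof -
  show "polynomial_fun (\<lambda>z. c)" unfolding polynomial_fun_def by (intro exI[of _ "[:c:]"]) simp
  show "polynomial_fun (\<lambda>z. z)" unfolding polynomial_fun_def by (intro exI[of _ "[:0, 1:]"]) simp
  assume "polynomial_fun S" "polynomial_fun T"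
  then obtain p q where "\<And>z. S z = poly p z" "\<And>z. T z = poly q z"
    unfolding polynomial_fun_def by blast
  then show "polynomial_fun (\<lambda>z. S z + T z)" "polynomial_fun (\<lambda>z. S z * T z)"
    unfolding polynomial_fun_def by (metis poly_add, metis poly_mult)
qed

lemma polynomial_cost_logic:
  shows polynomial_step: "polynomial_fun (\<lambda>z. cost_logic.step ((z + 3) * (z + 3)) 500)"
    and polynomial_loop_time: "polynomial_fun Q \<Longrightarrow> polynomial_fun T \<Longrightarrow>
      polynomial_fun (\<lambda>z. cost_logic.loop_time ((z + 3) * (z + 3)) 500 (Q z) (T z))"
    and polynomial_for_time: "polynomial_fun Q \<Longrightarrow> polynomial_fun T \<Longrightarrow>
      polynomial_fun (\<lambda>z. cost_logic.for_time ((z + 3) * (z + 3)) 500 (Q z) (T z))"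
proof -
  have cl: "cost_logic ((z + 3) * (z + 3))" for z by standard simp
  show st: "polynomial_fun (\<lambda>z. cost_logic.step ((z + 3) * (z + 3)) 500)"
    unfolding cost_logic.step_def[OF cl] by (intro polynomial_fun_intros)
  assume QT: "polynomial_fun Q" "polynomial_fun T"
  show "polynomial_fun (\<lambda>z. cost_logic.loop_time ((z + 3) * (z + 3)) 500 (Q z) (T z))"
    unfolding cost_logic.loop_time_def[OF cl] by (intro polynomial_fun_intros st QT)
  show "polynomial_fun (\<lambda>z. cost_logic.for_time ((z + 3) * (z + 3)) 500 (Q z) (T z))"
    unfolding cost_logic.for_time_def[OF cl] cost_logic.loop_time_def[OF cl]
    by (intro polynomial_fun_intros st QT)
qed

lemma polynomial_time_bound: "polynomial_fun time_bound"
  unfolding time_bound_def[abs_def] Let_def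
  by (intro polynomial_cost_logic polynomial_fun_intros)

context encoded_game
begin

lemma total_time_eq: "total_time = time_bound (input_size n es bs k)"
  unfolding total_time_def power_time_def rounds_time_def search_time_def close_time_def
    close_edge_time_def load_time_def load_vertex_time_def accept_time_def
  unfolding L_def z_def time_bound_def Let_def by (rule refl)

text \<open>From \<open>m + 1 \<le> 2 ^ m\<close> the stability factor has at most
  \<open>m * m\<close> bits; three more cover the factor 3 and the halving of the error, which
  reserves the other half for rounding.\<close>

lemma accuracy: "real (m + 1) ^ m * (3 * (1 / real D)) \<le> 1 / 2 / 2 ^ k"
proof -
  have "m + 1 \<le> 2 ^ m" using Suc_leI[OF less_exp[of m]] by simp
  then have "(m + 1) ^ m \<le> (2 ^ m) ^ m" by (rule power_mono) simp
  then have "(m + 1) ^ m * 6 \<le> 2 ^ (m * m) * 2 ^ 3" by (intro mult_mono) (auto simp: power_mult)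
  then have "real ((m + 1) ^ m * 6) \<le> real (2 ^ (m * m) * 2 ^ 3)" by (subst of_nat_le_iff)
  then have "real (m + 1) ^ m * 6 * 2 ^ k \<le> 2 ^ (m * m) * 2 ^ 3 * 2 ^ k"
    by (intro mult_right_mono) (simp_all add: add.commute)
  also have "\<dots> = real D" by (simp add: D_def power_add)
  finally show ?thesis using D_pos by (simp add: field_simps)
qed

text \<open>The program outputs a rounded greedy allocation and never touches an exact equilibrium;
  \<open>blocked_near_approx\<close> supplies one close to the unrounded allocation.\<close>

lemma computes_equilibrium:
  "\<exists>t N R s. exec orc equilibrium_prog (input_mem n es bs k) (\<lambda>_ _. 0) t N R \<and>
     t \<le> time_bound (input_size n es bs k) \<and>
     min_effort_equilibrium {..<n} (edges_of es) (budget_of bs) h s \<and> approximates es k N s"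
proof -
  obtain t \<sigma> x where run: "exec orc equilibrium_prog (input_mem n es bs k)
    (\<lambda>_ _. 0) t (mk \<sigma>) (\<lambda>_ _. 0)"
    "t \<le> total_time" and x: "greedy_inv x" "act x = {}"
    and out: "\<forall>i<m. mk \<sigma> 5 i = (x i + 2 ^ (m * m + 3) div 2) div 2 ^ (m * m + 3)"
    by (rule equilibrium_prog_runs)
  define c where "c e = real (x (inv_into {..<m} ed e)) / D" for e
  have ced: "c (ed i) = real (x i) / D" if "i < m" for i
    using bij_ed that by (simp add: c_def bij_betw_def)
  have "approx_blocked {..<n} (edges_of es) (budget_of bs) h (1 / D) (1 / D) c"
    by (rule greedy_approx_blocked(2)[OF graph bij_ed concave_h budget_nonneg D_pos cap_floor incr_def x ced])
  then obtain s where s: "blocked {..<n} (edges_of es) (budget_of bs) h s"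
    and near: "\<And>e. e \<in> edges_of es \<Longrightarrow>
      \<bar>s e - c e\<bar> \<le> real (m + 1) ^ m * (3 * (1 / D))"
    using blocked_near_approx[OF graph budget_nonneg concave_h continuous_h, of "1 / D" c] D_pos
    unfolding card_edges by auto
  define S where "S = state_of {..<n} (edges_of es) s"
  have "min_effort_equilibrium {..<n} (edges_of es) (budget_of bs) h S"
    unfolding S_def by (rule blocked_imp_equilibrium[OF graph concave_h mono_h s])
  moreover have "approximates es k (mk \<sigma>) S"
    unfolding approximates_def
  proof (intro allI impI ballI)
    fix i v assume i: "i < length es" and v: "v \<in> endpoints (es ! i)"
    have im: "i < m" using i by (simp add: m_def)
    have E: "endpoints (es ! i) \<in> edges_of es" using i by (auto simp: edges_of_def)
    then have "v < n" using v graph by (auto simp: simple_graph_def)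
    then have Sv: "S v (endpoints (es ! i)) = s (ed i)"
      using E v by (simp add: S_def state_of_def incident_def ed_def)
    let ?q = "2 ^ (m * m + 3) :: nat"
    have Dq: "real D = 2 ^ k * real ?q" by (simp add: D_def power_add)
    have "\<bar>real (mk \<sigma> 5 i) - real (x i) / real ?q\<bar> \<le> 1 / 2"
      using rounding_error[of ?q "x i"] out im by simp
    then have "\<bar>real (mk \<sigma> 5 i) - real (x i) / real ?q\<bar> / 2 ^ k \<le> 1 / 2 / 2 ^ k"
      by (intro divide_right_mono) auto
    moreover have "\<bar>real (mk \<sigma> 5 i) - real (x i) / real ?q\<bar> / 2 ^ k = \<bar>real (mk \<sigma> 5 i) / 2 ^ k - c (ed i)\<bar>"
    proof -
      have "real (mk \<sigma> 5 i) / 2 ^ k - c (ed i) = (real (mk \<sigma> 5 i) - real (x i) / real ?q) / 2 ^ k"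
        unfolding ced[OF im] Dq by (simp add: diff_divide_distrib mult.commute)
      then show ?thesis by (simp add: abs_divide)
    qed
    ultimately have "\<bar>real (mk \<sigma> 5 i) / 2 ^ k - c (ed i)\<bar> \<le> 1 / 2 / 2 ^ k" by simp
    moreover have "\<bar>s (ed i) - c (ed i)\<bar> \<le> 1 / 2 / 2 ^ k"
      using near[of "ed i"] E accuracy by (simp add: ed_def)
    ultimately show "\<bar>real (mk \<sigma> 5 i) / 2 ^ k - S v (endpoints (es ! i))\<bar> \<le> 1 / 2 ^ k"
      unfolding Sv by linarith
  qed
  ultimately show ?thesis using run total_time_eq by metis
qed

end

lemma equilibrium_prog_polynomial: "\<exists>c p. computes_equilibria_in_time c (poly p)"
proof -
  obtain p where p: "\<And>z. time_bound z = poly p z"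
    using polynomial_time_bound unfolding polynomial_fun_def by blast
  have "computes_equilibria_in_time equilibrium_prog (poly p)"
    unfolding computes_equilibria_in_time_def
  proof (intro allI impI)
    fix n es bs h k
    assume "valid_input n es bs \<and> (\<forall>e\<in>edges_of es. concave_reward (h e))"
    then interpret encoded_game n es bs h k by unfold_locales auto
    show "\<exists>t N R s. exec (reward_oracle es h) equilibrium_prog (input_mem n es bs k) (\<lambda>_ _. 0) t N R \<and>
        t \<le> poly p (input_size n es bs k) \<and>
        min_effort_equilibrium {..<n} (edges_of es) (budget_of bs) h s \<and> approximates es k N s"
      using computes_equilibrium unfolding p .
  qed
  then show ?thesis by blast
qed

theorem theorem4p8:
  shows
    "(\<forall>(V :: 'a set) E B h.
        simple_graph V E \<and> (\<forall>v\<in>V. B v \<ge> 0) \<and> (\<forall>e\<in>E. concave_reward (h e)) \<longrightarrow>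
        (\<exists>s. min_effort_equilibrium V E B h s)) \<and>
     (\<exists>c p. computes_equilibria_in_time c (poly p)) \<and>
     (\<forall>(V :: 'a set) E B h.
        simple_graph V E \<and> (\<forall>v\<in>V. B v \<ge> 0) \<and> (\<forall>e\<in>E. concave_reward (h e)) \<and>
        (\<forall>e\<in>E. strictly_concave_on {0..} (h e)) \<longrightarrow>
        (\<exists>!s. min_effort_equilibrium V E B h s))"
proof (intro conjI equilibrium_prog_polynomial allI impI)
  fix V :: "'a set" and E and B :: "'a \<Rightarrow> real" and h :: "'a set \<Rightarrow> real \<Rightarrow> real"
  assume "simple_graph V E \<and> (\<forall>v\<in>V. B v \<ge> 0) \<and> (\<forall>e\<in>E. concave_reward (h e))"
  then have G: "simple_graph V E" "\<forall>v\<in>V. B v \<ge> 0"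
    and h: "\<forall>e\<in>E. concave_on {0..} (h e)" "\<forall>e\<in>E. continuous_on {0..} (h e)"
      "\<forall>e\<in>E. mono_on {0..} (h e)"
    by (auto simp: concave_reward_def)
  show "\<exists>s. min_effort_equilibrium V E B h s"
    using blocked_exists[OF G h(1,2)] blocked_imp_equilibrium[OF G(1) h(1,3)] by blast
next
  fix V :: "'a set" and E and B :: "'a \<Rightarrow> real" and h :: "'a set \<Rightarrow> real \<Rightarrow> real"
  assume a: "simple_graph V E \<and> (\<forall>v\<in>V. B v \<ge> 0) \<and> (\<forall>e\<in>E. concave_reward (h e)) \<and>
    (\<forall>e\<in>E. strictly_concave_on {0..} (h e))"
  then have G: "simple_graph V E" "\<forall>v\<in>V. B v \<ge> 0"
    and h: "\<forall>e\<in>E. concave_on {0..} (h e)" "\<forall>e\<in>E. continuous_on {0..} (h e)"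
      "\<forall>e\<in>E. mono_on {0..} (h e)" "\<forall>e\<in>E. strictly_concave_on {0..} (h e)"
    by (auto simp: concave_reward_def)
  show "\<exists>!s. min_effort_equilibrium V E B h s"
  proof (rule ex_ex1I)
    show "\<exists>s. min_effort_equilibrium V E B h s"
      using blocked_exists[OF G h(1,2)] blocked_imp_equilibrium[OF G(1) h(1,3)] by blast
    fix S S' assume "min_effort_equilibrium V E B h S" "min_effort_equilibrium V E B h S'"
    then obtain s s' where s: "blocked V E B h s" "S = state_of V E s"
      "blocked V E B h s'" "S' = state_of V E s'"
      by (metis equilibrium_imp_blocked[OF G(1) h(4,3,1)])
    have "s e = s' e" if "e \<in> E" for e by (rule blocked_unique[OF G(1) h(1,4) s(1,3) that])
    then show "S = S'" unfolding s
      by (auto simp: state_of_def incident_def fun_eq_iff restrict_def)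
  qed
qed

end
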